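(* Let $d=1$, let $v\in\mathbb{R}$ with $|v|<1$, and let $1<q<p<3$. Let $\rho_0^v>0$ be the (unique) strictly positive number such that $I_{\rho^2}=0$ for all $\rho\in(0,\rho_0^v]$ and $I_{\rho^2}<0$ for all $\rho\in(\rho_0^v,\infty)$. Then for any $\rho>\rho_0^v$ the set $$\mathcal{G}=\{e^{i\gamma}u(\cdot+y):\ \gamma\in\mathbb{R},\ y\in\mathbb{R},\ u\in S_\rho \text{ with } E_v(u)=I_{\rho^2}\}$$ is orbitally stable, i.e. for every $\varepsilon>0$ there exists $\delta>0$ such that for any $\psi_0\in H^{1/2}(\mathbb{R})$ with $\inf_{w\in\mathcal{G}}\|w-\psi_0\|_{H^{1/2}}<\delta$ one has $$\sup_{t\in\mathbb{R}}\ \inf_{w\in\mathcal{G}}\|\psi(t,\cdot)-w\|_{H^{1/2}(\mathbb{R})}<\varepsilon,$$ where $\psi$ is the global solution of $i\psi_t=\sqrt{-\partial_x^2}\,\psi+|\psi|^{q-1}\psi-|\psi|^{p-1}\psi$ on $\mathbb{R}\times\mathbb{R}$ with $\psi(0,\cdot)=\psi_0$.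
   Context: $H^{1/2}(\mathbb{R})$ is the usual Sobolev space of complex-valued functions on $\mathbb{R}$, and $\sqrt{-\partial_x^2}$ is the Fourier multiplier with symbol $|\xi|$. For $u\in H^{1/2}(\mathbb{R})$ and $|v|<1$ define $$T_v(u)=\int_{\mathbb{R}}\bar u(x)\,(\sqrt{-\partial_x^2}+iv\,\partial_x)u(x)\,dx=\int_{\mathbb{R}}(|\xi|-v\xi)\,|\mathcal{F}(u)(\xi)|^2\,d\xi$$ ($\mathcal{F}$ the unitary Fourier transform; the first integral is understood through the second), and $$E_v(u)=\frac12T_v(u)+\frac{1}{q+1}\int_{\mathbb{R}}|u|^{q+1}dx-\frac{1}{p+1}\int_{\mathbb{R}}|u|^{p+1}dx.$$ For $\rho>0$ let $S_\rho=\{u\in H^{1/2}(\mathbb{R}):\ \|u\|_{L^2}=\rho\}$ and $I_{\rho^2}=\inf_{u\in S_\rho}E_v(u)$. A number $\rho_0^v$ as in the claim exists. Well-posedness: for $1<q<p<3$ and every $\psi_0\in H^{1/2}(\mathbb{R})$, the Cauchy problem $i\psi_t=\sqrt{-\partial_x^2}\,\psi+|\psi|^{q-1}\psi-|\psi|^{p-1}\psi$, $\psi(0,\cdot)=\psi_0$, has a unique global solution $\psi\in C(\mathbb{R};H^{1/2}(\mathbb{R}))$, and it conserves the mass $\int_{\mathbb{R}}|\psi|^2dx$, the energy $\frac12\int_{\mathbb{R}}\bar\psi\sqrt{-\partial_x^2}\,\psi\,dx+\frac1{q+1}\int_{\mathbb{R}}|\psi|^{q+1}dx-\frac1{p+1}\int_{\mathbb{R}}|\psi|^{p+1}dx$,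 and the momentum $\mathcal{P}(\psi)=-\int_{\mathbb{R}}i\bar\psi\,\partial_x\psi\,dx$; consequently $E_v(\psi(t))=E_v(\psi_0)$ for all $t$. "The solution" in the claim refers to this one. *)

theory Defs
  imports "HOL-Analysis.Analysis"
begin

text \<open>
  Elements of \<open>L\<^sup>2(\<real>)\<close> and of the Sobolev spaces are represented by Borel measurable functions,
  without passing to the quotient by almost everywhere equality; norms and functionals below only
  depend on the class.
\<close>

definition L2 :: "(real \<Rightarrow> complex) set" where
  "L2 = {u \<in> borel_measurable borel. integrable lborel (\<lambda>x. (cmod (u x))\<^sup>2)}"

definition L2_norm :: "(real \<Rightarrow> complex) \<Rightarrow> real" where
  "L2_norm u = sqrt (LINT x|lborel. (cmod (u x))\<^sup>2)"

subsection \<open>The unitary Fourier transform on \<open>L\<^sup>2(\<real>)\<close>\<close>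

definition truncated_fourier :: "real \<Rightarrow> (real \<Rightarrow> complex) \<Rightarrow> real \<Rightarrow> complex" where
  "truncated_fourier R u \<xi> =
     complex_of_real (1 / sqrt (2 * pi)) * (LINT x:{-R..R}|lborel. cis (- (x * \<xi>)) * u x)"

text \<open>
  Plancherel's definition: the transform of \<open>u \<in> L\<^sup>2\<close> is the \<open>L\<^sup>2\<close>-limit of the transforms of the
  integrable functions \<open>u \<cdot> 1\<^bsub>[-R,R]\<^esub>\<close>. The limit is determined up to a null set, and the choice
  operator picks one representative of it.
\<close>

definition is_fourier :: "(real \<Rightarrow> complex) \<Rightarrow> (real \<Rightarrow> complex) \<Rightarrow> bool" where
  "is_fourier u g \<longleftrightarrow> g \<in> L2 \<and>
     ((\<lambda>R. \<integral>\<^sup>+\<xi>. ennreal ((cmod (truncated_fourier R u \<xi> - g \<xi>))\<^sup>2) \<partial>lborel) \<longlongrightarrow> 0) at_top"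

definition fourier :: "(real \<Rightarrow> complex) \<Rightarrow> real \<Rightarrow> complex" where
  "fourier u = (SOME g. is_fourier u g)"

subsection \<open>The space \<open>H\<^bsup>1/2\<^esup>(\<real>)\<close>\<close>

text \<open>The weight is \<open>(1 + |\<xi>|\<^sup>2)\<^bsup>s\<^esup>\<close> with \<open>s = 1/2\<close>.\<close>

definition H_half :: "(real \<Rightarrow> complex) set" where
  "H_half = {u \<in> L2. integrable lborel (\<lambda>\<xi>. (1 + \<xi>\<^sup>2) powr (1/2) * (cmod (fourier u \<xi>))\<^sup>2)}"

definition H_half_norm :: "(real \<Rightarrow> complex) \<Rightarrow> real" where
  "H_half_norm u = sqrt (LINT \<xi>|lborel. (1 + \<xi>\<^sup>2) powr (1/2) * (cmod (fourier u \<xi>))\<^sup>2)"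

text \<open>Extended reals make the distance to the empty set \<open>\<infinity>\<close>.\<close>

definition H_half_dist_set :: "(real \<Rightarrow> complex) \<Rightarrow> (real \<Rightarrow> complex) set \<Rightarrow> ereal" where
  "H_half_dist_set f G = (INF w\<in>G. ereal (H_half_norm (\<lambda>x. f x - w x)))"

subsection \<open>Energy and constrained minimisers\<close>

definition kinetic :: "real \<Rightarrow> (real \<Rightarrow> complex) \<Rightarrow> real" where
  "kinetic v u = (LINT \<xi>|lborel. (\<bar>\<xi>\<bar> - v * \<xi>) * (cmod (fourier u \<xi>))\<^sup>2)"

definition energy :: "real \<Rightarrow> real \<Rightarrow> real \<Rightarrow> (real \<Rightarrow> complex) \<Rightarrow> real" where
  "energy v p q u =
     1 / 2 * kinetic v u
     + 1 / (q + 1) * (LINT x|lborel. cmod (u x) powr (q + 1))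
     - 1 / (p + 1) * (LINT x|lborel. cmod (u x) powr (p + 1))"

definition sphere_L2 :: "real \<Rightarrow> (real \<Rightarrow> complex) set" where
  "sphere_L2 \<rho> = {u \<in> H_half. L2_norm u = \<rho>}"

text \<open>
  \<open>min_energy v p q \<rho>\<close> is \<open>I\<^bsub>\<rho>\<^sup>2\<^esub>\<close>: the argument is the \<open>L\<^sup>2\<close>-norm, not the mass. The infimum is
  taken in the extended reals, since boundedness from below is not part of the definition.
\<close>

definition min_energy :: "real \<Rightarrow> real \<Rightarrow> real \<Rightarrow> real \<Rightarrow> ereal" where
  "min_energy v p q \<rho> = (INF u\<in>sphere_L2 \<rho>. ereal (energy v p q u))"

definition ground_states :: "real \<Rightarrow> real \<Rightarrow> real \<Rightarrow> real \<Rightarrow> (real \<Rightarrow> complex) set" where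
  "ground_states v p q \<rho> =
     {(\<lambda>x. cis \<gamma> * u (x + y)) | \<gamma> y u.
        u \<in> sphere_L2 \<rho> \<and> ereal (energy v p q u) = min_energy v p q \<rho>}"

subsection \<open>The Cauchy problem\<close>

definition nonlinearity :: "real \<Rightarrow> real \<Rightarrow> (real \<Rightarrow> complex) \<Rightarrow> real \<Rightarrow> complex" where
  "nonlinearity p q u x =
     complex_of_real (cmod (u x) powr (q - 1)) * u x
     - complex_of_real (cmod (u x) powr (p - 1)) * u x"

text \<open>
  \<open>\<psi> \<in> C(\<real>; H\<^bsup>1/2\<^esup>)\<close> is differentiable in time with values in \<open>H\<^bsup>-1/2\<^esup>\<close> and satisfies
  \<open>\<i> \<psi>\<^sub>t = \<surd>(-\<partial>\<^sub>x\<^sup>2) \<psi> + |\<psi>|\<^bsup>q-1\<^esup>\<psi> - |\<psi>|\<^bsup>p-1\<^esup>\<psi>\<close> there: the last clause says that the squared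
  \<open>H\<^bsup>-1/2\<^esup>\<close>-norm of \<open>\<i> (\<psi>(t+h) - \<psi>(t)) / h\<close> minus the right-hand side, written on the
  Fourier side, tends to 0 as \<open>h \<rightarrow> 0\<close>. For \<open>1 < q < p < 3\<close> the nonlinear term lies
  in \<open>L\<^sup>2\<close>, by the embedding \<open>H\<^bsup>1/2\<^esup> \<subseteq> L\<^sup>r\<close> for \<open>2 \<le> r < \<infinity>\<close>.
\<close>

definition global_solution ::
    "real \<Rightarrow> real \<Rightarrow> (real \<Rightarrow> complex) \<Rightarrow> (real \<Rightarrow> real \<Rightarrow> complex) \<Rightarrow> bool" where
  "global_solution p q \<psi>0 \<psi> \<longleftrightarrow>
     (\<forall>t. \<psi> t \<in> H_half) \<and>
     (\<forall>t. ((\<lambda>s. H_half_norm (\<lambda>x. \<psi> s x - \<psi> t x)) \<longlongrightarrow> 0) (at t)) \<and>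
     (AE x in lborel. \<psi> 0 x = \<psi>0 x) \<and>
     (\<forall>t. ((\<lambda>h. \<integral>\<^sup>+\<xi>. ennreal ((1 + \<xi>\<^sup>2) powr (-1/2) *
               (cmod (\<i> * (fourier (\<psi> (t + h)) \<xi> - fourier (\<psi> t) \<xi>) / complex_of_real h
                      - (complex_of_real \<bar>\<xi>\<bar> * fourier (\<psi> t) \<xi>
                         + fourier (nonlinearity p q (\<psi> t)) \<xi>)))\<^sup>2) \<partial>lborel)
            \<longlongrightarrow> 0) (at 0))"

definition mass :: "(real \<Rightarrow> complex) \<Rightarrow> real" where
  "mass u = (LINT x|lborel. (cmod (u x))\<^sup>2)"

text \<open>
  \<open>-\<integral> \<i> (cnj u) \<partial>\<^sub>x u dx\<close> for \<open>u \<in> H\<^bsup>1/2\<^esup>\<close>, understood through Plancherel as in \<open>kinetic\<close>: \<open>-\<i> \<partial>\<^sub>x\<close> has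
  symbol \<open>\<xi>\<close>.
\<close>

definition momentum :: "(real \<Rightarrow> complex) \<Rightarrow> real" where
  "momentum u = (LINT \<xi>|lborel. \<xi> * (cmod (fourier u \<xi>))\<^sup>2)"

text \<open>
  Global well-posedness in \<open>H\<^bsup>1/2\<^esup>\<close>, with uniqueness up to null sets at each time, and the
  conservation laws; the conserved energy is \<open>energy 0\<close>.
\<close>

definition globally_well_posed :: "real \<Rightarrow> real \<Rightarrow> bool" where
  "globally_well_posed p q \<longleftrightarrow>
     (\<forall>\<psi>0\<in>H_half. \<exists>\<psi>.
        global_solution p q \<psi>0 \<psi> \<and>
        (\<forall>\<phi>. global_solution p q \<psi>0 \<phi> \<longrightarrow> (\<forall>t. AE x in lborel. \<phi> t x = \<psi> t x)) \<and>
        (\<forall>t. mass (\<psi> t) = mass \<psi>0 \<and>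
             energy 0 p q (\<psi> t) = energy 0 p q \<psi>0 \<and>
             momentum (\<psi> t) = momentum \<psi>0))"

end

theory Submission
  imports Defs "HOL-Probability.Probability" "HOL-Complex_Analysis.Great_Picard"
begin

text \<open>
  A solution keeps its mass and its energy \<open>E\<^sub>v\<close> (which is the conserved energy minus \<open>v/2\<close> times the
  momentum), so instability would produce a minimising sequence on \<open>S\<^sub>\<rho>\<close> (up to \<open>o(1)\<close> in the mass)
  staying away from the ground states. It therefore suffices that such sequences are relatively compact
  in \<open>H\<^bsup>1/2\<^esup>\<close> up to translations.

  By Plancherel the form \<open>\<integral>|\<xi>||F u|\<^sup>2\<close> is a multiple of \<open>\<integral>\<integral>|u(x+h) - u(x)|\<^sup>2/h\<^sup>2\<close>. If \<open>D(x)\<close> denotes the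
  inner integral over \<open>h\<close> and \<open>M(x)\<close> the mass of \<open>u\<close> in \<open>[x,x+1]\<close>, then averaging over \<open>[x,x+s]\<close> gives
  \<open>s|u(x)|\<^sup>2 \<le> 2s\<^sup>2D(x) + 2M(x)\<close> for \<open>s \<le> 1\<close>, hence \<open>|u|\<^sup>4 \<le> 16M(D+M)\<close>: this is both the Sobolev bound
  and the statement that vanishing local masses force \<open>L\<^sup>4\<close>-convergence to zero. Comparison with averages over
  a fine grid gives almost everywhere convergent subsequences.

  Since the infimum is negative, a translated minimising sequence converges almost everywhere to some
  \<open>w \<noteq> 0\<close>, and all terms of the energy split into the contributions of \<open>w\<close> and of the remainder \<open>d\<close>
  (Brezis-Lieb). The dilation \<open>u(\<cdot>/l)\<close> multiplies the mass and the \<open>L\<^sup>r\<close>-terms by \<open>l\<close> and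
  keeps the kinetic term, so a profile of mass \<open>a < \<rho>\<^sup>2\<close> has energy at least
  \<open>(a/\<rho>\<^sup>2) I + (1 - a/\<rho>\<^sup>2) T/2\<close>. Adding these bounds for \<open>w\<close> and \<open>d\<close> excludes a splitting of the mass;
  then \<open>d\<close> tends to zero in \<open>L\<^sup>2\<close>, in \<open>L\<^sup>r\<close> and, by the convergence of the energies, in \<open>H\<^bsup>1/2\<^esup>\<close>.
\<close>

section \<open>Square-integrable functions and convergence\<close>

text \<open>Pointwise convergence is the working notion because one splitting lemma then serves most
  terms: it applies to every \<open>L^r\<close> integral and, the form with symbol |\<xi>| being the
  squared \<open>L^2\<close> norm of a difference quotient on the plane, to that form as well. The
  obstacle created by a non-zero v is the momentum: its symbol \<xi> changes sign, so it is not the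
  power of a norm, and its cross terms need a separate argument. The exponent 4 is dictated by p <
  3. For bounded mass the \<open>L^4\<close> integral grows at most linearly in the kinetic form,
  while p + 1 lies strictly between 2 and 4, so the focusing term is bounded by a small multiple of
  one endpoint integral plus a large multiple of the other. Making the \<open>L^4\<close>
  coefficient small gives coercivity of the energy; making the mass coefficient small gives
  non-vanishing, because a negative energy requires a focusing term that is not small. Since the
  transform is defined by a limit and a choice of representative, its identities hold almost
  everywhere; they are first proved for integrable functions and then carried over by the
  isometry.\<close>

lemma ennreal_tendsto_0I:
  fixes f :: "'b \<Rightarrow> ennreal"
  assumes "\<And>e::real. 0 < e \<Longrightarrow> \<forall>\<^sub>F n in F. f n \<le> ennreal e"
  shows "(f \<longlongrightarrow> 0) F"
proof (rule order_tendstoI)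
  fix a :: ennreal assume "0 < a"
  then obtain b where "0 < b" "b < a" using dense by blast
  then have bt: "b < top" by (meson order_less_le_trans top_greatest)
  then have "0 < enn2real b" using \<open>0 < b\<close> by (simp add: enn2real_positive_iff)
  from assms[OF this] show "\<forall>\<^sub>F n in F. f n < a"
    by (rule eventually_mono) (use bt \<open>b < a\<close> in \<open>auto\<close>)
qed auto

lemma ennreal_tendsto_0D:
  fixes f :: "'b \<Rightarrow> ennreal"
  assumes "(f \<longlongrightarrow> 0) F" "0 < (e::real)"
  shows "\<forall>\<^sub>F n in F. f n < ennreal e"
  using order_tendstoD(2)[OF assms(1), of "ennreal e"] assms(2) by simp

text \<open>Young's inequality without the sharp constant. The free weight \<eta> is what every
  later use exploits.\<close>

lemma product_le_weighted_squares:
  fixes a b \<eta> :: real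
  assumes "0 < \<eta>" "0 \<le> a" "0 \<le> b"
  shows "a * b \<le> \<eta> * a\<^sup>2 + 1 / \<eta> * b\<^sup>2"
proof -
  have "0 \<le> (\<eta> * a - b)\<^sup>2" by simp
  then have "\<eta> * (a * b) * 2 \<le> \<eta>\<^sup>2 * a\<^sup>2 + b\<^sup>2" unfolding power2_diff by (simp add: power_mult_distrib)
  moreover have "0 \<le> \<eta> * (a * b)" using assms by simp
  ultimately have "\<eta> * (a * b) \<le> \<eta>\<^sup>2 * a\<^sup>2 + b\<^sup>2" by linarith
  also have "\<dots> = \<eta> * (\<eta> * a\<^sup>2 + 1 / \<eta> * b\<^sup>2)" using assms by (simp add: distrib_left power2_eq_square mult.assoc)
  finally show ?thesis using assms by simp
qed

text \<open>If b is small against a, the quotient of the norms of a + b and a lies between 1 -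
  \<eta> and 1 + \<eta>, and continuity of the power at 1 yields the factor \<epsilon>. Otherwise
  both norms are at most a multiple of \<open>norm b\<close>, and C pays for them.\<close>

lemma powr_norm_add_bound:
  assumes "0 < r" "0 < (\<epsilon>::real)"
  obtains C :: real where "0 \<le> C"
    "\<And>a b :: 'a::real_normed_vector.
       \<bar>norm (a + b) powr r - norm a powr r\<bar> \<le> \<epsilon> * norm a powr r + C * norm b powr r"
proof -
  have "((\<lambda>h::real. (1 + h) powr r) \<longlongrightarrow> (1 + 0) powr r) (at_right 0)"
    by (intro tendsto_intros) auto
  then have "((\<lambda>h::real. (1 + h) powr r) \<longlongrightarrow> 1) (at_right 0)" by simp
  from order_tendstoD(2)[OF this, of "1 + \<epsilon>"] assms
  have 1: "\<forall>\<^sub>F h in at_right 0. (1 + h) powr r < 1 + \<epsilon>" by simp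
  have "((\<lambda>h::real. (1 - h) powr r) \<longlongrightarrow> (1 - 0) powr r) (at_right 0)"
    by (intro tendsto_intros) auto
  then have "((\<lambda>h::real. (1 - h) powr r) \<longlongrightarrow> 1) (at_right 0)" by simp
  from order_tendstoD(1)[OF this, of "1 - \<epsilon>"] assms
  have 2: "\<forall>\<^sub>F h in at_right 0. 1 - \<epsilon> < (1 - h) powr r" by simp
  have 3: "\<forall>\<^sub>F h::real in at_right 0. h < 1" "\<forall>\<^sub>F h::real in at_right 0. 0 < h"
    by (auto simp: eventually_at_right_less intro: eventually_at_right_real[of 0 1] eventually_mono[OF eventually_at_right_real[of 0 1]])
  obtain \<eta> where \<eta>: "(1 + \<eta>) powr r < 1 + \<epsilon>" "1 - \<epsilon> < (1 - \<eta>) powr r" "\<eta> < 1" "0 < \<eta>"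
    using eventually_happens[OF eventually_conj[OF 1 eventually_conj[OF 2 eventually_conj[OF 3]]]] by auto
  show ?thesis
  proof
    show "0 \<le> (1 + 1 / \<eta>) powr r" by simp
    fix a b :: 'a
    let ?s = "norm (a + b)" and ?t = "norm a" and ?d = "norm b"
    have s: "?s \<le> ?t + ?d" "?t - ?d \<le> ?s"
      using norm_triangle_ineq norm_diff_ineq by blast+
    show "\<bar>?s powr r - ?t powr r\<bar> \<le> \<epsilon> * ?t powr r + (1 + 1 / \<eta>) powr r * ?d powr r"
    proof (cases "?d \<le> \<eta> * ?t")
      case True
      have "?s powr r \<le> ((1 + \<eta>) * ?t) powr r"
        using s True assms by (intro powr_mono2) (auto simp: algebra_simps)
      also have "\<dots> = (1 + \<eta>) powr r * ?t powr r" using \<eta> by (simp add: powr_mult)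
      also have "\<dots> \<le> (1 + \<epsilon>) * ?t powr r" using \<eta> by (intro mult_right_mono) auto
      finally have A: "?s powr r \<le> (1 + \<epsilon>) * ?t powr r" .
      have "(1 - \<epsilon>) * ?t powr r \<le> (1 - \<eta>) powr r * ?t powr r"
        using \<eta> by (intro mult_right_mono) auto
      also have "\<dots> = ((1 - \<eta>) * ?t) powr r" using \<eta> by (simp add: powr_mult)
      also have "\<dots> \<le> ?s powr r"
        using s True assms \<eta> by (intro powr_mono2) (auto simp: left_diff_distrib intro!: mult_left_le_one_le)
      finally have B: "(1 - \<epsilon>) * ?t powr r \<le> ?s powr r" .
      have "0 \<le> (1 + 1 / \<eta>) powr r * ?d powr r" by simp
      with A B show ?thesis unfolding abs_le_iff ring_distribs mult_1 by linarith
    next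
      case False
      then have t: "?t \<le> ?d / \<eta>" using \<eta> by (simp add: field_simps)
      have "?s powr r \<le> ((1 + 1 / \<eta>) * ?d) powr r"
        using s t assms by (intro powr_mono2) (auto simp: algebra_simps)
      moreover have "?t powr r \<le> ((1 + 1 / \<eta>) * ?d) powr r"
        using t assms by (intro powr_mono2) (auto simp: algebra_simps intro: order_trans)
      moreover have "((1 + 1 / \<eta>) * ?d) powr r = (1 + 1 / \<eta>) powr r * ?d powr r"
        using \<eta> by (simp add: powr_mult)
      moreover have "0 \<le> \<epsilon> * ?t powr r" "0 \<le> ?s powr r" "0 \<le> ?t powr r" using assms by auto
      ultimately show ?thesis unfolding abs_le_iff by linarith
    qed
  qed
qed

lemma square_norm_add_bound:
  assumes "0 < (\<epsilon>::real)"
  obtains C :: real where "0 \<le> C"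
    "\<And>a b :: 'a::real_normed_vector. \<bar>(norm (a + b))\<^sup>2 - (norm a)\<^sup>2\<bar> \<le> \<epsilon> * (norm a)\<^sup>2 + C * (norm b)\<^sup>2"
  using powr_norm_add_bound[of 2 \<epsilon>, where 'a = 'a] assms by (auto simp flip: powr_numeral)

text \<open>The truncation behind the Brezis-Lieb lemma: the excess of \<open>F n\<close> over
  \<epsilon> times \<open>G n\<close> is dominated by the fixed function C times H, so dominated
  convergence applies to it, and the rest costs at most \<epsilon> times B.\<close>

lemma vanishing_nn_integral:
  fixes F G :: "nat \<Rightarrow> 'a \<Rightarrow> real" and H :: "'a \<Rightarrow> real"
  assumes F: "\<And>n. F n \<in> borel_measurable M" "\<And>n x. 0 \<le> F n x"
    and G: "\<And>n. G n \<in> borel_measurable M" "\<And>n x. 0 \<le> G n x"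
    and H: "H \<in> borel_measurable M" "\<And>x. 0 \<le> H x"
    and lim: "AE x in M. (\<lambda>n. F n x) \<longlonglongrightarrow> 0"
    and GB: "\<And>n. (\<integral>\<^sup>+x. ennreal (G n x) \<partial>M) \<le> ennreal B"
    and HB: "(\<integral>\<^sup>+x. ennreal (H x) \<partial>M) < \<infinity>"
    and bound: "\<And>\<epsilon>. 0 < \<epsilon> \<Longrightarrow> \<exists>C\<ge>0. \<forall>n x. F n x \<le> \<epsilon> * G n x + C * H x"
  shows "(\<lambda>n. \<integral>\<^sup>+x. ennreal (F n x) \<partial>M) \<longlonglongrightarrow> 0"
proof (rule ennreal_tendsto_0I)
  fix e :: real assume e: "0 < e"
  \<comment> \<open>The absolute value covers a negative B, for which \<open>ennreal B\<close> is 0;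
    the added 1 avoids a division by zero.\<close>
  define \<epsilon> where "\<epsilon> = e / (2 * (\<bar>B\<bar> + 1))"
  have \<epsilon>: "0 < \<epsilon>" using e by (simp add: \<epsilon>_def)
  have \<epsilon>B: "\<epsilon> * \<bar>B\<bar> \<le> e / 2" using e by (simp add: \<epsilon>_def field_simps)
  obtain C where C: "0 \<le> C" "\<And>n x. F n x \<le> \<epsilon> * G n x + C * H x" using bound[OF \<epsilon>] by blast
  define W where "W n x = max 0 (F n x - \<epsilon> * G n x)" for n x
  have W: "\<And>n. W n \<in> borel_measurable M" "\<And>n x. 0 \<le> W n x" "\<And>n x. W n x \<le> F n x"
    "\<And>n x. W n x \<le> C * H x" "\<And>n x. F n x \<le> W n x + \<epsilon> * G n x"
    unfolding W_def using F G C H(2) \<epsilon> by (auto simp: algebra_simps)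
  have "(\<lambda>n. \<integral>\<^sup>+x. ennreal (W n x) \<partial>M) \<longlonglongrightarrow> (\<integral>\<^sup>+x. 0 \<partial>M)"
  proof (rule nn_integral_dominated_convergence[where w = "\<lambda>x. ennreal (C * H x)"])
    have "(\<integral>\<^sup>+x. ennreal (C * H x) \<partial>M) = ennreal C * (\<integral>\<^sup>+x. ennreal (H x) \<partial>M)"
      using C H by (subst nn_integral_cmult[symmetric]) (auto simp: ennreal_mult)
    also have "\<dots> < \<infinity>" using HB by (simp add: ennreal_mult_less_top)
    finally show "(\<integral>\<^sup>+x. ennreal (C * H x) \<partial>M) < \<infinity>" .
    show "AE x in M. (\<lambda>n. ennreal (W n x)) \<longlonglongrightarrow> 0"
      using lim
    proof eventually_elim
      case (elim x)
      have "(\<lambda>n. W n x) \<longlonglongrightarrow> 0"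
        by (rule tendsto_sandwich[OF _ _ tendsto_const elim]) (use W in auto)
      then show ?case using tendsto_ennrealI by fastforce
    qed
  qed (use W H in \<open>auto intro!: ennreal_leI\<close>)
  then have "(\<lambda>n. \<integral>\<^sup>+x. ennreal (W n x) \<partial>M) \<longlonglongrightarrow> 0" by simp
  from ennreal_tendsto_0D[OF this, of "e / 2"] e
  have "\<forall>\<^sub>F n in sequentially. (\<integral>\<^sup>+x. ennreal (W n x) \<partial>M) < ennreal (e / 2)" by simp
  then show "\<forall>\<^sub>F n in sequentially. (\<integral>\<^sup>+x. ennreal (F n x) \<partial>M) \<le> ennreal e"
  proof eventually_elim
    case (elim n)
    have "(\<integral>\<^sup>+x. ennreal (F n x) \<partial>M) \<le> (\<integral>\<^sup>+x. (ennreal (W n x) + ennreal \<epsilon> * ennreal (G n x)) \<partial>M)"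
      using W \<epsilon> G by (intro nn_integral_mono) (simp add: ennreal_leI flip: ennreal_plus ennreal_mult)
    also have "\<dots> = (\<integral>\<^sup>+x. ennreal (W n x) \<partial>M) + ennreal \<epsilon> * (\<integral>\<^sup>+x. ennreal (G n x) \<partial>M)"
      using W G by (simp add: nn_integral_add nn_integral_cmult)
    also have "\<dots> \<le> ennreal (e / 2) + ennreal \<epsilon> * ennreal \<bar>B\<bar>"
      using elim GB[of n] by (intro add_mono mult_left_mono) (auto intro: order_trans ennreal_leI less_imp_le)
    also have "\<dots> \<le> ennreal e"
      using \<epsilon> \<epsilon>B e by (simp flip: ennreal_plus ennreal_mult)
    finally show ?case .
  qed
qed

text \<open>The Riesz-Fischer argument: along a subsequence the increments have geometrically
  decaying integrals, so their sum is finite almost everywhere and the partial sums telescope. Only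
  differences are measured; the functions themselves may fail to be integrable.\<close>

lemma Cauchy_L1_AE_subseq:
  fixes f :: "nat \<Rightarrow> 'a \<Rightarrow> 'b::{banach, second_countable_topology}"
  assumes f[measurable]: "\<And>n. f n \<in> borel_measurable M"
    and cau: "\<And>e::real. 0 < e \<Longrightarrow> \<exists>N. \<forall>i\<ge>N. \<forall>j\<ge>N. (\<integral>\<^sup>+x. ennreal (norm (f i x - f j x)) \<partial>M) \<le> ennreal e"
  obtains r :: "nat \<Rightarrow> nat" and g where "strict_mono r" "g \<in> borel_measurable M"
    "AE x in M. (\<lambda>n. f (r n) x) \<longlonglongrightarrow> g x"
proof -
  have "\<forall>k. \<exists>N. \<forall>i\<ge>N. \<forall>j\<ge>N. (\<integral>\<^sup>+x. ennreal (norm (f i x - f j x)) \<partial>M) \<le> ennreal ((1/2) ^ k)"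
    using cau by simp
  then obtain N where N: "\<And>k i j. i \<ge> N k \<Longrightarrow> j \<ge> N k \<Longrightarrow>
    (\<integral>\<^sup>+x. ennreal (norm (f i x - f j x)) \<partial>M) \<le> ennreal ((1/2) ^ k)" by metis
  \<comment> \<open>\<open>Suc m\<close> makes the indices strictly increasing,
    \<open>N (Suc k)\<close> keeps each index beyond the Cauchy threshold of its accuracy.\<close>
  define r where "r = rec_nat (N 0) (\<lambda>k m. max (Suc m) (N (Suc k)))"
  have r0: "r 0 = N 0" and rS: "\<And>k. r (Suc k) = max (Suc (r k)) (N (Suc k))" by (auto simp: r_def)
  have mono: "strict_mono r" by (rule strict_monoI_Suc) (simp add: rS)
  have rN: "N k \<le> r k" for k by (cases k) (auto simp: r0 rS)
  have d: "(\<integral>\<^sup>+x. ennreal (norm (f (r (Suc k)) x - f (r k) x)) \<partial>M) \<le> ennreal ((1/2) ^ k)" for k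
    using rN[of k] rS[of k] by (intro N) auto
  have "(\<integral>\<^sup>+x. (\<Sum>k. ennreal (norm (f (r (Suc k)) x - f (r k) x))) \<partial>M)
      = (\<Sum>k. \<integral>\<^sup>+x. ennreal (norm (f (r (Suc k)) x - f (r k) x)) \<partial>M)"
    by (rule nn_integral_suminf) measurable
  also have "\<dots> \<le> (\<Sum>k. ennreal ((1/2) ^ k))" by (rule suminf_le[OF d]) auto
  also have "\<dots> = ennreal (\<Sum>k. (1/2) ^ k)" by (rule suminf_ennreal2) (auto simp: summable_geometric)
  also have "\<dots> < \<infinity>" by simp
  finally have fin: "(\<integral>\<^sup>+x. (\<Sum>k. ennreal (norm (f (r (Suc k)) x - f (r k) x))) \<partial>M) \<noteq> \<infinity>" by simp
  have "AE x in M. (\<Sum>k. ennreal (norm (f (r (Suc k)) x - f (r k) x))) \<noteq> \<infinity>"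
    by (rule nn_integral_PInf_AE[OF _ fin]) measurable
  then have conv: "AE x in M. convergent (\<lambda>n. f (r n) x)"
  proof eventually_elim
    case (elim x)
    then have "summable (\<lambda>k. norm (f (r (Suc k)) x - f (r k) x))"
      by (intro summable_suminf_not_top) auto
    then have "summable (\<lambda>k. f (r (Suc k)) x - f (r k) x)" by (rule summable_norm_cancel)
    then have "convergent (\<lambda>n. \<Sum>k<n. f (r (Suc k)) x - f (r k) x)"
      by (simp add: summable_iff_convergent)
    then have "convergent (\<lambda>n. f (r n) x - f (r 0) x)" by (subst (asm) sum_lessThan_telescope)
    then have "convergent (\<lambda>n. (f (r n) x - f (r 0) x) + f (r 0) x)"
      by (rule convergent_add[OF _ convergent_const])
    then show ?case by simp
  qed
  show ?thesis
  proof
    show "strict_mono r" by fact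
    show "(\<lambda>x. lim (\<lambda>n. f (r n) x)) \<in> borel_measurable M" by measurable
    show "AE x in M. (\<lambda>n. f (r n) x) \<longlonglongrightarrow> lim (\<lambda>n. f (r n) x)"
      using conv by eventually_elim (simp add: convergent_LIMSEQ_iff)
  qed
qed

section \<open>Squared \<open>L^2\<close> norms with values in the extended half-line\<close>

text \<open>\<open>mass\<close> is a Bochner integral and defaults to 0 when the square is not
  integrable. This version detects membership in \<open>L2\<close> and carries no integrability side
  conditions.\<close>

definition nmass :: "(real \<Rightarrow> complex) \<Rightarrow> ennreal" where
  "nmass u = (\<integral>\<^sup>+x. ennreal ((cmod (u x))\<^sup>2) \<partial>lborel)"

lemma L2_iff: "u \<in> L2 \<longleftrightarrow> u \<in> borel_measurable borel \<and> nmass u < \<infinity>"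
  unfolding L2_def nmass_def by (auto simp: integrable_iff_bounded)

lemma L2_measurable[measurable_dest]: "u \<in> L2 \<Longrightarrow> u \<in> borel_measurable borel"
  by (simp add: L2_iff)

lemma L2_nmass: "u \<in> L2 \<Longrightarrow> nmass u < \<infinity>" "u \<in> L2 \<Longrightarrow> nmass u < top"
  by (simp_all add: L2_iff)

lemma mass_nonneg: "0 \<le> mass u"
  by (simp add: mass_def)

lemma nmass_eq_mass: "u \<in> L2 \<Longrightarrow> nmass u = ennreal (mass u)"
  unfolding L2_def nmass_def mass_def by (auto intro!: nn_integral_eq_integral)

lemma nmass_cong_AE: "AE x in lborel. u x = w x \<Longrightarrow> nmass u = nmass w"
  unfolding nmass_def by (intro nn_integral_cong_AE) auto

lemma norm_add_square_le:
  fixes a b :: "'a::real_normed_vector"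
  shows "(norm (a + b))\<^sup>2 \<le> 2 * (norm a)\<^sup>2 + 2 * (norm b)\<^sup>2"
proof -
  have "(norm (a + b))\<^sup>2 \<le> (norm a + norm b)\<^sup>2" by (simp add: norm_triangle_ineq)
  also have "\<dots> \<le> 2 * (norm a)\<^sup>2 + 2 * (norm b)\<^sup>2"
    using sum_squares_bound[of "norm a" "norm b"] by (simp add: power2_sum)
  finally show ?thesis .
qed

lemma nmass_add_le:
  assumes [measurable]: "u \<in> borel_measurable borel" "w \<in> borel_measurable borel"
  shows "nmass (\<lambda>x. u x + w x) \<le> 2 * nmass u + 2 * nmass w"
proof -
  have "nmass (\<lambda>x. u x + w x)
      \<le> (\<integral>\<^sup>+x. (2 * ennreal ((cmod (u x))\<^sup>2) + 2 * ennreal ((cmod (w x))\<^sup>2)) \<partial>lborel)"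
    unfolding nmass_def
    by (intro nn_integral_mono)
       (use norm_add_square_le in \<open>simp add: ennreal_leI flip: ennreal_plus ennreal_mult ennreal_numeral\<close>)
  also have "\<dots> = 2 * nmass u + 2 * nmass w"
    unfolding nmass_def by (simp add: nn_integral_add nn_integral_cmult)
  finally show ?thesis .
qed

lemma nmass_cmult: "u \<in> borel_measurable borel \<Longrightarrow> nmass (\<lambda>x. c * u x) = ennreal ((cmod c)\<^sup>2) * nmass u"
  unfolding nmass_def
  by (subst nn_integral_cmult[symmetric]) (auto simp: norm_mult power_mult_distrib ennreal_mult)

lemma nmass_uminus: "nmass (\<lambda>x. - u x) = nmass u"
  by (simp add: nmass_def)

lemma nmass_minus_commute: "nmass (\<lambda>x. u x - w x) = nmass (\<lambda>x. w x - u x)"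
  by (simp add: nmass_def norm_minus_commute)

lemma nmass_diff_le:
  assumes "u \<in> borel_measurable borel" "w \<in> borel_measurable borel"
  shows "nmass (\<lambda>x. u x - w x) \<le> 2 * nmass u + 2 * nmass w"
  using nmass_add_le[of u "\<lambda>x. - w x"] assms by (simp add: nmass_uminus)

lemma nmass_triangle:
  assumes "u \<in> borel_measurable borel" "w \<in> borel_measurable borel" "z \<in> borel_measurable borel"
  shows "nmass (\<lambda>x. u x - z x) \<le> 2 * nmass (\<lambda>x. u x - w x) + 2 * nmass (\<lambda>x. w x - z x)"
  using nmass_add_le[of "\<lambda>x. u x - w x" "\<lambda>x. w x - z x"] assms by simp

lemma L2_add: "u \<in> L2 \<Longrightarrow> w \<in> L2 \<Longrightarrow> (\<lambda>x. u x + w x) \<in> L2"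
  using nmass_add_le[of u w] by (auto simp: L2_iff intro: le_less_trans simp: ennreal_mult_less_top)

lemma L2_uminus: "u \<in> L2 \<Longrightarrow> (\<lambda>x. - u x) \<in> L2"
  by (auto simp: L2_iff nmass_uminus)

lemma L2_diff: "u \<in> L2 \<Longrightarrow> w \<in> L2 \<Longrightarrow> (\<lambda>x. u x - w x) \<in> L2"
  using L2_add[OF _ L2_uminus, of u w] by simp

lemma L2_cmult: "u \<in> L2 \<Longrightarrow> (\<lambda>x. c * u x) \<in> L2"
  by (auto simp: L2_iff nmass_cmult ennreal_mult_less_top)

lemma nn_integral_translate:
  fixes y :: real
  assumes "f \<in> borel_measurable borel"
  shows "(\<integral>\<^sup>+x. f (x + y) \<partial>lborel) = (\<integral>\<^sup>+x. f x \<partial>lborel)"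
  using nn_integral_real_affine[of f 1 y] assms by (simp add: add.commute)

lemma nn_integral_dilate:
  assumes "f \<in> borel_measurable borel" "0 < (l::real)"
  shows "(\<integral>\<^sup>+x. f (x / l) \<partial>lborel) = ennreal l * (\<integral>\<^sup>+x. f x \<partial>lborel)"
  using nn_integral_real_affine[of "\<lambda>x. f (x / l)" l 0] assms by simp

lemma nmass_translate: "u \<in> borel_measurable borel \<Longrightarrow> nmass (\<lambda>x. u (x + y)) = nmass u"
  unfolding nmass_def using nn_integral_translate[of "\<lambda>x. ennreal ((cmod (u x))\<^sup>2)" y] by simp

lemma nmass_dilate:
  "u \<in> borel_measurable borel \<Longrightarrow> 0 < l \<Longrightarrow> nmass (\<lambda>x. u (x / l)) = ennreal l * nmass u"
  unfolding nmass_def using nn_integral_dilate[of "\<lambda>x. ennreal ((cmod (u x))\<^sup>2)" l] by simp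

lemma L2_translate: "u \<in> L2 \<Longrightarrow> (\<lambda>x. u (x + y)) \<in> L2"
  by (auto simp: L2_iff nmass_translate)

lemma L2_dilate: "u \<in> L2 \<Longrightarrow> 0 < l \<Longrightarrow> (\<lambda>x. u (x / l)) \<in> L2"
  by (auto simp: L2_iff nmass_dilate ennreal_mult_less_top)

text \<open>Both directions carry the error \<epsilon> times \<open>nmass w\<close> of the fixed
  function w, so that \<epsilon> and C can be chosen before the index of a sequence.\<close>

lemma nmass_tendsto_aux:
  assumes u: "u \<in> borel_measurable borel" and w: "w \<in> borel_measurable borel"
    and C: "\<And>a b::complex. \<bar>(norm (a + b))\<^sup>2 - (norm a)\<^sup>2\<bar> \<le> \<epsilon> * (norm a)\<^sup>2 + C * (norm b)\<^sup>2"
    and "0 \<le> C" "0 < \<epsilon>"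
  shows "nmass u \<le> nmass w + ennreal \<epsilon> * nmass w + ennreal C * nmass (\<lambda>x. u x - w x)"
    and "nmass w \<le> nmass u + ennreal \<epsilon> * nmass w + ennreal C * nmass (\<lambda>x. u x - w x)"
proof -
  note [measurable] = u w
  have "(cmod (u x))\<^sup>2 \<le> (cmod (w x))\<^sup>2 + \<epsilon> * (cmod (w x))\<^sup>2 + C * (cmod (u x - w x))\<^sup>2"
    "(cmod (w x))\<^sup>2 \<le> (cmod (u x))\<^sup>2 + \<epsilon> * (cmod (w x))\<^sup>2 + C * (cmod (u x - w x))\<^sup>2" for x
    using C[of "w x" "u x - w x"] by (auto simp: abs_le_iff)
  note * = this
  have "nmass u \<le> (\<integral>\<^sup>+x. (ennreal ((cmod (w x))\<^sup>2) + ennreal \<epsilon> * ennreal ((cmod (w x))\<^sup>2) +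
      ennreal C * ennreal ((cmod (u x - w x))\<^sup>2)) \<partial>lborel)"
    unfolding nmass_def using *(1) assms(4,5)
    by (intro nn_integral_mono) (simp add: ennreal_leI flip: ennreal_plus ennreal_mult)
  also have "\<dots> = nmass w + ennreal \<epsilon> * nmass w + ennreal C * nmass (\<lambda>x. u x - w x)"
    unfolding nmass_def by (simp add: nn_integral_add nn_integral_cmult)
  finally show "nmass u \<le> nmass w + ennreal \<epsilon> * nmass w + ennreal C * nmass (\<lambda>x. u x - w x)" .
  have "nmass w \<le> (\<integral>\<^sup>+x. (ennreal ((cmod (u x))\<^sup>2) + ennreal \<epsilon> * ennreal ((cmod (w x))\<^sup>2) +
      ennreal C * ennreal ((cmod (u x - w x))\<^sup>2)) \<partial>lborel)"
    unfolding nmass_def using *(2) assms(4,5)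
    by (intro nn_integral_mono) (simp add: ennreal_leI flip: ennreal_plus ennreal_mult)
  also have "\<dots> = nmass u + ennreal \<epsilon> * nmass w + ennreal C * nmass (\<lambda>x. u x - w x)"
    unfolding nmass_def by (simp add: nn_integral_add nn_integral_cmult)
  finally show "nmass w \<le> nmass u + ennreal \<epsilon> * nmass w + ennreal C * nmass (\<lambda>x. u x - w x)" .
qed

lemma mass_tendsto:
  fixes f :: "nat \<Rightarrow> real \<Rightarrow> complex"
  assumes f: "\<And>n. f n \<in> L2" and w: "w \<in> L2"
    and lim: "(\<lambda>n. nmass (\<lambda>x. f n x - w x)) \<longlonglongrightarrow> 0"
  shows "(\<lambda>n. mass (f n)) \<longlonglongrightarrow> mass w"
proof (rule LIMSEQ_I)
  fix e :: real assume e: "0 < e"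
  define \<epsilon> where "\<epsilon> = e / (2 * (mass w + 1))"
  have \<epsilon>: "0 < \<epsilon>" "\<epsilon> * mass w < e / 2" using e mass_nonneg[of w]
    by (auto simp: \<epsilon>_def field_simps add_pos_nonneg)
  obtain C where C: "0 \<le> C"
    "\<And>a b::complex. \<bar>(norm (a + b))\<^sup>2 - (norm a)\<^sup>2\<bar> \<le> \<epsilon> * (norm a)\<^sup>2 + C * (norm b)\<^sup>2"
    using square_norm_add_bound[OF \<epsilon>(1), where 'a = complex] by blast
  have "\<forall>\<^sub>F n in sequentially. nmass (\<lambda>x. f n x - w x) < ennreal (e / (2 * (C + 1)))"
    by (rule ennreal_tendsto_0D[OF lim]) (use e C in auto)
  then obtain N where N: "\<And>n. n \<ge> N \<Longrightarrow> nmass (\<lambda>x. f n x - w x) < ennreal (e / (2 * (C + 1)))"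
    by (auto simp: eventually_sequentially)
  show "\<exists>N. \<forall>n\<ge>N. norm (mass (f n) - mass w) < e"
  proof (intro exI[of _ N] allI impI)
    fix n assume n: "N \<le> n"
    let ?d = "mass (\<lambda>x. f n x - w x)"
    have "?d < e / (2 * (C + 1))"
      using N[OF n] nmass_eq_mass[OF L2_diff[OF f w]] by (simp add: ennreal_less_iff mass_nonneg)
    then have "(C + 1) * ?d < e / 2" using C by (simp add: field_simps)
    then have d: "C * ?d < e / 2" using mass_nonneg[of "\<lambda>x. f n x - w x"] by (simp add: algebra_simps)
    have "ennreal (mass (f n)) \<le> ennreal (mass w + \<epsilon> * mass w + C * ?d)"
      "ennreal (mass w) \<le> ennreal (mass (f n) + \<epsilon> * mass w + C * ?d)"
      using nmass_tendsto_aux[OF L2_measurable[OF f] L2_measurable[OF w] C(2) C(1) \<epsilon>(1), of n]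
        nmass_eq_mass[OF L2_diff[OF f w]] nmass_eq_mass[OF f] nmass_eq_mass[OF w] C(1) \<epsilon>(1)
      by (simp_all add: mass_nonneg ennreal_plus ennreal_mult)
    moreover have "0 \<le> mass w + \<epsilon> * mass w + C * ?d" "0 \<le> mass (f n) + \<epsilon> * mass w + C * ?d"
      using C(1) \<epsilon>(1) by (auto intro!: add_nonneg_nonneg mult_nonneg_nonneg mass_nonneg)
    ultimately have "mass (f n) \<le> mass w + \<epsilon> * mass w + C * ?d" "mass w \<le> mass (f n) + \<epsilon> * mass w + C * ?d"
      by (simp_all only: ennreal_le_iff)
    then show "norm (mass (f n) - mass w) < e" using d \<epsilon>(2) by (simp add: abs_less_iff)
  qed
qed

section \<open>A finite reference measure and completeness of \<open>L^2\<close>\<close>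

text \<open>A finite measure with the null sets of Lebesgue measure. Functions in \<open>L2\<close>
  and bounded functions are both integrable against it, which makes its \<open>L^1\<close> distance
  a convenient gauge of local convergence.\<close>

definition weighted :: "real measure" where
  "weighted = density lborel (\<lambda>x. ennreal (1 / (1 + x\<^sup>2)))"

lemma one_plus_square_pos: "0 < 1 + (x::real)\<^sup>2"
  by (simp add: add_pos_nonneg)

lemma sets_weighted[measurable_cong, simp]: "sets weighted = sets borel"
  by (simp add: weighted_def)

lemma nn_integral_weighted:
  "f \<in> borel_measurable borel \<Longrightarrow>
    (\<integral>\<^sup>+x. f x \<partial>weighted) = (\<integral>\<^sup>+x. ennreal (1 / (1 + x\<^sup>2)) * f x \<partial>lborel)"
  unfolding weighted_def by (subst nn_integral_density) auto

lemma AE_weighted: "(AE x in weighted. P x) \<longleftrightarrow> (AE x in lborel. P x)"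
  unfolding weighted_def by (subst AE_density) (auto simp: one_plus_square_pos)

lemma space_weighted[simp]: "space weighted = UNIV"
  by (simp add: weighted_def)

lemma emeasure_weighted: "emeasure weighted UNIV = (\<integral>\<^sup>+x. ennreal (1 / (1 + x\<^sup>2)) \<partial>lborel)"
  using nn_integral_weighted[of "\<lambda>_. 1"] by simp

lemma finite_weighted: "emeasure weighted UNIV < \<infinity>"
proof -
  have "integrable lborel (\<lambda>x::real. inverse (1 + x\<^sup>2))"
    using integrable_inverse_1_plus_square by (simp add: set_integrable_def)
  then have "(\<integral>\<^sup>+x. ennreal (inverse (1 + x\<^sup>2)) \<partial>lborel) < \<infinity>"
    by (simp add: integrable_iff_bounded add_nonneg_nonneg)
  then show ?thesis by (simp add: emeasure_weighted inverse_eq_divide)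
qed

text \<open>From |u| \<le> s + |u|^2 / s and a density of at most 1. First s is taken small, then
  the squared norm is small against s.\<close>

lemma weighted_le_nmass:
  fixes u :: "real \<Rightarrow> complex"
  assumes [measurable]: "u \<in> borel_measurable borel" and "0 < s"
  shows "(\<integral>\<^sup>+x. ennreal (cmod (u x)) \<partial>weighted)
    \<le> ennreal s * emeasure weighted UNIV + ennreal (1 / s) * nmass u"
proof -
  have *: "1 / (1 + x\<^sup>2) * cmod (u x) \<le> 1 / (1 + x\<^sup>2) * s + 1 / s * (cmod (u x))\<^sup>2" for x
  proof -
    have "cmod (u x) \<le> s + 1 / s * (cmod (u x))\<^sup>2"
      using product_le_weighted_squares[OF \<open>0 < s\<close>, of 1 "cmod (u x)"] by simp
    then have "1 / (1 + x\<^sup>2) * cmod (u x) \<le> 1 / (1 + x\<^sup>2) * (s + 1 / s * (cmod (u x))\<^sup>2)"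
      by (intro mult_left_mono) (auto simp: one_plus_square_pos less_imp_le)
    also have "\<dots> = 1 / (1 + x\<^sup>2) * s + 1 / (1 + x\<^sup>2) * (1 / s * (cmod (u x))\<^sup>2)" by (simp add: distrib_left)
    also have "\<dots> \<le> 1 / (1 + x\<^sup>2) * s + 1 * (1 / s * (cmod (u x))\<^sup>2)"
      using \<open>0 < s\<close> by (intro add_left_mono mult_right_mono) (auto simp: one_plus_square_pos divide_le_eq)
    finally show ?thesis by simp
  qed
  have "(\<integral>\<^sup>+x. ennreal (cmod (u x)) \<partial>weighted) = (\<integral>\<^sup>+x. ennreal (1 / (1 + x\<^sup>2) * cmod (u x)) \<partial>lborel)"
    by (subst nn_integral_weighted)
       (auto intro!: nn_integral_cong simp: less_imp_le[OF one_plus_square_pos] simp flip: ennreal_mult)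
  also have "\<dots> \<le> (\<integral>\<^sup>+x. (ennreal s * ennreal (1 / (1 + x\<^sup>2)) + ennreal (1 / s) * ennreal ((cmod (u x))\<^sup>2)) \<partial>lborel)"
    using * \<open>0 < s\<close> by (intro nn_integral_mono)
      (simp add: ennreal_leI less_imp_le[OF one_plus_square_pos] mult.commute[of s] flip: ennreal_plus ennreal_mult)
  also have "\<dots> = ennreal s * emeasure weighted UNIV + ennreal (1 / s) * nmass u"
    by (simp add: nn_integral_add nn_integral_cmult nmass_def emeasure_weighted)
  finally show ?thesis .
qed

lemma L2_Fatou:
  fixes f :: "nat \<Rightarrow> real \<Rightarrow> complex"
  assumes [measurable]: "\<And>n. f n \<in> borel_measurable borel" "g \<in> borel_measurable borel"
    and ae: "AE x in lborel. (\<lambda>n. f n x) \<longlonglongrightarrow> g x"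
    and le: "\<forall>\<^sub>F n in sequentially. nmass (f n) \<le> B"
  shows "nmass g \<le> B"
proof -
  have "nmass g = (\<integral>\<^sup>+x. liminf (\<lambda>n. ennreal ((cmod (f n x))\<^sup>2)) \<partial>lborel)"
    unfolding nmass_def
  proof (rule nn_integral_cong_AE, use ae in eventually_elim)
    case (elim x)
    have "(\<lambda>n. ennreal ((cmod (f n x))\<^sup>2)) \<longlonglongrightarrow> ennreal ((cmod (g x))\<^sup>2)"
      by (intro tendsto_intros elim)
    then show ?case by (intro lim_imp_Liminf[symmetric]) simp
  qed
  also have "\<dots> \<le> liminf (\<lambda>n. nmass (f n))"
    unfolding nmass_def by (rule nn_integral_liminf) measurable
  also have "\<dots> \<le> limsup (\<lambda>n. nmass (f n))" by (rule Liminf_le_Limsup) simp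
  also have "\<dots> \<le> B" by (rule Limsup_bounded[OF le])
  finally show ?thesis .
qed

text \<open>A Cauchy sequence in \<open>L2\<close> is Cauchy for the weighted \<open>L^1\<close>
  distance and has an almost everywhere convergent subsequence. Fatou's lemma along it bounds the
  distance of the full sequence to the limit.\<close>

lemma L2_complete:
  fixes f :: "nat \<Rightarrow> real \<Rightarrow> complex"
  assumes f: "\<And>n. f n \<in> L2"
    and cau: "\<And>e::real. 0 < e \<Longrightarrow> \<exists>N. \<forall>i\<ge>N. \<forall>j\<ge>N. nmass (\<lambda>x. f i x - f j x) \<le> ennreal e"
  obtains g where "g \<in> L2" "(\<lambda>n. nmass (\<lambda>x. f n x - g x)) \<longlonglongrightarrow> 0"
proof -
  note [measurable] = L2_measurable[OF f]
  obtain W where W: "emeasure weighted UNIV = ennreal W" "0 \<le> W"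
    using finite_weighted by (cases "emeasure weighted UNIV") auto
  have cau': "\<exists>N. \<forall>i\<ge>N. \<forall>j\<ge>N. (\<integral>\<^sup>+x. ennreal (norm (f i x - f j x)) \<partial>weighted) \<le> ennreal e" if e: "0 < e" for e :: real
  proof -
    \<comment> \<open>The constant term then costs at most e / 2, and differences with squared norm
      at most s e / 2 cost another e / 2.\<close>
    define s where "s = e / (2 * (W + 1))"
    have s: "0 < s" "s * W \<le> e / 2" using e W by (auto simp: s_def field_simps)
    obtain N where N: "\<And>i j. i \<ge> N \<Longrightarrow> j \<ge> N \<Longrightarrow> nmass (\<lambda>x. f i x - f j x) \<le> ennreal (s * e / 2)"
      using cau[of "s * e / 2"] s e by auto
    have "(\<integral>\<^sup>+x. ennreal (norm (f i x - f j x)) \<partial>weighted) \<le> ennreal e" if "i \<ge> N" "j \<ge> N" for i j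
    proof -
      have "(\<integral>\<^sup>+x. ennreal (norm (f i x - f j x)) \<partial>weighted)
         \<le> ennreal s * ennreal W + ennreal (1 / s) * ennreal (s * e / 2)"
        using s(1) N[OF that] unfolding W(1)[symmetric]
        by (intro order_trans[OF weighted_le_nmass[of "\<lambda>x. f i x - f j x" s]] add_left_mono mult_left_mono) auto
      also have "\<dots> = ennreal (s * W + e / 2)"
        using s W e by (simp flip: ennreal_plus ennreal_mult)
      also have "\<dots> \<le> ennreal e" using s by (intro ennreal_leI) auto
      finally show ?thesis .
    qed
    then show ?thesis by blast
  qed
  have fm: "f n \<in> borel_measurable weighted" for n by simp
  obtain r g where r: "strict_mono r" and g: "g \<in> borel_measurable weighted"
    and ae: "AE x in weighted. (\<lambda>n. f (r n) x) \<longlonglongrightarrow> g x"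
    using Cauchy_L1_AE_subseq[OF fm cau'] by blast
  have g[measurable]: "g \<in> borel_measurable borel" using g by simp
  have lim: "nmass (\<lambda>x. f i x - g x) \<le> ennreal e"
    if "\<And>j. j \<ge> N \<Longrightarrow> nmass (\<lambda>x. f i x - f j x) \<le> ennreal e" for i e N
  proof (rule L2_Fatou[where f = "\<lambda>n x. f i x - f (r n) x"])
    show "AE x in lborel. (\<lambda>n. f i x - f (r n) x) \<longlonglongrightarrow> f i x - g x"
      using ae unfolding AE_weighted by eventually_elim (intro tendsto_intros)
    show "\<forall>\<^sub>F n in sequentially. nmass (\<lambda>x. f i x - f (r n) x) \<le> ennreal e"
      using eventually_ge_at_top[of N]
      by eventually_elim (intro that, meson order_trans r seq_suble)
  qed measurable
  show ?thesis
  proof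
    show "(\<lambda>n. nmass (\<lambda>x. f n x - g x)) \<longlonglongrightarrow> 0"
    proof (rule ennreal_tendsto_0I)
      fix e :: real assume "0 < e"
      then obtain N where "\<And>i j. i \<ge> N \<Longrightarrow> j \<ge> N \<Longrightarrow> nmass (\<lambda>x. f i x - f j x) \<le> ennreal e"
        using cau by blast
      then have "nmass (\<lambda>x. f n x - g x) \<le> ennreal e" if "n \<ge> N" for n
        using that by (intro lim[of N]) auto
      then show "\<forall>\<^sub>F n in sequentially. nmass (\<lambda>x. f n x - g x) \<le> ennreal e"
        by (auto simp: eventually_sequentially)
    qed
    obtain N where "\<And>i j. i \<ge> N \<Longrightarrow> j \<ge> N \<Longrightarrow> nmass (\<lambda>x. f i x - f j x) \<le> ennreal 1"
      using cau[of 1] by auto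
    then have "nmass (\<lambda>x. f N x - g x) \<le> ennreal 1" by (intro lim[of N]) auto
    then have "(\<lambda>x. f N x - g x) \<in> L2" by (auto simp: L2_iff intro: le_less_trans)
    from L2_diff[OF f[of N] this] show "g \<in> L2" by simp
  qed
qed

section \<open>Continuity of translations\<close>

lemma integrable_translate:
  fixes f :: "real \<Rightarrow> 'b::{banach, second_countable_topology}"
  shows "integrable lborel f \<Longrightarrow> integrable lborel (\<lambda>x. f (x + h))"
  using lborel_integrable_real_affine[of f 1 h] by (simp add: add.commute)

lemma integral_translate:
  fixes f :: "real \<Rightarrow> 'b::{banach, second_countable_topology}"
  shows "(LINT x|lborel. f (x + h)) = (LINT x|lborel. f x)"
  using lborel_integral_real_affine[of 1 f h] by (simp add: add.commute)

definition L1_translation_continuous :: "(real \<Rightarrow> 'b::{banach, second_countable_topology}) \<Rightarrow> bool" where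
  "L1_translation_continuous f \<longleftrightarrow>
     (\<forall>h. h \<longlonglongrightarrow> 0 \<longrightarrow> (\<lambda>n::nat. LINT x|lborel. norm (f (x + h n) - f x)) \<longlonglongrightarrow> 0)"

text \<open>The three-term estimate: translation preserves the integral, so the approximation error
  enters twice and the modulus of the approximant once.\<close>

lemma L1_translation_continuous_approx:
  fixes f :: "real \<Rightarrow> 'b::{banach, second_countable_topology}"
  assumes f: "integrable lborel f"
    and approx: "\<And>e. 0 < e \<Longrightarrow> \<exists>g. integrable lborel g \<and> L1_translation_continuous g \<and>
      (LINT x|lborel. norm (f x - g x)) < e"
  shows "L1_translation_continuous f"
  unfolding L1_translation_continuous_def
proof (intro allI impI LIMSEQ_I)
  fix h :: "nat \<Rightarrow> real" and e :: real assume h: "h \<longlonglongrightarrow> 0" and e: "0 < e"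
  obtain g where g: "integrable lborel g" "L1_translation_continuous g"
    "(LINT x|lborel. norm (f x - g x)) < e / 4" using approx[of "e/4"] e by auto
  have "(\<lambda>n. LINT x|lborel. norm (g (x + h n) - g x)) \<longlonglongrightarrow> 0"
    using g(2) h by (simp add: L1_translation_continuous_def)
  from LIMSEQ_D[OF this, of "e/2"] e obtain N where
    N: "\<And>n. n \<ge> N \<Longrightarrow> (LINT x|lborel. norm (g (x + h n) - g x)) < e / 2" by auto
  show "\<exists>N. \<forall>n\<ge>N. norm ((LINT x|lborel. norm (f (x + h n) - f x)) - 0) < e"
  proof (intro exI[of _ N] allI impI)
    fix n assume n: "N \<le> n"
    note i = integrable_translate[OF f] integrable_translate[OF g(1)] f g(1)
    have "norm (f (x + h n) - f x) \<le> norm (f (x + h n) - g (x + h n))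
      + (norm (g (x + h n) - g x) + norm (f x - g x))" for x
      by norm
    then have "(LINT x|lborel. norm (f (x + h n) - f x))
      \<le> (LINT x|lborel. norm (f (x + h n) - g (x + h n)) + (norm (g (x + h n) - g x) + norm (f x - g x)))"
      using i by (intro integral_mono) auto
    also have "\<dots> = (LINT x|lborel. norm (f (x + h n) - g (x + h n)))
      + ((LINT x|lborel. norm (g (x + h n) - g x)) + (LINT x|lborel. norm (f x - g x)))"
      using i by simp
    also have "(LINT x|lborel. norm (f (x + h n) - g (x + h n))) = (LINT x|lborel. norm (f x - g x))"
      by (rule integral_translate[of "\<lambda>x. norm (f x - g x)"])
    also have "(LINT x|lborel. norm (f x - g x)) + ((LINT x|lborel. norm (g (x + h n) - g x)) +
        (LINT x|lborel. norm (f x - g x))) < e"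
      using N[OF n] g(3) by simp
    finally show "norm ((LINT x|lborel. norm (f (x + h n) - f x)) - 0) < e" by simp
  qed
qed

text \<open>The absolute difference of two indicators is their sum minus twice their product, and
  the sum has constant integral. The product converges at every point, by openness inside U and
  trivially outside, so the boundary of U, which may have positive measure, never enters.\<close>

lemma L1_translation_continuous_open:
  fixes U :: "real set"
  assumes U: "open U" "emeasure lborel U < \<infinity>"
  shows "L1_translation_continuous (indicator U :: real \<Rightarrow> real)"
  unfolding L1_translation_continuous_def
proof (intro allI impI)
  fix h :: "nat \<Rightarrow> real" assume h: "h \<longlonglongrightarrow> 0"
  have [measurable]: "U \<in> sets borel" using U by simp
  have i: "integrable lborel (indicator U :: real \<Rightarrow> real)" using U by simp
  note it = integrable_translate[OF i]
  let ?m = "\<lambda>n x. indicator U (x + h n) * indicator U x :: real"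
  have im: "integrable lborel (?m n)" for n
    by (rule Bochner_Integration.integrable_bound[OF i]) (auto simp: indicator_def)
  have "(\<lambda>n. LINT x|lborel. ?m n x) \<longlonglongrightarrow> (LINT x|lborel. indicator U x)"
  proof (rule integral_dominated_convergence[OF _ _ i])
    show "AE x in lborel. (\<lambda>n. ?m n x) \<longlonglongrightarrow> indicator U x"
    proof (intro AE_I2)
      fix x
      show "(\<lambda>n. ?m n x) \<longlonglongrightarrow> indicator U x"
      proof (cases "x \<in> U")
        case True
        have "(\<lambda>n. x + h n) \<longlonglongrightarrow> x" using tendsto_add[OF tendsto_const h, of x] by simp
        from topological_tendstoD[OF this U(1) True] have "\<forall>\<^sub>F n in sequentially. ?m n x = 1"
          by eventually_elim (use True in simp)
        then show ?thesis using True by (simp add: tendsto_eventually)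
      qed simp
    qed
  qed (auto simp: indicator_def)
  then have "(\<lambda>n. 2 * (LINT x|lborel. indicator U x) - 2 * (LINT x|lborel. ?m n x)) \<longlonglongrightarrow>
     2 * (LINT x|lborel. indicator U x) - 2 * (LINT x|lborel. indicator U x :: real)"
    by (intro tendsto_intros)
  moreover have "(LINT x|lborel. norm (indicator U (x + h n) - indicator U x :: real))
     = 2 * (LINT x|lborel. indicator U x) - 2 * (LINT x|lborel. ?m n x)" for n
  proof -
    have "(LINT x|lborel. norm (indicator U (x + h n) - indicator U x :: real))
       = (LINT x|lborel. indicator U (x + h n) + indicator U x - 2 * ?m n x)"
      by (rule Bochner_Integration.integral_cong) (auto simp: indicator_def)
    also have "\<dots> = (LINT x|lborel. indicator U (x + h n)) + (LINT x|lborel. indicator U x) - 2 * (LINT x|lborel. ?m n x)"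
      using i it im by simp
    also have "(LINT x|lborel. indicator U (x + h n) :: real) = (LINT x|lborel. indicator U x)"
      by (rule integral_translate)
    finally show ?thesis by simp
  qed
  ultimately show "(\<lambda>n. LINT x|lborel. norm (indicator U (x + h n) - indicator U x :: real)) \<longlonglongrightarrow> 0"
    by simp
qed

lemma enn2real_lt: "x < ennreal e \<Longrightarrow> enn2real x < e"
  by (cases x) (auto simp: ennreal_less_iff)

lemma L1_translation_continuous_indicator:
  fixes A :: "real set"
  assumes A: "A \<in> sets borel" "emeasure lborel A < \<infinity>"
  shows "L1_translation_continuous (indicator A :: real \<Rightarrow> real)"
proof (rule L1_translation_continuous_approx)
  show "integrable lborel (indicator A :: real \<Rightarrow> real)" using A by simp
  fix e :: real assume e: "0 < e"
  obtain U where U: "open U" "A \<subseteq> U" "emeasure lborel (U - A) < e"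
    using outer_regular_lborel[OF A(1) e] by blast
  have [measurable]: "U \<in> sets borel" "A \<in> sets borel" using U A by auto
  have "emeasure lborel U = emeasure lborel ((U - A) \<union> A)" using U by (simp add: Un_absorb2)
  also have "\<dots> \<le> emeasure lborel (U - A) + emeasure lborel A" by (rule emeasure_subadditive) auto
  also have "\<dots> < \<infinity>" using U(3) A(2) by (auto intro: less_trans)
  finally have Uf: "emeasure lborel U < \<infinity>" .
  have "(LINT x|lborel. norm (indicator A x - indicator U x :: real)) = (LINT x|lborel. indicator (U - A) x)"
    using U(2) by (intro Bochner_Integration.integral_cong) (auto simp: indicator_def)
  also have "\<dots> = measure lborel (U - A)" by simp
  also have "\<dots> < e" using U(3) e by (simp add: measure_def enn2real_lt)
  finally show "\<exists>g. integrable lborel g \<and> L1_translation_continuous g \<and>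
      (LINT x|lborel. norm (indicator A x - g x :: real)) < e"
    using L1_translation_continuous_open[OF U(1) Uf] Uf by (intro exI[of _ "indicator U :: real \<Rightarrow> real"]) auto
qed

lemma integrable_L1_translation_continuous:
  fixes f :: "real \<Rightarrow> 'b::{banach, second_countable_topology}"
  assumes "integrable lborel f"
  shows "L1_translation_continuous f"
  using assms
proof induction
  case (base A c)
  then have A: "L1_translation_continuous (indicator A :: real \<Rightarrow> real)"
    by (intro L1_translation_continuous_indicator) auto
  have "norm (indicator A (x + h) *\<^sub>R c - indicator A x *\<^sub>R c) =
      norm (indicator A (x + h) - indicator A x :: real) * norm c" for x h
    by (simp flip: scaleR_diff_left)
  then have "(LINT x|lborel. norm (indicator A (x + h) *\<^sub>R c - indicator A x *\<^sub>R c)) =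
      (LINT x|lborel. norm (indicator A (x + h) - indicator A x :: real)) * norm c" for h
    by (simp only: integral_mult_left_zero)
  note eq = this
  show ?case unfolding L1_translation_continuous_def eq
  proof (intro allI impI)
    fix h :: "nat \<Rightarrow> real" assume "h \<longlonglongrightarrow> 0"
    with A have "(\<lambda>n. LINT x|lborel. norm (indicator A (x + h n) - indicator A x :: real)) \<longlonglongrightarrow> 0"
      unfolding L1_translation_continuous_def by blast
    from tendsto_mult_left_zero[OF this, of "norm c"]
    show "(\<lambda>n. (LINT x|lborel. norm (indicator A (x + h n) - indicator A x :: real)) * norm c) \<longlonglongrightarrow> 0" .
  qed
next
  case (add f g)
  show ?case unfolding L1_translation_continuous_def
  proof (intro allI impI)
    fix h :: "nat \<Rightarrow> real" assume h: "h \<longlonglongrightarrow> 0"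
    note i = integrable_translate[OF add.hyps(1)] integrable_translate[OF add.hyps(2)] add.hyps(1,2)
    have lim0: "(\<lambda>n. (LINT x|lborel. norm (f (x + h n) - f x)) + (LINT x|lborel. norm (g (x + h n) - g x))) \<longlonglongrightarrow> 0"
      using add.IH h by (intro tendsto_add_zero) (auto simp: L1_translation_continuous_def)
    have "(LINT x|lborel. norm (f (x + h n) + g (x + h n) - (f x + g x)))
       \<le> (LINT x|lborel. norm (f (x + h n) - f x)) + (LINT x|lborel. norm (g (x + h n) - g x))" for n
    proof -
      have "norm (f (x + h n) + g (x + h n) - (f x + g x)) \<le> norm (f (x + h n) - f x) + norm (g (x + h n) - g x)" for x
        by norm
      then have "(LINT x|lborel. norm (f (x + h n) + g (x + h n) - (f x + g x)))
        \<le> (LINT x|lborel. norm (f (x + h n) - f x) + norm (g (x + h n) - g x))"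
        using i by (intro integral_mono) auto
      then show ?thesis using i by simp
    qed
    moreover have "0 \<le> (LINT x|lborel. norm (f (x + h n) + g (x + h n) - (f x + g x)))" for n
      by (rule Bochner_Integration.integral_nonneg) simp
    ultimately have "norm (LINT x|lborel. norm (f (x + h n) + g (x + h n) - (f x + g x)))
       \<le> (LINT x|lborel. norm (f (x + h n) - f x)) + (LINT x|lborel. norm (g (x + h n) - g x))" for n
      by (simp only: real_norm_def abs_of_nonneg)
    from Lim_null_comparison[OF always_eventually[OF allI, OF this] lim0]
    show "(\<lambda>n. LINT x|lborel. norm (f (x + h n) + g (x + h n) - (f x + g x))) \<longlonglongrightarrow> 0" .
  qed
next
  case (lim f s)
  show ?case
  proof (rule L1_translation_continuous_approx[OF lim.hyps(4)])
    fix e :: real assume e: "0 < e"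
    have [measurable]: "f \<in> borel_measurable borel" "\<And>i. s i \<in> borel_measurable borel"
      using lim.hyps(1,4) borel_measurable_integrable by force+
    have "(\<lambda>i. LINT x|lborel. norm (f x - s i x)) \<longlonglongrightarrow> (LINT x|(lborel::real measure). 0)"
    proof (rule integral_dominated_convergence[where w = "\<lambda>x. 3 * norm (f x)"])
      show "integrable lborel (\<lambda>x. 3 * norm (f x))" using lim.hyps(4) by auto
      have "(\<lambda>i. norm (f x - s i x)) \<longlonglongrightarrow> norm (f x - f x)" for x
        by (intro tendsto_intros) (use lim.hyps(2)[of x] in simp)
      then show "AE x in lborel. (\<lambda>i. norm (f x - s i x)) \<longlonglongrightarrow> 0" by simp
      have "norm (f x - s i x) \<le> 3 * norm (f x)" for i x
        using lim.hyps(3)[of x i] norm_triangle_ineq4[of "f x" "s i x"] by simp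
      then show "\<And>i. AE x in lborel. norm (norm (f x - s i x)) \<le> 3 * norm (f x)" by simp
    qed measurable
    from LIMSEQ_D[OF this e] obtain N where "(LINT x|lborel. norm (f x - s N x)) < e" by auto
    then show "\<exists>g. integrable lborel g \<and> L1_translation_continuous g \<and> (LINT x|lborel. norm (f x - g x)) < e"
      using lim.hyps(1)[of N] lim.IH[of N] by blast
  qed
qed

section \<open>The autocorrelation and its continuity at the origin\<close>

lemma borel_measurable_cnj[measurable (raw)]:
  "f \<in> borel_measurable M \<Longrightarrow> (\<lambda>x. cnj (f x)) \<in> borel_measurable M"
  by (rule borel_measurable_continuous_on[OF continuous_on_cnj[OF continuous_on_id]])

text \<open>The convolution of f with its conjugate reflection. Its transform is the squared modulus
  of the transform of f, and its value at 0 is the mass, so Plancherel's identity is Fourier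
  inversion of this function at the origin.\<close>

definition autocorrelation :: "(real \<Rightarrow> complex) \<Rightarrow> real \<Rightarrow> complex" where
  "autocorrelation f h = (LINT y|lborel. f (y + h) * cnj (f y))"

lemma square_integrable: "f \<in> L2 \<Longrightarrow> integrable lborel (\<lambda>x. (cmod (f x))\<^sup>2)"
  by (simp add: L2_def)

lemma integrable_L2_product:
  assumes "f \<in> L2" "g \<in> L2"
  shows "integrable lborel (\<lambda>x. cmod (f x) * cmod (g x))" "integrable lborel (\<lambda>x. f x * cnj (g x))"
proof -
  note [measurable] = L2_measurable[OF assms(1)] L2_measurable[OF assms(2)]
  have i: "integrable lborel (\<lambda>x. (cmod (f x))\<^sup>2 + (cmod (g x))\<^sup>2)"
    using assms by (auto simp: L2_def)
  have *: "cmod (f x) * cmod (g x) \<le> (cmod (f x))\<^sup>2 + (cmod (g x))\<^sup>2" for x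
    using product_le_weighted_squares[of 1 "cmod (f x)" "cmod (g x)"] by simp
  show "integrable lborel (\<lambda>x. cmod (f x) * cmod (g x))"
    by (rule Bochner_Integration.integrable_bound[OF i]) (use * in auto)
  show "integrable lborel (\<lambda>x. f x * cnj (g x))"
    by (rule Bochner_Integration.integrable_bound[OF i]) (use * in \<open>auto simp: norm_mult\<close>)
qed

lemma autocorrelation_bound:
  assumes f: "f \<in> L2"
  shows "cmod (autocorrelation f h) \<le> mass f"
proof -
  note ft = L2_translate[OF f, of h]
  have "cmod (autocorrelation f h) \<le> (LINT y|lborel. cmod (f (y + h) * cnj (f y)))"
    unfolding autocorrelation_def by (rule integral_norm_bound)
  also have "\<dots> \<le> (LINT y|lborel. ((cmod (f (y + h)))\<^sup>2 + (cmod (f y))\<^sup>2) / 2)"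
  proof (rule integral_mono)
    show "integrable lborel (\<lambda>y. cmod (f (y + h) * cnj (f y)))"
      using integrable_L2_product(1)[OF ft f] by (simp add: norm_mult)
    show "integrable lborel (\<lambda>y. ((cmod (f (y + h)))\<^sup>2 + (cmod (f y))\<^sup>2) / 2)"
      using square_integrable[OF f] square_integrable[OF ft] by simp
    show "cmod (f (y + h) * cnj (f y)) \<le> ((cmod (f (y + h)))\<^sup>2 + (cmod (f y))\<^sup>2) / 2" for y
      using sum_squares_bound[of "cmod (f (y + h))" "cmod (f y)"] by (simp add: norm_mult)
  qed
  also have "\<dots> = ((LINT y|lborel. (cmod (f (y + h)))\<^sup>2) + (LINT y|lborel. (cmod (f y))\<^sup>2)) / 2"
    using square_integrable[OF f] square_integrable[OF ft] by simp
  also have "\<dots> = mass f"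
    using integral_translate[of "\<lambda>y. (cmod (f y))\<^sup>2" h] by (simp add: mass_def)
  finally show ?thesis .
qed

lemma autocorrelation_0: "autocorrelation f 0 = complex_of_real (mass f)"
  unfolding autocorrelation_def mass_def
  by (simp add: complex_mult_cnj cmod_power2 flip: of_real_power of_real_add integral_complex_of_real)

text \<open>Translations are known to be continuous only in \<open>L^1\<close>, so f is split by
  size: where |f| \<le> N the error is at most N times an \<open>L^1\<close> distance, and where |f|
  > N the mass of f is small for large N.\<close>

lemma autocorrelation_tendsto:
  assumes f1: "integrable lborel f" and f2: "f \<in> L2" and h: "h \<longlonglongrightarrow> (0::real)"
  shows "(\<lambda>n::nat. autocorrelation f (h n)) \<longlonglongrightarrow> complex_of_real (mass f)"
proof (rule LIMSEQ_I)
  fix e :: real assume e: "0 < e"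
  note [measurable] = L2_measurable[OF f2]
  \<comment> \<open>\<eta> multiplies the squared modulus of the translate, whose integral is the
    full mass and does not become small. Hence \<eta> is fixed first, then N, then the index
    n.\<close>
  define \<eta> where "\<eta> = e / (4 * (mass f + 1))"
  have \<eta>: "0 < \<eta>" "\<eta> * mass f < e / 3"
    using e mass_nonneg[of f] by (auto simp: \<eta>_def field_simps add_pos_nonneg add_nonneg_pos)
  let ?L = "\<lambda>N x. (cmod (f x))\<^sup>2 * indicator {x. real N < cmod (f x)} x"
  have iL: "integrable lborel (?L N)" for N
    by (rule Bochner_Integration.integrable_bound[OF square_integrable[OF f2]]) (auto simp: indicator_def)
  have "(\<lambda>N. LINT x|lborel. ?L N x) \<longlonglongrightarrow> (LINT x|(lborel::real measure). 0)"
  proof (rule integral_dominated_convergence[OF _ _ square_integrable[OF f2]])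
    show "AE x in lborel. (\<lambda>N. ?L N x) \<longlonglongrightarrow> 0"
    proof (intro AE_I2 tendsto_eventually)
      fix x
      obtain N0 where "cmod (f x) \<le> real N0" using real_arch_simple by blast
      then show "\<forall>\<^sub>F N in sequentially. ?L N x = 0"
        by (intro eventually_sequentiallyI[of N0]) (auto simp: indicator_def)
    qed
  qed (auto simp: indicator_def)
  then have "(\<lambda>N. (1 / \<eta> + 1) * (LINT x|lborel. ?L N x)) \<longlonglongrightarrow> (1 / \<eta> + 1) * 0"
    by (intro tendsto_mult_left) simp
  from LIMSEQ_D[OF this, of "e/3"] e obtain N where
    "norm ((1 / \<eta> + 1) * (LINT x|lborel. ?L N x) - (1 / \<eta> + 1) * 0) < e / 3" by auto
  then have N: "(1 / \<eta> + 1) * (LINT x|lborel. ?L N x) < e / 3" by (simp add: abs_less_iff)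
  have "(\<lambda>n. real N * (LINT x|lborel. norm (f (x + h n) - f x))) \<longlonglongrightarrow> real N * 0"
    using integrable_L1_translation_continuous[OF f1] h
    by (intro tendsto_mult_left) (auto simp: L1_translation_continuous_def)
  from LIMSEQ_D[OF this, of "e/3"] e obtain M where
    "\<And>n. n \<ge> M \<Longrightarrow> norm (real N * (LINT x|lborel. norm (f (x + h n) - f x)) - real N * 0) < e / 3" by auto
  then have M: "\<And>n. n \<ge> M \<Longrightarrow> real N * (LINT x|lborel. norm (f (x + h n) - f x)) < e / 3"
    by (simp add: abs_less_iff)
  show "\<exists>M. \<forall>n\<ge>M. norm (autocorrelation f (h n) - complex_of_real (mass f)) < e"
  proof (intro exI[of _ M] allI impI)
    fix n assume n: "M \<le> n"
    let ?g = "\<lambda>x. f (x + h n)"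
    note ft = L2_translate[OF f2, of "h n"]
    note i = integrable_translate[OF f1, of "h n"] f1 square_integrable[OF ft] iL[of N]
    have "autocorrelation f (h n) - complex_of_real (mass f)
       = (LINT x|lborel. ?g x * cnj (f x) - f x * cnj (f x))"
      using integrable_L2_product(2)[OF ft f2] integrable_L2_product(2)[OF f2 f2]
      by (simp add: autocorrelation_0[symmetric] autocorrelation_def)
    also have "cmod \<dots> \<le> (LINT x|lborel. cmod (?g x * cnj (f x) - f x * cnj (f x)))"
      by (rule integral_norm_bound)
    also have "\<dots> \<le> (LINT x|lborel. real N * cmod (?g x - f x) + (\<eta> * (cmod (?g x))\<^sup>2 + (1 / \<eta> + 1) * ?L N x))"
    proof (rule integral_mono)
      show "integrable lborel (\<lambda>x. cmod (?g x * cnj (f x) - f x * cnj (f x)))"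
        using integrable_L2_product(2)[OF ft f2] integrable_L2_product(2)[OF f2 f2] by auto
      show "integrable lborel (\<lambda>x. real N * cmod (?g x - f x) + (\<eta> * (cmod (?g x))\<^sup>2 + (1 / \<eta> + 1) * ?L N x))"
        using i by auto
      fix x
      have "cmod (?g x * cnj (f x) - f x * cnj (f x)) = cmod (?g x - f x) * cmod (f x)"
        by (simp add: norm_mult flip: left_diff_distrib)
      also have "\<dots> \<le> real N * cmod (?g x - f x) + (\<eta> * (cmod (?g x))\<^sup>2 + (1 / \<eta> + 1) * ?L N x)"
      proof (cases "cmod (f x) \<le> real N")
        case True
        then have "cmod (?g x - f x) * cmod (f x) \<le> real N * cmod (?g x - f x)"
          by (simp add: mult.commute mult_right_mono)
        moreover have "0 \<le> \<eta> * (cmod (?g x))\<^sup>2" using \<eta>(1) by simp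
        ultimately show ?thesis using True by (simp add: indicator_def)
      next
        case False
        let ?a = "cmod (?g x)" and ?b = "cmod (f x)"
        have "cmod (?g x - f x) * ?b \<le> (?a + ?b) * ?b"
          by (intro mult_right_mono norm_triangle_ineq4) auto
        also have "\<dots> = ?a * ?b + ?b\<^sup>2" by (simp add: power2_eq_square algebra_simps)
        also have "?a * ?b \<le> \<eta> * ?a\<^sup>2 + 1 / \<eta> * ?b\<^sup>2"
          by (rule product_le_weighted_squares[OF \<eta>(1)]) auto
        finally have "cmod (?g x - f x) * ?b \<le> \<eta> * ?a\<^sup>2 + (1 / \<eta> + 1) * ?b\<^sup>2"
          by (simp add: distrib_right)
        moreover have "0 \<le> real N * cmod (?g x - f x)" by simp
        moreover have L: "?L N x = ?b\<^sup>2" using False by (simp add: indicator_def)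
        ultimately show ?thesis unfolding L by linarith
      qed
      finally show "cmod (?g x * cnj (f x) - f x * cnj (f x))
        \<le> real N * cmod (?g x - f x) + (\<eta> * (cmod (?g x))\<^sup>2 + (1 / \<eta> + 1) * ?L N x)" .
    qed
    also have "\<dots> = real N * (LINT x|lborel. cmod (?g x - f x)) +
        (\<eta> * (LINT x|lborel. (cmod (?g x))\<^sup>2) + (1 / \<eta> + 1) * (LINT x|lborel. ?L N x))"
      using i by simp
    also have "(LINT x|lborel. (cmod (?g x))\<^sup>2) = mass f"
      using integral_translate[of "\<lambda>y. (cmod (f y))\<^sup>2" "h n"] by (simp add: mass_def)
    also have "real N * (LINT x|lborel. cmod (?g x - f x)) +
        (\<eta> * mass f + (1 / \<eta> + 1) * (LINT x|lborel. ?L N x)) < e"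
      using M[OF n] N \<eta>(2) by linarith
    finally show "norm (autocorrelation f (h n) - complex_of_real (mass f)) < e" .
  qed
qed

section \<open>Plancherel's theorem\<close>

definition fourier_L1 :: "(real \<Rightarrow> complex) \<Rightarrow> real \<Rightarrow> complex" where
  "fourier_L1 f \<xi> = complex_of_real (1 / sqrt (2 * pi)) * (LINT x|lborel. cis (- (x * \<xi>)) * f x)"

lemma borel_measurable_cis[measurable (raw)]:
  "f \<in> borel_measurable M \<Longrightarrow> (\<lambda>x. cis (f x)) \<in> borel_measurable M"
  by (rule borel_measurable_continuous_on[OF continuous_on_cis[OF continuous_on_id]])

lemma integrable_cis_mult:
  assumes "integrable lborel f" "g \<in> borel_measurable borel"
  shows "integrable lborel (\<lambda>x. cis (g x) * f x)"
proof (rule Bochner_Integration.integrable_bound[OF assms(1)])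
  have [measurable]: "f \<in> borel_measurable borel" using borel_measurable_integrable[OF assms(1)] by simp
  show "(\<lambda>x. cis (g x) * f x) \<in> borel_measurable lborel" using assms(2) by measurable
qed (simp add: norm_mult)

lemma borel_measurable_fourier_L1[measurable]:
  assumes "integrable lborel f"
  shows "fourier_L1 f \<in> borel_measurable borel"
proof -
  have [measurable]: "f \<in> borel_measurable borel" using borel_measurable_integrable[OF assms] by simp
  show ?thesis unfolding fourier_L1_def by measurable
qed

lemma autocorrelation_integrand_integrable:
  fixes f :: "real \<Rightarrow> complex"
  assumes f: "integrable lborel f"
  shows "integrable (lborel \<Otimes>\<^sub>M lborel) (\<lambda>(y, h). f (y + h) * cnj (f y))"
proof (rule lborel_pair.Fubini_integrable)
  have [measurable]: "f \<in> borel_measurable borel" using borel_measurable_integrable[OF f] by simp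
  show "(\<lambda>(y, h). f (y + h) * cnj (f y)) \<in> borel_measurable (lborel \<Otimes>\<^sub>M lborel)" by measurable
  have "(LINT h|lborel. norm (f (y + h) * cnj (f y))) = (LINT h|lborel. norm (f h)) * norm (f y)" for y
    using integral_translate[of "\<lambda>h. norm (f h)" y] by (simp add: norm_mult add.commute)
  then show "integrable lborel (\<lambda>y. LINT h|lborel. norm (case (y, h) of (y, h) \<Rightarrow> f (y + h) * cnj (f y)))"
    using f by simp
  show "AE y in lborel. integrable lborel (\<lambda>h. case (y, h) of (y, h) \<Rightarrow> f (y + h) * cnj (f y))"
    using integrable_translate[OF f] by (simp add: add.commute)
qed

lemma autocorrelation_integrable:
  assumes f: "integrable lborel f"
  shows "integrable lborel (autocorrelation f)"
  using lborel_pair.integrable_snd[OF autocorrelation_integrand_integrable[OF f]]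
  unfolding autocorrelation_def[abs_def] by simp

text \<open>The phase at h is the phase at h + y times the conjugate phase at y; after Fubini the
  two factors integrate to J and its conjugate. J is the transform without the factor 1 / sqrt (2
  pi).\<close>

lemma fourier_autocorrelation:
  assumes f: "integrable lborel f"
  defines "J \<equiv> \<lambda>\<xi>. LINT x|lborel. cis (- (x * \<xi>)) * f x"
  shows "(LINT h|lborel. cis (- (h * \<xi>)) * autocorrelation f h) = complex_of_real ((cmod (J \<xi>))\<^sup>2)"
proof -
  have [measurable]: "f \<in> borel_measurable borel" using borel_measurable_integrable[OF f] by simp
  have i: "integrable (lborel \<Otimes>\<^sub>M lborel) (\<lambda>(y, h). cis (- (h * \<xi>)) * (f (y + h) * cnj (f y)))"
    by (rule Bochner_Integration.integrable_bound[OF autocorrelation_integrand_integrable[OF f]])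
       (auto simp: norm_mult split: prod.split)
  have "(LINT h|lborel. cis (- (h * \<xi>)) * autocorrelation f h)
     = (LINT h|lborel. LINT y|lborel. cis (- (h * \<xi>)) * (f (y + h) * cnj (f y)))"
    unfolding autocorrelation_def by simp
  also have "\<dots> = (LINT y|lborel. LINT h|lborel. cis (- (h * \<xi>)) * (f (y + h) * cnj (f y)))"
    by (rule lborel_pair.Fubini_integral[OF i])
  also have "\<dots> = (LINT y|lborel. J \<xi> * cnj (cis (- (y * \<xi>)) * f y))"
  proof (rule Bochner_Integration.integral_cong[OF refl])
    fix y
    have "(LINT h|lborel. cis (- (h * \<xi>)) * (f (y + h) * cnj (f y)))
      = (LINT h|lborel. (cis (- ((h + y) * \<xi>)) * f (h + y)) * cnj (cis (- (y * \<xi>)) * f y))"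
    proof (rule Bochner_Integration.integral_cong[OF refl])
      fix h
      have "cis (- (h * \<xi>)) = cis (- ((h + y) * \<xi>)) * cnj (cis (- (y * \<xi>)))"
        by (simp add: cis_cnj cis_mult algebra_simps)
      then show "cis (- (h * \<xi>)) * (f (y + h) * cnj (f y)) = (cis (- ((h + y) * \<xi>)) * f (h + y)) * cnj (cis (- (y * \<xi>)) * f y)"
        by (simp add: add.commute)
    qed
    also have "\<dots> = (LINT h|lborel. cis (- ((h + y) * \<xi>)) * f (h + y)) * cnj (cis (- (y * \<xi>)) * f y)"
      by (rule integral_mult_left_zero)
    also have "(LINT h|lborel. cis (- ((h + y) * \<xi>)) * f (h + y)) = J \<xi>"
      unfolding J_def by (rule integral_translate[of "\<lambda>h. cis (- (h * \<xi>)) * f h"])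
    finally show "(LINT h|lborel. cis (- (h * \<xi>)) * (f (y + h) * cnj (f y))) = J \<xi> * cnj (cis (- (y * \<xi>)) * f y)" .
  qed
  also have "\<dots> = J \<xi> * cnj (J \<xi>)"
    unfolding J_def by (subst integral_mult_right_zero) (simp only: Bochner_Integration.integral_cnj)
  also have "\<dots> = complex_of_real ((cmod (J \<xi>))\<^sup>2)" by (simp only: complex_norm_square)
  finally show ?thesis .
qed

lemma fourier_std_normal_density:
  "(LINT x|lborel. cis (t * x) * complex_of_real (std_normal_density x)) = complex_of_real (exp (- t\<^sup>2 / 2))"
proof -
  have "complex_of_real (exp (- t\<^sup>2 / 2)) = char std_normal_distribution t"
    by (simp add: char_std_normal_distribution)
  also have "\<dots> = (LINT x|lborel. std_normal_density x *\<^sub>R iexp (t * x))"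
    unfolding char_def by (subst integral_density) auto
  also have "\<dots> = (LINT x|lborel. cis (t * x) * complex_of_real (std_normal_density x))"
    by (rule Bochner_Integration.integral_cong) (auto simp: cis_conv_exp scaleR_conv_of_real)
  finally show ?thesis by simp
qed

text \<open>Inversion at the origin by Gaussian summation. The integral of |J|^2 against a wide
  Gaussian is, by Fubini, a Gaussian average of the autocorrelation at scale 1 / k, which tends to
  its value at 0. On the frequency side the Gaussians increase with k, so monotone convergence
  applies before |J|^2 is known to be integrable.\<close>

lemma nmass_fourier_L1:
  assumes f1: "integrable lborel f" and f2: "f \<in> L2"
  shows "nmass (fourier_L1 f) = nmass f"
proof -
  note [measurable] = L2_measurable[OF f2]
  define J where "J \<xi> = (LINT x|lborel. cis (- (x * \<xi>)) * f x)" for \<xi>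
  have [measurable]: "J \<in> borel_measurable borel" unfolding J_def by measurable
  \<comment> \<open>This number is both the normalisation of the transform and the value of the
    normal density at 0; the squared normalisation thus supplies one factor for the limit of the
    Gaussians and one more in front.\<close>
  define c where "c = 1 / sqrt (2 * pi)"
  have c: "0 < c" by (simp add: c_def)
  let ?\<phi> = std_normal_density
  have \<phi>i: "integrable lborel (\<lambda>x. complex_of_real (?\<phi> x))"
    using integrable_normal_density[of 1 0] by (simp add: complex_of_real_integrable_eq)
  have \<phi>k: "integrable lborel (\<lambda>x. complex_of_real (?\<phi> (x / k)))" if "k > 0" for k
    using lborel_integrable_real_affine[OF \<phi>i, of "1/k" 0] that by simp
  have mono_\<phi>: "?\<phi> x \<le> ?\<phi> y" if "\<bar>y\<bar> \<le> \<bar>x\<bar>" for x y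
    using that by (auto simp: std_normal_density_def abs_le_square_iff intro!: divide_right_mono)
  have J_bd: "cmod (J \<xi>) \<le> (LINT x|lborel. cmod (f x))" for \<xi>
  proof -
    have "cmod (J \<xi>) \<le> (LINT x|lborel. cmod (cis (- (x * \<xi>)) * f x))"
      unfolding J_def by (rule integral_norm_bound)
    then show ?thesis by (simp add: norm_mult)
  qed
  \<comment> \<open>The transform of the dilated Gaussian has a prefactor k, which the substitution
    s = k h removes.\<close>
  have key: "(LINT \<xi>|lborel. complex_of_real ((cmod (J \<xi>))\<^sup>2 * ?\<phi> (\<xi> / k)))
     = (LINT s|lborel. autocorrelation f (s / k) * complex_of_real (exp (- s\<^sup>2 / 2)))" if k: "k > 0" for k
  proof -
    have i: "integrable (lborel \<Otimes>\<^sub>M lborel)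
        (\<lambda>(h, \<xi>). cis (- (h * \<xi>)) * autocorrelation f h * complex_of_real (?\<phi> (\<xi> / k)))"
    proof (rule lborel_pair.Fubini_integrable)
      have [measurable]: "autocorrelation f \<in> borel_measurable borel"
        using borel_measurable_integrable[OF autocorrelation_integrable[OF f1]] by simp
      show "(\<lambda>(h, \<xi>). cis (- (h * \<xi>)) * autocorrelation f h * complex_of_real (?\<phi> (\<xi> / k)))
        \<in> borel_measurable (lborel \<Otimes>\<^sub>M lborel)" by measurable
      show "integrable lborel (\<lambda>h. LINT \<xi>|lborel. norm (case (h, \<xi>) of (h, \<xi>) \<Rightarrow>
          cis (- (h * \<xi>)) * autocorrelation f h * complex_of_real (?\<phi> (\<xi> / k))))"
        using autocorrelation_integrable[OF f1] by (simp add: norm_mult)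
      show "AE h in lborel. integrable lborel (\<lambda>\<xi>. case (h, \<xi>) of (h, \<xi>) \<Rightarrow>
          cis (- (h * \<xi>)) * autocorrelation f h * complex_of_real (?\<phi> (\<xi> / k)))"
      proof (intro AE_I2)
        fix h
        have "integrable lborel (\<lambda>\<xi>. cis (- (h * \<xi>)) * (autocorrelation f h * complex_of_real (?\<phi> (\<xi> / k))))"
          using \<phi>k[OF k] by (intro integrable_cis_mult) auto
        then show "integrable lborel (\<lambda>\<xi>. case (h, \<xi>) of (h, \<xi>) \<Rightarrow>
          cis (- (h * \<xi>)) * autocorrelation f h * complex_of_real (?\<phi> (\<xi> / k)))"
          by (simp add: mult.assoc)
      qed
    qed
    have "(LINT \<xi>|lborel. complex_of_real ((cmod (J \<xi>))\<^sup>2 * ?\<phi> (\<xi> / k)))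
      = (LINT \<xi>|lborel. LINT h|lborel. cis (- (h * \<xi>)) * autocorrelation f h * complex_of_real (?\<phi> (\<xi> / k)))"
      unfolding J_def of_real_mult fourier_autocorrelation[OF f1, symmetric]
      by (simp only: integral_mult_left_zero)
    also have "\<dots> = (LINT h|lborel. LINT \<xi>|lborel. cis (- (h * \<xi>)) * autocorrelation f h * complex_of_real (?\<phi> (\<xi> / k)))"
      by (rule lborel_pair.Fubini_integral[OF i])
    also have "\<dots> = (LINT h|lborel. autocorrelation f h * complex_of_real (k * exp (- (k * h)\<^sup>2 / 2)))"
    proof (rule Bochner_Integration.integral_cong[OF refl])
      fix h
      have "(LINT \<xi>|lborel. cis (- (h * \<xi>)) * autocorrelation f h * complex_of_real (?\<phi> (\<xi> / k)))
        = (LINT \<xi>|lborel. autocorrelation f h * (cis (- (h * \<xi>)) * complex_of_real (?\<phi> (\<xi> / k))))"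
        by (simp add: mult_ac)
      also have "\<dots> = autocorrelation f h * (LINT \<xi>|lborel. cis (- (h * \<xi>)) * complex_of_real (?\<phi> (\<xi> / k)))"
        by (rule integral_mult_right_zero)
      also have "(LINT \<xi>|lborel. cis (- (h * \<xi>)) * complex_of_real (?\<phi> (\<xi> / k)))
         = k *\<^sub>R (LINT x|lborel. cis ((- (h * k)) * x) * complex_of_real (?\<phi> x))"
        using k by (subst lborel_integral_real_affine[where c = k and t = 0]) (auto simp: mult_ac)
      also have "\<dots> = complex_of_real (k * exp (- (k * h)\<^sup>2 / 2))"
        unfolding fourier_std_normal_density by (simp add: scaleR_conv_of_real mult_ac)
      finally show "(LINT \<xi>|lborel. cis (- (h * \<xi>)) * autocorrelation f h * complex_of_real (?\<phi> (\<xi> / k)))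
        = autocorrelation f h * complex_of_real (k * exp (- (k * h)\<^sup>2 / 2))" .
    qed
    also have "\<dots> = (1 / k) *\<^sub>R (LINT s|lborel. autocorrelation f (s / k) * complex_of_real (k * exp (- s\<^sup>2 / 2)))"
      using k by (subst lborel_integral_real_affine[where c = "1 / k" and t = 0]) auto
    also have "\<dots> = (LINT s|lborel. autocorrelation f (s / k) * complex_of_real (exp (- s\<^sup>2 / 2)))"
      using k by (simp flip: integral_scaleR_right add: scaleR_conv_of_real mult_ac del: integral_scaleR_right)
    finally show ?thesis .
  qed
  define K where "K n = real (Suc n)" for n
  have K: "K n > 0" for n by (simp add: K_def)
  have gi: "integrable lborel (\<lambda>s. exp (- s\<^sup>2 / 2) :: real)"
    and gint: "(LINT s|lborel. exp (- s\<^sup>2 / 2) :: real) = sqrt (2 * pi)"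
  proof -
    have *: "exp (- s\<^sup>2 / 2) = sqrt (2 * pi) * ?\<phi> s" for s :: real by (simp add: std_normal_density_def)
    show "integrable lborel (\<lambda>s. exp (- s\<^sup>2 / 2) :: real)" unfolding * by simp
    show "(LINT s|lborel. exp (- s\<^sup>2 / 2) :: real) = sqrt (2 * pi)" unfolding * by simp
  qed
  have [measurable]: "autocorrelation f \<in> borel_measurable borel"
    using borel_measurable_integrable[OF autocorrelation_integrable[OF f1]] by simp
  have "(\<lambda>n. LINT s|lborel. autocorrelation f (s / K n) * complex_of_real (exp (- s\<^sup>2 / 2)))
    \<longlonglongrightarrow> (LINT s|lborel. complex_of_real (mass f) * complex_of_real (exp (- s\<^sup>2 / 2)))"
  proof (rule integral_dominated_convergence[where w = "\<lambda>s. mass f * exp (- s\<^sup>2 / 2)"])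
    show "integrable lborel (\<lambda>s. mass f * exp (- s\<^sup>2 / 2))" using gi by simp
    show "AE s in lborel. (\<lambda>n. autocorrelation f (s / K n) * complex_of_real (exp (- s\<^sup>2 / 2)))
        \<longlonglongrightarrow> complex_of_real (mass f) * complex_of_real (exp (- s\<^sup>2 / 2))"
    proof (intro AE_I2 tendsto_mult_right autocorrelation_tendsto[OF f1 f2])
      show "(\<lambda>n. s / K n) \<longlonglongrightarrow> 0" for s
        unfolding K_def by (rule LIMSEQ_Suc[OF lim_const_over_n])
    qed
    show "\<And>n. AE s in lborel. norm (autocorrelation f (s / K n) * complex_of_real (exp (- s\<^sup>2 / 2)))
        \<le> mass f * exp (- s\<^sup>2 / 2)"
      using autocorrelation_bound[OF f2] by (simp add: norm_mult mult_right_mono)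
  qed measurable
  also have "(LINT s|lborel. complex_of_real (mass f) * complex_of_real (exp (- s\<^sup>2 / 2)))
      = complex_of_real (mass f * sqrt (2 * pi))"
    unfolding of_real_mult[symmetric] integral_complex_of_real using gi gint by simp
  finally have "(\<lambda>n. complex_of_real (LINT \<xi>|lborel. (cmod (J \<xi>))\<^sup>2 * ?\<phi> (\<xi> / K n)))
      \<longlonglongrightarrow> complex_of_real (mass f * sqrt (2 * pi))"
    unfolding key[OF K, symmetric] integral_complex_of_real .
  then have lim1: "(\<lambda>n. LINT \<xi>|lborel. (cmod (J \<xi>))\<^sup>2 * ?\<phi> (\<xi> / K n)) \<longlonglongrightarrow> mass f * sqrt (2 * pi)"
    by (simp only: tendsto_of_real_iff)
  have Ji: "integrable lborel (\<lambda>\<xi>. (cmod (J \<xi>))\<^sup>2 * ?\<phi> (\<xi> / K n))" for n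
  proof (rule Bochner_Integration.integrable_bound)
    show "integrable lborel (\<lambda>\<xi>. (LINT x|lborel. cmod (f x))\<^sup>2 * complex_of_real (?\<phi> (\<xi> / K n)))"
      using \<phi>k[OF K] by simp
    show "AE \<xi> in lborel. norm ((cmod (J \<xi>))\<^sup>2 * ?\<phi> (\<xi> / K n))
        \<le> norm ((LINT x|lborel. cmod (f x))\<^sup>2 * complex_of_real (?\<phi> (\<xi> / K n)))"
      using J_bd by (auto simp: norm_mult norm_power abs_mult intro!: mult_right_mono power_mono AE_I2)
  qed measurable
  have "(\<lambda>n. \<integral>\<^sup>+\<xi>. ennreal ((cmod (J \<xi>))\<^sup>2 * ?\<phi> (\<xi> / K n)) \<partial>lborel)
      \<longlonglongrightarrow> (\<integral>\<^sup>+\<xi>. ennreal ((cmod (J \<xi>))\<^sup>2 * c) \<partial>lborel)"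
  proof (rule nn_integral_LIMSEQ)
    show "incseq (\<lambda>n \<xi>. ennreal ((cmod (J \<xi>))\<^sup>2 * ?\<phi> (\<xi> / K n)))"
      by (auto simp: incseq_def le_fun_def K_def abs_divide intro!: ennreal_leI mult_left_mono mono_\<phi> divide_left_mono)
    fix \<xi>
    have "(\<lambda>n. \<xi> / K n) \<longlonglongrightarrow> 0"
      unfolding K_def by (rule LIMSEQ_Suc[OF lim_const_over_n])
    then have "(\<lambda>n. (cmod (J \<xi>))\<^sup>2 * (1 / sqrt (2 * pi) * exp (- (\<xi> / K n)\<^sup>2 / 2))) \<longlonglongrightarrow> (cmod (J \<xi>))\<^sup>2 * (1 / sqrt (2 * pi) * exp (- 0\<^sup>2 / 2))"
      by (intro tendsto_intros) auto
    then show "(\<lambda>n. ennreal ((cmod (J \<xi>))\<^sup>2 * ?\<phi> (\<xi> / K n))) \<longlonglongrightarrow> ennreal ((cmod (J \<xi>))\<^sup>2 * c)"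
      unfolding std_normal_density_def c_def by (intro tendsto_ennrealI) simp
  qed auto
  moreover have "(\<integral>\<^sup>+\<xi>. ennreal ((cmod (J \<xi>))\<^sup>2 * ?\<phi> (\<xi> / K n)) \<partial>lborel)
      = ennreal (LINT \<xi>|lborel. (cmod (J \<xi>))\<^sup>2 * ?\<phi> (\<xi> / K n))" for n
    by (rule nn_integral_eq_integral[OF Ji]) simp
  ultimately have "(\<integral>\<^sup>+\<xi>. ennreal ((cmod (J \<xi>))\<^sup>2 * c) \<partial>lborel) = ennreal (mass f * sqrt (2 * pi))"
    using LIMSEQ_unique tendsto_ennrealI[OF lim1] by fastforce
  moreover have "nmass (fourier_L1 f) = (\<integral>\<^sup>+\<xi>. ennreal c * ennreal ((cmod (J \<xi>))\<^sup>2 * c) \<partial>lborel)"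
    unfolding nmass_def fourier_L1_def J_def[symmetric] c_def[symmetric] using c
    by (intro nn_integral_cong) (simp add: norm_mult power_mult_distrib power2_eq_square mult_ac flip: ennreal_mult)
  ultimately have "nmass (fourier_L1 f) = ennreal c * ennreal (mass f * sqrt (2 * pi))"
    by (simp add: nn_integral_cmult)
  also have "\<dots> = ennreal (mass f)"
    using c mass_nonneg[of f] by (simp add: c_def flip: ennreal_mult)
  finally show ?thesis using nmass_eq_mass[OF f2] by simp
qed

section \<open>Extension of the transform from integrable to square-integrable functions\<close>

lemma ennreal_null_comparison:
  fixes f g :: "'a \<Rightarrow> ennreal"
  assumes "\<And>n. f n \<le> g n" "(g \<longlongrightarrow> 0) F"
  shows "(f \<longlongrightarrow> 0) F"
  by (rule tendsto_sandwich[OF _ _ tendsto_const assms(2)]) (use assms(1) in auto)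

lemma ennreal_double_add: "0 \<le> a \<Longrightarrow> 0 \<le> b \<Longrightarrow> 2 * ennreal a + 2 * ennreal b = ennreal (2 * a + 2 * b)"
  by (simp add: ennreal_plus ennreal_mult)

definition cutoff :: "real \<Rightarrow> (real \<Rightarrow> complex) \<Rightarrow> real \<Rightarrow> complex" where
  "cutoff R u = (\<lambda>x. indicator {-R..R} x *\<^sub>R u x)"

lemma L2_mono:
  assumes "u \<in> L2" "w \<in> borel_measurable borel" "\<And>x. cmod (w x) \<le> cmod (u x)"
  shows "w \<in> L2"
proof -
  have "nmass w \<le> nmass u"
    unfolding nmass_def using assms(3) by (intro nn_integral_mono ennreal_leI power_mono) auto
  then show ?thesis using assms(1,2) by (auto simp: L2_iff intro: le_less_trans)
qed

lemma cutoff_L2: "u \<in> L2 \<Longrightarrow> cutoff R u \<in> L2"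
  by (rule L2_mono[of u]) (auto simp: cutoff_def indicator_def)

lemma cutoff_integrable:
  assumes u: "u \<in> L2"
  shows "integrable lborel (cutoff R u)"
proof (rule Bochner_Integration.integrable_bound)
  note [measurable] = L2_measurable[OF u]
  show "integrable lborel (\<lambda>x. indicator {-R..R} x + (cmod (u x))\<^sup>2 :: real)"
    by (intro Bochner_Integration.integrable_add square_integrable[OF u]) (simp add: emeasure_lborel_Icc_eq)
  have *: "cmod z \<le> 1 + (cmod z)\<^sup>2" for z
    using product_le_weighted_squares[of 1 1 "cmod z"] by simp
  show "AE x in lborel. norm (cutoff R u x) \<le> norm (indicator {-R..R} x + (cmod (u x))\<^sup>2)"
    using * by (intro AE_I2) (auto simp: cutoff_def indicator_def)
  show "cutoff R u \<in> borel_measurable lborel"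
    unfolding cutoff_def by measurable
qed

lemma truncated_fourier_cutoff: "truncated_fourier R u = fourier_L1 (cutoff R u)"
  unfolding truncated_fourier_def[abs_def] fourier_L1_def[abs_def] set_lebesgue_integral_def cutoff_def
  by (simp add: mult_scaleR_right)

lemma is_fourier_iff:
  "is_fourier u g \<longleftrightarrow> g \<in> L2 \<and> ((\<lambda>R. nmass (\<lambda>\<xi>. fourier_L1 (cutoff R u) \<xi> - g \<xi>)) \<longlongrightarrow> 0) at_top"
  by (simp add: is_fourier_def nmass_def truncated_fourier_cutoff)

lemma nmass_cutoff_diff_antimono:
  assumes "R \<le> S"
  shows "nmass (\<lambda>x. cutoff S u x - u x) \<le> nmass (\<lambda>x. cutoff R u x - u x)"
  unfolding nmass_def cutoff_def using assms
  by (intro nn_integral_mono ennreal_leI power_mono) (auto simp: indicator_def)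

lemma cutoff_seq_tendsto:
  assumes u: "u \<in> L2"
  shows "(\<lambda>n. nmass (\<lambda>x. cutoff (real n) u x - u x)) \<longlonglongrightarrow> 0"
proof -
  note [measurable] = L2_measurable[OF u]
  have "(\<lambda>n. \<integral>\<^sup>+x. ennreal ((cmod (cutoff (real n) u x - u x))\<^sup>2) \<partial>lborel)
     \<longlonglongrightarrow> (\<integral>\<^sup>+x. 0 \<partial>(lborel :: real measure))"
  proof (rule nn_integral_dominated_convergence[where w = "\<lambda>x. ennreal ((cmod (u x))\<^sup>2)"])
    show "(\<integral>\<^sup>+x. ennreal ((cmod (u x))\<^sup>2) \<partial>lborel) < \<infinity>"
      using L2_nmass[OF u] by (simp add: nmass_def)
    show "AE x in lborel. (\<lambda>n. ennreal ((cmod (cutoff (real n) u x - u x))\<^sup>2)) \<longlonglongrightarrow> 0"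
    proof (intro AE_I2 tendsto_eventually)
      fix x
      obtain N where "\<bar>x\<bar> \<le> real N" using real_arch_simple by blast
      then show "\<forall>\<^sub>F n in sequentially. ennreal ((cmod (cutoff (real n) u x - u x))\<^sup>2) = 0"
        by (intro eventually_sequentiallyI[of N]) (auto simp: cutoff_def indicator_def)
    qed
  qed (auto simp: cutoff_def indicator_def)
  then show ?thesis by (simp add: nmass_def)
qed

lemma cutoff_tendsto:
  assumes u: "u \<in> L2"
  shows "((\<lambda>R. nmass (\<lambda>x. cutoff R u x - u x)) \<longlongrightarrow> 0) at_top"
proof (rule ennreal_tendsto_0I)
  fix e :: real assume "0 < e"
  from eventually_happens[OF ennreal_tendsto_0D[OF cutoff_seq_tendsto[OF u] this]]
  obtain N where N: "nmass (\<lambda>x. cutoff (real N) u x - u x) < ennreal e" by auto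
  show "\<forall>\<^sub>F R in at_top. nmass (\<lambda>x. cutoff R u x - u x) \<le> ennreal e"
    using eventually_ge_at_top[of "real N"]
    by eventually_elim (use N nmass_cutoff_diff_antimono in \<open>meson less_imp_le order_trans\<close>)
qed

lemma fourier_L1_linear:
  assumes "integrable lborel f" "integrable lborel g"
  shows "fourier_L1 (\<lambda>x. a * f x + b * g x) = (\<lambda>\<xi>. a * fourier_L1 f \<xi> + b * fourier_L1 g \<xi>)"
proof
  fix \<xi>
  have i: "integrable lborel (\<lambda>x. cis (- (x * \<xi>)) * f x)" "integrable lborel (\<lambda>x. cis (- (x * \<xi>)) * g x)"
    using assms by (auto intro!: integrable_cis_mult)
  have "(LINT x|lborel. cis (- (x * \<xi>)) * (a * f x + b * g x))
    = (LINT x|lborel. a * (cis (- (x * \<xi>)) * f x) + b * (cis (- (x * \<xi>)) * g x))"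
    by (simp add: algebra_simps)
  also have "\<dots> = a * (LINT x|lborel. cis (- (x * \<xi>)) * f x) + b * (LINT x|lborel. cis (- (x * \<xi>)) * g x)"
    using i by simp
  finally show "fourier_L1 (\<lambda>x. a * f x + b * g x) \<xi> = a * fourier_L1 f \<xi> + b * fourier_L1 g \<xi>"
    by (simp add: fourier_L1_def distrib_left mult_ac)
qed

lemma fourier_L1_diff:
  assumes "integrable lborel f" "integrable lborel g"
  shows "fourier_L1 (\<lambda>x. f x - g x) = (\<lambda>\<xi>. fourier_L1 f \<xi> - fourier_L1 g \<xi>)"
  using fourier_L1_linear[OF assms, of 1 "-1"] by simp

lemma nmass_fourier_L1_diff:
  assumes "integrable lborel f" "f \<in> L2" "integrable lborel g" "g \<in> L2"
  shows "nmass (\<lambda>\<xi>. fourier_L1 f \<xi> - fourier_L1 g \<xi>) = nmass (\<lambda>x. f x - g x)"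
  using nmass_fourier_L1[of "\<lambda>x. f x - g x"] assms by (simp add: fourier_L1_diff L2_diff)

lemma fourier_L1_L2:
  assumes "integrable lborel f" "f \<in> L2"
  shows "fourier_L1 f \<in> L2"
  using nmass_fourier_L1[OF assms] L2_nmass[OF assms(2)] assms(1) by (auto simp: L2_iff)

lemma nmass_tendsto_trans:
  assumes [measurable]: "\<And>n. f n \<in> borel_measurable borel" "\<And>n. g n \<in> borel_measurable borel"
      "h \<in> borel_measurable borel"
    and "((\<lambda>n. nmass (\<lambda>x. f n x - g n x)) \<longlongrightarrow> 0) F" "((\<lambda>n. nmass (\<lambda>x. g n x - h x)) \<longlongrightarrow> 0) F"
  shows "((\<lambda>n. nmass (\<lambda>x. f n x - h x)) \<longlongrightarrow> 0) F"
proof (rule ennreal_tendsto_0I)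
  fix e :: real assume e: "0 < e"
  then have "0 < e / 4" by simp
  from ennreal_tendsto_0D[OF assms(4) this] ennreal_tendsto_0D[OF assms(5) this]
  show "\<forall>\<^sub>F n in F. nmass (\<lambda>x. f n x - h x) \<le> ennreal e"
  proof eventually_elim
    case (elim n)
    have "nmass (\<lambda>x. f n x - h x) \<le> 2 * nmass (\<lambda>x. f n x - g n x) + 2 * nmass (\<lambda>x. g n x - h x)"
      by (rule nmass_triangle) measurable
    also have "\<dots> \<le> 2 * ennreal (e / 4) + 2 * ennreal (e / 4)"
      using elim by (intro add_mono mult_mono) (auto simp: less_imp_le)
    also have "\<dots> = ennreal e" using e by (simp add: ennreal_double_add)
    finally show ?case .
  qed
qed

lemma Cauchy_fourier_L1:
  assumes f: "\<And>n. integrable lborel (f n)" "\<And>n. f n \<in> L2" and u: "u \<in> L2"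
    and lim: "(\<lambda>n::nat. nmass (\<lambda>x. f n x - u x)) \<longlonglongrightarrow> 0" and e: "0 < (e::real)"
  shows "\<exists>N. \<forall>i\<ge>N. \<forall>j\<ge>N. nmass (\<lambda>\<xi>. fourier_L1 (f i) \<xi> - fourier_L1 (f j) \<xi>) \<le> ennreal e"
proof -
  note m = L2_measurable[OF u] L2_measurable[OF f(2)]
  have "0 < e / 4" using e by simp
  from ennreal_tendsto_0D[OF lim this]
  obtain N where N: "\<And>n. n \<ge> N \<Longrightarrow> nmass (\<lambda>x. f n x - u x) < ennreal (e / 4)"
    by (auto simp: eventually_sequentially)
  have "nmass (\<lambda>\<xi>. fourier_L1 (f i) \<xi> - fourier_L1 (f j) \<xi>) \<le> ennreal e" if "i \<ge> N" "j \<ge> N" for i j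
  proof -
    have "nmass (\<lambda>\<xi>. fourier_L1 (f i) \<xi> - fourier_L1 (f j) \<xi>) = nmass (\<lambda>x. f i x - f j x)"
      by (rule nmass_fourier_L1_diff[OF f(1,2) f(1,2)])
    also have "\<dots> \<le> 2 * nmass (\<lambda>x. f i x - u x) + 2 * nmass (\<lambda>x. u x - f j x)"
      using m by (intro nmass_triangle) auto
    also have "\<dots> \<le> 2 * ennreal (e / 4) + 2 * ennreal (e / 4)"
      using N[OF that(1)] N[OF that(2)] nmass_minus_commute[of u "f j"]
      by (intro add_mono mult_mono) (auto simp: less_imp_le)
    also have "\<dots> = ennreal e" using e by (simp add: ennreal_double_add)
    finally show ?thesis .
  qed
  then show ?thesis by blast
qed

text \<open>By the isometry, any integrable approximation in \<open>L2\<close> identifies the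
  transform, not only the symmetric cutoffs of the definition. Translates need this freedom, because
  a translated cutoff is not a symmetric cutoff of the translate.\<close>

lemma fourier_L1_tendsto_imp_is_fourier:
  assumes f: "\<And>n. integrable lborel (f n)" "\<And>n. f n \<in> L2" and u: "u \<in> L2"
    and lim: "(\<lambda>n::nat. nmass (\<lambda>x. f n x - u x)) \<longlonglongrightarrow> 0"
    and g: "g \<in> L2" and lim': "(\<lambda>n. nmass (\<lambda>\<xi>. fourier_L1 (f n) \<xi> - g \<xi>)) \<longlonglongrightarrow> 0"
  shows "is_fourier u g"
  unfolding is_fourier_iff
proof (intro conjI g ennreal_tendsto_0I)
  fix e :: real assume e: "0 < e"
  \<comment> \<open>The triangle inequality for squared norms doubles its terms and is applied
    twice: 2 (e / 16) + 2 (e / 16) = e / 4, and 2 (e / 4) + 2 (e / 16) \<le> e.\<close>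
  then have "0 < e / 16" by simp
  note m = L2_measurable[OF u] L2_measurable[OF f(2)] L2_measurable[OF cutoff_L2[OF u]] L2_measurable[OF g]
    L2_measurable[OF fourier_L1_L2[OF f]] L2_measurable[OF fourier_L1_L2[OF cutoff_integrable[OF u] cutoff_L2[OF u]]]
  from eventually_happens[OF eventually_conj[OF
      ennreal_tendsto_0D[OF lim \<open>0 < e / 16\<close>] ennreal_tendsto_0D[OF lim' \<open>0 < e / 16\<close>]]]
  obtain n where n: "nmass (\<lambda>x. f n x - u x) < ennreal (e / 16)"
    "nmass (\<lambda>\<xi>. fourier_L1 (f n) \<xi> - g \<xi>) < ennreal (e / 16)" by auto
  from ennreal_tendsto_0D[OF cutoff_tendsto[OF u] \<open>0 < e / 16\<close>]
  show "\<forall>\<^sub>F R in at_top. nmass (\<lambda>\<xi>. fourier_L1 (cutoff R u) \<xi> - g \<xi>) \<le> ennreal e"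
  proof eventually_elim
    case (elim R)
    have "nmass (\<lambda>\<xi>. fourier_L1 (cutoff R u) \<xi> - fourier_L1 (f n) \<xi>) = nmass (\<lambda>x. cutoff R u x - f n x)"
      by (rule nmass_fourier_L1_diff[OF cutoff_integrable[OF u] cutoff_L2[OF u] f])
    also have "\<dots> \<le> 2 * nmass (\<lambda>x. cutoff R u x - u x) + 2 * nmass (\<lambda>x. u x - f n x)"
      using m by (intro nmass_triangle) auto
    also have "\<dots> \<le> 2 * ennreal (e / 16) + 2 * ennreal (e / 16)"
      using elim n(1) nmass_minus_commute[of u "f n"] by (intro add_mono mult_mono) (auto simp: less_imp_le)
    also have "\<dots> = ennreal (e / 4)" using e by (simp add: ennreal_double_add)
    finally have A: "nmass (\<lambda>\<xi>. fourier_L1 (cutoff R u) \<xi> - fourier_L1 (f n) \<xi>) \<le> ennreal (e / 4)" .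
    have "nmass (\<lambda>\<xi>. fourier_L1 (cutoff R u) \<xi> - g \<xi>)
       \<le> 2 * nmass (\<lambda>\<xi>. fourier_L1 (cutoff R u) \<xi> - fourier_L1 (f n) \<xi>) + 2 * nmass (\<lambda>\<xi>. fourier_L1 (f n) \<xi> - g \<xi>)"
      using m by (intro nmass_triangle) auto
    also have "\<dots> \<le> 2 * ennreal (e / 4) + 2 * ennreal (e / 16)"
      using A n(2) by (intro add_mono mult_mono) (auto simp: less_imp_le)
    also have "\<dots> \<le> ennreal e" using e by (simp add: ennreal_double_add)
    finally show ?case .
  qed
qed

lemma is_fourier_exists:
  assumes u: "u \<in> L2"
  shows "\<exists>g. is_fourier u g"
proof -
  let ?f = "\<lambda>n. cutoff (real n) u"
  note f = cutoff_integrable[OF u] cutoff_L2[OF u]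
  obtain g where "g \<in> L2" "(\<lambda>n. nmass (\<lambda>x. fourier_L1 (?f n) x - g x)) \<longlonglongrightarrow> 0"
    using L2_complete[OF fourier_L1_L2[OF f] Cauchy_fourier_L1[OF f u cutoff_seq_tendsto[OF u]]] by blast
  from fourier_L1_tendsto_imp_is_fourier[OF f u cutoff_seq_tendsto[OF u] this] show ?thesis by blast
qed

lemma is_fourier_fourier: "u \<in> L2 \<Longrightarrow> is_fourier u (fourier u)"
  unfolding fourier_def using is_fourier_exists by (rule someI_ex)

lemma fourier_L2: "u \<in> L2 \<Longrightarrow> fourier u \<in> L2"
  using is_fourier_fourier by (simp add: is_fourier_def)

lemma nmass_diff_0_AE:
  assumes [measurable]: "f \<in> borel_measurable borel" "g \<in> borel_measurable borel"
    and "nmass (\<lambda>x. f x - g x) = 0"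
  shows "AE x in lborel. f x = g x"
proof -
  have "AE x in lborel. ennreal ((cmod (f x - g x))\<^sup>2) = 0"
    using assms(3) unfolding nmass_def by (subst (asm) nn_integral_0_iff_AE) auto
  then show ?thesis by eventually_elim simp
qed

lemma nmass_limit_unique:
  assumes f: "\<And>n. f n \<in> borel_measurable borel" and [measurable]: "g \<in> borel_measurable borel" "h \<in> borel_measurable borel"
    and "((\<lambda>n. nmass (\<lambda>x. f n x - g x)) \<longlongrightarrow> 0) F" "((\<lambda>n. nmass (\<lambda>x. f n x - h x)) \<longlongrightarrow> 0) F" "F \<noteq> bot"
  shows "AE x in lborel. g x = h x"
proof (rule nmass_diff_0_AE)
  have "((\<lambda>n. nmass (\<lambda>x. g x - h x)) \<longlongrightarrow> 0) F"
  proof (rule nmass_tendsto_trans[where g = f])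
    show "((\<lambda>n. nmass (\<lambda>x. g x - f n x)) \<longlongrightarrow> 0) F"
      using assms(4) by (subst nmass_minus_commute)
  qed (use assms in auto)
  then show "nmass (\<lambda>x. g x - h x) = 0" using assms(6) by (simp add: tendsto_const_iff)
qed auto

lemma is_fourier_AE_unique:
  assumes u: "u \<in> L2" and "is_fourier u g" "is_fourier u h"
  shows "AE \<xi> in lborel. g \<xi> = h \<xi>"
proof (rule nmass_limit_unique[where F = at_top and f = "\<lambda>R. fourier_L1 (cutoff R u)"])
  show "fourier_L1 (cutoff R u) \<in> borel_measurable borel" for R
    by (rule borel_measurable_fourier_L1[OF cutoff_integrable[OF u]])
qed (use assms in \<open>auto simp: is_fourier_iff L2_measurable\<close>)

lemma is_fourier_AE_fourier:
  "u \<in> L2 \<Longrightarrow> is_fourier u g \<Longrightarrow> AE \<xi> in lborel. fourier u \<xi> = g \<xi>"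
  using is_fourier_AE_unique is_fourier_fourier by blast

lemma fourier_L1_tendsto_fourier:
  assumes f: "\<And>n. integrable lborel (f n)" "\<And>n. f n \<in> L2" and u: "u \<in> L2"
    and lim: "(\<lambda>n::nat. nmass (\<lambda>x. f n x - u x)) \<longlonglongrightarrow> 0"
  shows "(\<lambda>n. nmass (\<lambda>\<xi>. fourier_L1 (f n) \<xi> - fourier u \<xi>)) \<longlonglongrightarrow> 0"
proof -
  obtain g where g: "g \<in> L2" "(\<lambda>n. nmass (\<lambda>x. fourier_L1 (f n) x - g x)) \<longlonglongrightarrow> 0"
    using L2_complete[OF fourier_L1_L2[OF f] Cauchy_fourier_L1[OF f u lim]] by blast
  have ae: "AE \<xi> in lborel. fourier u \<xi> = g \<xi>"
    by (rule is_fourier_AE_fourier[OF u fourier_L1_tendsto_imp_is_fourier[OF f u lim g]])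
  have "nmass (\<lambda>\<xi>. fourier_L1 (f n) \<xi> - fourier u \<xi>) = nmass (\<lambda>x. fourier_L1 (f n) x - g x)" for n
    by (rule nmass_cong_AE) (use ae in auto)
  then show ?thesis using g(2) by simp
qed

lemma fourier_cutoff_tendsto:
  "u \<in> L2 \<Longrightarrow> (\<lambda>n. nmass (\<lambda>\<xi>. fourier_L1 (cutoff (real n) u) \<xi> - fourier u \<xi>)) \<longlonglongrightarrow> 0"
  by (rule fourier_L1_tendsto_fourier[OF cutoff_integrable cutoff_L2 _ cutoff_seq_tendsto])

lemma mass_fourier:
  assumes u: "u \<in> L2"
  shows "mass (fourier u) = mass u"
proof -
  note f = cutoff_integrable[OF u] cutoff_L2[OF u]
  have "(\<lambda>n. mass (fourier_L1 (cutoff (real n) u))) \<longlonglongrightarrow> mass (fourier u)"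
    by (rule mass_tendsto[OF fourier_L1_L2[OF f] fourier_L2[OF u] fourier_cutoff_tendsto[OF u]])
  moreover have "mass (fourier_L1 (cutoff (real n) u)) = mass (cutoff (real n) u)" for n
    using nmass_fourier_L1[OF f] nmass_eq_mass[OF f(2)] nmass_eq_mass[OF fourier_L1_L2[OF f]]
    by (simp add: mass_nonneg)
  moreover have "(\<lambda>n. mass (cutoff (real n) u)) \<longlonglongrightarrow> mass u"
    by (rule mass_tendsto[OF f(2) u cutoff_seq_tendsto[OF u]])
  ultimately show ?thesis using LIMSEQ_unique by simp
qed

lemma nmass_fourier: "u \<in> L2 \<Longrightarrow> nmass (fourier u) = nmass u"
  by (simp add: nmass_eq_mass fourier_L2 mass_fourier)

section \<open>Linearity, translations and dilations\<close>

text \<open>The choice in \<open>fourier\<close> depends only on the predicate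
  \<open>is_fourier u\<close>, which does not change on null sets. Hence the transforms are equal as
  functions and not merely almost everywhere.\<close>

lemma fourier_cong_AE:
  assumes "AE x in lborel. u x = w x" "u \<in> borel_measurable borel" "w \<in> borel_measurable borel"
  shows "fourier u = fourier w"
proof -
  have "fourier_L1 (cutoff R u) = fourier_L1 (cutoff R w)" for R
    unfolding fourier_L1_def[abs_def]
    by (intro ext arg_cong2[where f = "(*)"] refl integral_cong_AE)
       (use assms in \<open>auto simp: cutoff_def\<close>)
  then have "is_fourier u = is_fourier w" by (intro ext) (simp add: is_fourier_iff)
  then show ?thesis by (simp add: fourier_def)
qed

text \<open>The representatives chosen for u, w and their combination are unrelated, so a null set
  has to be excepted.\<close>

lemma fourier_linear:
  assumes u: "u \<in> L2" and w: "w \<in> L2"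
  shows "AE \<xi> in lborel. fourier (\<lambda>x. a * u x + b * w x) \<xi> = a * fourier u \<xi> + b * fourier w \<xi>"
proof (rule is_fourier_AE_fourier)
  note f = cutoff_integrable[OF u] cutoff_L2[OF u]
  note g = cutoff_integrable[OF w] cutoff_L2[OF w]
  note m = L2_measurable[OF u] L2_measurable[OF w] L2_measurable[OF f(2)] L2_measurable[OF g(2)]
  have lin: "(\<lambda>n. nmass (\<lambda>x. (a * U n x + b * W n x) - (a * U' x + b * W' x))) \<longlonglongrightarrow> 0"
    if U: "\<And>n. U n \<in> L2" "\<And>n. W n \<in> L2" "U' \<in> L2" "W' \<in> L2"
    and l: "(\<lambda>n. nmass (\<lambda>x. U n x - U' x)) \<longlonglongrightarrow> 0" "(\<lambda>n. nmass (\<lambda>x. W n x - W' x)) \<longlonglongrightarrow> 0"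
    for U W :: "nat \<Rightarrow> real \<Rightarrow> complex" and U' W'
  proof -
    have "nmass (\<lambda>x. (a * U n x + b * W n x) - (a * U' x + b * W' x))
      \<le> 2 * (ennreal ((cmod a)\<^sup>2) * nmass (\<lambda>x. U n x - U' x)) + 2 * (ennreal ((cmod b)\<^sup>2) * nmass (\<lambda>x. W n x - W' x))" for n
    proof -
      note [measurable] = L2_measurable[OF U(1)] L2_measurable[OF U(2)] L2_measurable[OF U(3)] L2_measurable[OF U(4)]
      have "nmass (\<lambda>x. (a * U n x + b * W n x) - (a * U' x + b * W' x)) = nmass (\<lambda>x. a * (U n x - U' x) + b * (W n x - W' x))"
        by (simp add: algebra_simps)
      also have "\<dots> \<le> 2 * nmass (\<lambda>x. a * (U n x - U' x)) + 2 * nmass (\<lambda>x. b * (W n x - W' x))"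
        by (rule nmass_add_le) measurable
      finally show ?thesis by (simp add: nmass_cmult)
    qed
    note le = this
    have "(\<lambda>n. 2 * (ennreal ((cmod a)\<^sup>2) * nmass (\<lambda>x. U n x - U' x)) + 2 * (ennreal ((cmod b)\<^sup>2) * nmass (\<lambda>x. W n x - W' x)))
       \<longlonglongrightarrow> 2 * (ennreal ((cmod a)\<^sup>2) * 0) + 2 * (ennreal ((cmod b)\<^sup>2) * 0)"
      by (intro tendsto_add ennreal_tendsto_cmult l) auto
    then have "(\<lambda>n. 2 * (ennreal ((cmod a)\<^sup>2) * nmass (\<lambda>x. U n x - U' x)) + 2 * (ennreal ((cmod b)\<^sup>2) * nmass (\<lambda>x. W n x - W' x)))
       \<longlonglongrightarrow> 0" by simp
    from ennreal_null_comparison[OF le this] show ?thesis .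
  qed
  show "(\<lambda>x. a * u x + b * w x) \<in> L2" by (intro L2_add L2_cmult u w)
  show "is_fourier (\<lambda>x. a * u x + b * w x) (\<lambda>\<xi>. a * fourier u \<xi> + b * fourier w \<xi>)"
  proof (rule fourier_L1_tendsto_imp_is_fourier)
    show "integrable lborel (\<lambda>x. a * cutoff (real n) u x + b * cutoff (real n) w x)" for n using f g by simp
    show "(\<lambda>x. a * cutoff (real n) u x + b * cutoff (real n) w x) \<in> L2" for n by (intro L2_add L2_cmult f g)
    show "(\<lambda>n. nmass (\<lambda>x. a * cutoff (real n) u x + b * cutoff (real n) w x - (a * u x + b * w x))) \<longlonglongrightarrow> 0"
      by (rule lin[OF f(2) g(2) u w cutoff_seq_tendsto[OF u] cutoff_seq_tendsto[OF w]])
    show "(\<lambda>n. nmass (\<lambda>\<xi>. fourier_L1 (\<lambda>x. a * cutoff (real n) u x + b * cutoff (real n) w x) \<xi> - (a * fourier u \<xi> + b * fourier w \<xi>))) \<longlonglongrightarrow> 0"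
      unfolding fourier_L1_linear[OF f(1) g(1)]
      by (rule lin[OF fourier_L1_L2[OF f] fourier_L1_L2[OF g] fourier_L2[OF u] fourier_L2[OF w]
            fourier_cutoff_tendsto[OF u] fourier_cutoff_tendsto[OF w]])
  qed (intro L2_add L2_cmult u w fourier_L2)+
qed

lemma fourier_diff:
  assumes "u \<in> L2" "w \<in> L2"
  shows "AE \<xi> in lborel. fourier (\<lambda>x. u x - w x) \<xi> = fourier u \<xi> - fourier w \<xi>"
  using fourier_linear[OF assms, of 1 "-1"] by simp

lemma fourier_cmult:
  assumes "u \<in> L2"
  shows "AE \<xi> in lborel. fourier (\<lambda>x. a * u x) \<xi> = a * fourier u \<xi>"
  using fourier_linear[OF assms assms, of a 0] by simp

lemma fourier_translate:
  assumes u: "u \<in> L2"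
  shows "AE \<xi> in lborel. fourier (\<lambda>x. u (x + y)) \<xi> = cis (y * \<xi>) * fourier u \<xi>"
proof (rule is_fourier_AE_fourier)
  note f = cutoff_integrable[OF u] cutoff_L2[OF u]
  show "(\<lambda>x. u (x + y)) \<in> L2" by (rule L2_translate[OF u])
  show "is_fourier (\<lambda>x. u (x + y)) (\<lambda>\<xi>. cis (y * \<xi>) * fourier u \<xi>)"
  proof (rule fourier_L1_tendsto_imp_is_fourier)
    show "integrable lborel (\<lambda>x. cutoff (real n) u (x + y))" for n by (rule integrable_translate[OF f(1)])
    show "(\<lambda>x. cutoff (real n) u (x + y)) \<in> L2" for n by (rule L2_translate[OF f(2)])
    have "nmass (\<lambda>x. cutoff (real n) u (x + y) - u (x + y)) = nmass (\<lambda>x. cutoff (real n) u x - u x)" for n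
      using L2_measurable[OF u] L2_measurable[OF f(2)]
      by (intro nmass_translate[of "\<lambda>x. cutoff (real n) u x - u x"]) auto
    then show "(\<lambda>n. nmass (\<lambda>x. cutoff (real n) u (x + y) - u (x + y))) \<longlonglongrightarrow> 0"
      using cutoff_seq_tendsto[OF u] by simp
    show "(\<lambda>\<xi>. cis (y * \<xi>) * fourier u \<xi>) \<in> L2"
      by (rule L2_mono[OF fourier_L2[OF u]]) (use L2_measurable[OF fourier_L2[OF u]] in \<open>auto simp: norm_mult\<close>)
    have "fourier_L1 (\<lambda>x. cutoff (real n) u (x + y)) \<xi> = cis (y * \<xi>) * fourier_L1 (cutoff (real n) u) \<xi>" for n \<xi>
    proof -
      have "cis (- (x * \<xi>)) = cis (y * \<xi>) * cis (- ((x + y) * \<xi>))" for x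
        by (simp add: cis_mult distrib_right)
      then have "cis (- (x * \<xi>)) * cutoff (real n) u (x + y)
         = cis (y * \<xi>) * (cis (- ((x + y) * \<xi>)) * cutoff (real n) u (x + y))" for x
        by (metis mult.assoc)
      then have "(LINT x|lborel. cis (- (x * \<xi>)) * cutoff (real n) u (x + y))
         = (LINT x|lborel. cis (y * \<xi>) * (cis (- ((x + y) * \<xi>)) * cutoff (real n) u (x + y)))"
        by (rule Bochner_Integration.integral_cong[OF refl])
      also have "\<dots> = cis (y * \<xi>) * (LINT x|lborel. cis (- ((x + y) * \<xi>)) * cutoff (real n) u (x + y))"
        by (rule integral_mult_right_zero)
      also have "(LINT x|lborel. cis (- ((x + y) * \<xi>)) * cutoff (real n) u (x + y)) = (LINT x|lborel. cis (- (x * \<xi>)) * cutoff (real n) u x)"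
        by (rule integral_translate[of "\<lambda>x. cis (- (x * \<xi>)) * cutoff (real n) u x"])
      finally show ?thesis by (simp add: fourier_L1_def mult_ac)
    qed
    then have "nmass (\<lambda>\<xi>. fourier_L1 (\<lambda>x. cutoff (real n) u (x + y)) \<xi> - cis (y * \<xi>) * fourier u \<xi>)
       = nmass (\<lambda>\<xi>. fourier_L1 (cutoff (real n) u) \<xi> - fourier u \<xi>)" for n
      by (simp add: nmass_def norm_mult flip: right_diff_distrib)
    then show "(\<lambda>n. nmass (\<lambda>\<xi>. fourier_L1 (\<lambda>x. cutoff (real n) u (x + y)) \<xi> - cis (y * \<xi>) * fourier u \<xi>)) \<longlonglongrightarrow> 0"
      using fourier_cutoff_tendsto[OF u] by simp
  qed (rule L2_translate[OF u])
qed

lemma fourier_dilate: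
  assumes u: "u \<in> L2" and l: "0 < l"
  shows "AE \<xi> in lborel. fourier (\<lambda>x. u (x / l)) \<xi> = complex_of_real l * fourier u (l * \<xi>)"
proof (rule is_fourier_AE_fourier)
  note f = cutoff_integrable[OF u] cutoff_L2[OF u]
  show "(\<lambda>x. u (x / l)) \<in> L2" by (rule L2_dilate[OF u l])
  \<comment> \<open>Reading l * \<xi> as \<xi> / inverse l lets the dilation rules for
    \<open>L2\<close> and \<open>nmass\<close> act on the frequency side as well.\<close>
  have il: "inverse l > 0" using l by simp
  show "is_fourier (\<lambda>x. u (x / l)) (\<lambda>\<xi>. complex_of_real l * fourier u (l * \<xi>))"
  proof (rule fourier_L1_tendsto_imp_is_fourier)
    show "integrable lborel (\<lambda>x. cutoff (real n) u (x / l))" for n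
      using lborel_integrable_real_affine[OF f(1)[where R = "real n"], of "1/l" 0] l by simp
    show "(\<lambda>x. cutoff (real n) u (x / l)) \<in> L2" for n by (rule L2_dilate[OF f(2) l])
    have "nmass (\<lambda>x. cutoff (real n) u (x / l) - u (x / l)) = ennreal l * nmass (\<lambda>x. cutoff (real n) u x - u x)" for n
      using L2_measurable[OF u] L2_measurable[OF f(2)] l
      by (intro nmass_dilate[of "\<lambda>x. cutoff (real n) u x - u x"]) auto
    moreover have "(\<lambda>n. ennreal l * nmass (\<lambda>x. cutoff (real n) u x - u x)) \<longlonglongrightarrow> ennreal l * 0"
      by (intro ennreal_tendsto_cmult cutoff_seq_tendsto[OF u]) auto
    ultimately show "(\<lambda>n. nmass (\<lambda>x. cutoff (real n) u (x / l) - u (x / l))) \<longlonglongrightarrow> 0" by simp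
    show "(\<lambda>\<xi>. complex_of_real l * fourier u (l * \<xi>)) \<in> L2"
      using L2_cmult[OF L2_dilate[OF fourier_L2[OF u] il]] by (simp add: field_simps)
    have "fourier_L1 (\<lambda>x. cutoff (real n) u (x / l)) \<xi> = complex_of_real l * fourier_L1 (cutoff (real n) u) (l * \<xi>)" for n \<xi>
    proof -
      have "(LINT x|lborel. cis (- (x * \<xi>)) * cutoff (real n) u (x / l))
         = l *\<^sub>R (LINT x|lborel. cis (- (x * (l * \<xi>))) * cutoff (real n) u x)"
        using l by (subst lborel_integral_real_affine[where c = l and t = 0]) (auto simp: mult_ac)
      then show ?thesis by (simp add: fourier_L1_def scaleR_conv_of_real mult_ac)
    qed
    then have "nmass (\<lambda>\<xi>. fourier_L1 (\<lambda>x. cutoff (real n) u (x / l)) \<xi> - complex_of_real l * fourier u (l * \<xi>))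
       = nmass (\<lambda>\<xi>. complex_of_real l * (fourier_L1 (cutoff (real n) u) (\<xi> / inverse l) - fourier u (\<xi> / inverse l)))" for n
      by (simp only: right_diff_distrib divide_inverse inverse_inverse_eq mult.commute[of l])
    also have "\<dots> n = ennreal (l\<^sup>2) * (ennreal (inverse l) * nmass (\<lambda>\<xi>. fourier_L1 (cutoff (real n) u) \<xi> - fourier u \<xi>))" for n
      using L2_measurable[OF fourier_L2[OF u]] L2_measurable[OF fourier_L1_L2[OF f]] il l
      by (subst nmass_cmult) (auto simp: nmass_dilate[of "\<lambda>\<xi>. fourier_L1 (cutoff (real n) u) \<xi> - fourier u \<xi>"])
    finally have eq: "nmass (\<lambda>\<xi>. fourier_L1 (\<lambda>x. cutoff (real n) u (x / l)) \<xi> - complex_of_real l * fourier u (l * \<xi>))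
       = ennreal (l\<^sup>2) * (ennreal (inverse l) * nmass (\<lambda>\<xi>. fourier_L1 (cutoff (real n) u) \<xi> - fourier u \<xi>))" for n .
    have "(\<lambda>n. ennreal (l\<^sup>2) * (ennreal (inverse l) * nmass (\<lambda>\<xi>. fourier_L1 (cutoff (real n) u) \<xi> - fourier u \<xi>))) \<longlonglongrightarrow> ennreal (l\<^sup>2) * (ennreal (inverse l) * 0)"
      by (intro ennreal_tendsto_cmult fourier_cutoff_tendsto[OF u]) auto
    then show "(\<lambda>n. nmass (\<lambda>\<xi>. fourier_L1 (\<lambda>x. cutoff (real n) u (x / l)) \<xi> - complex_of_real l * fourier u (l * \<xi>))) \<longlonglongrightarrow> 0"
      unfolding eq by simp
  qed (rule L2_dilate[OF u l])
qed

section \<open>The Gagliardo form of the kinetic energy\<close>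

text \<open>The counterpart of \<open>kinetic 0\<close> with values in the extended half-line,
  introduced for the same reason as \<open>nmass\<close>.\<close>

definition nkin :: "(real \<Rightarrow> complex) \<Rightarrow> ennreal" where
  "nkin u = (\<integral>\<^sup>+\<xi>. ennreal (\<bar>\<xi>\<bar> * (cmod (fourier u \<xi>))\<^sup>2) \<partial>lborel)"

lemma fourier_measurable: "u \<in> L2 \<Longrightarrow> fourier u \<in> borel_measurable borel"
  using fourier_L2 L2_measurable by blast

lemma bracket_bounds:
  fixes \<xi> :: real
  shows "\<bar>\<xi>\<bar> \<le> (1 + \<xi>\<^sup>2) powr (1/2)" "1 \<le> (1 + \<xi>\<^sup>2) powr (1/2)" "(1 + \<xi>\<^sup>2) powr (1/2) \<le> 1 + \<bar>\<xi>\<bar>"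
proof -
  have e: "(1 + \<xi>\<^sup>2) powr (1/2) = sqrt (1 + \<xi>\<^sup>2)" by (simp add: powr_half_sqrt)
  show "\<bar>\<xi>\<bar> \<le> (1 + \<xi>\<^sup>2) powr (1/2)" "1 \<le> (1 + \<xi>\<^sup>2) powr (1/2)"
    unfolding e by (auto intro!: real_le_rsqrt)
  show "(1 + \<xi>\<^sup>2) powr (1/2) \<le> 1 + \<bar>\<xi>\<bar>"
    unfolding e by (rule real_le_lsqrt) (auto simp: power2_sum)
qed

lemma H_half_iff: "u \<in> H_half \<longleftrightarrow> u \<in> L2 \<and> nkin u < \<infinity>"
proof (cases "u \<in> L2")
  case True
  note [measurable] = fourier_measurable[OF True]
  let ?w = "\<lambda>\<xi>::real. (1 + \<xi>\<^sup>2) powr (1/2)"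
  have lo: "nkin u \<le> (\<integral>\<^sup>+\<xi>. ennreal (?w \<xi> * (cmod (fourier u \<xi>))\<^sup>2) \<partial>lborel)"
    unfolding nkin_def by (intro nn_integral_mono ennreal_leI mult_right_mono bracket_bounds) auto
  have up: "(\<integral>\<^sup>+\<xi>. ennreal (?w \<xi> * (cmod (fourier u \<xi>))\<^sup>2) \<partial>lborel) \<le> nmass (fourier u) + nkin u"
  proof -
    have "(\<integral>\<^sup>+\<xi>. ennreal (?w \<xi> * (cmod (fourier u \<xi>))\<^sup>2) \<partial>lborel)
      \<le> (\<integral>\<^sup>+\<xi>. ennreal ((cmod (fourier u \<xi>))\<^sup>2) + ennreal (\<bar>\<xi>\<bar> * (cmod (fourier u \<xi>))\<^sup>2) \<partial>lborel)"
    proof (intro nn_integral_mono)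
      fix \<xi>
      have "?w \<xi> * (cmod (fourier u \<xi>))\<^sup>2 \<le> (1 + \<bar>\<xi>\<bar>) * (cmod (fourier u \<xi>))\<^sup>2"
        by (intro mult_right_mono bracket_bounds) auto
      then show "ennreal (?w \<xi> * (cmod (fourier u \<xi>))\<^sup>2) \<le> ennreal ((cmod (fourier u \<xi>))\<^sup>2) + ennreal (\<bar>\<xi>\<bar> * (cmod (fourier u \<xi>))\<^sup>2)"
        by (simp add: distrib_right ennreal_leI flip: ennreal_plus)
    qed
    then show ?thesis unfolding nkin_def nmass_def by (subst (asm) nn_integral_add) auto
  qed
  have fin: "nmass (fourier u) < \<infinity>" using L2_nmass[OF fourier_L2[OF True]] by simp
  have "(\<integral>\<^sup>+\<xi>. ennreal (?w \<xi> * (cmod (fourier u \<xi>))\<^sup>2) \<partial>lborel) < \<infinity> \<longleftrightarrow> nkin u < \<infinity>"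
  proof
    assume "nkin u < \<infinity>"
    then have "nmass (fourier u) + nkin u < \<infinity>" using fin by simp
    then show "(\<integral>\<^sup>+\<xi>. ennreal (?w \<xi> * (cmod (fourier u \<xi>))\<^sup>2) \<partial>lborel) < \<infinity>"
      by (rule le_less_trans[OF up])
  qed (rule le_less_trans[OF lo])
  moreover have "integrable lborel (\<lambda>\<xi>. ?w \<xi> * (cmod (fourier u \<xi>))\<^sup>2) \<longleftrightarrow>
      (\<integral>\<^sup>+\<xi>. ennreal (?w \<xi> * (cmod (fourier u \<xi>))\<^sup>2) \<partial>lborel) < \<infinity>"
    by (simp add: integrable_iff_bounded)
  ultimately show ?thesis using True unfolding H_half_def by simp
qed (simp add: H_half_def)

lemma H_half_L2: "u \<in> H_half \<Longrightarrow> u \<in> L2"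
  by (simp add: H_half_def)

lemma H_half_integrable_abs:
  assumes u: "u \<in> H_half"
  shows "integrable lborel (\<lambda>\<xi>. \<bar>\<xi>\<bar> * (cmod (fourier u \<xi>))\<^sup>2)"
  using u fourier_measurable[OF H_half_L2[OF u]]
  by (auto simp: H_half_iff nkin_def integrable_iff_bounded)

lemma H_half_integrable:
  assumes u: "u \<in> H_half"
  shows "integrable lborel (\<lambda>\<xi>. \<xi> * (cmod (fourier u \<xi>))\<^sup>2)"
    "integrable lborel (\<lambda>\<xi>. (\<bar>\<xi>\<bar> - v * \<xi>) * (cmod (fourier u \<xi>))\<^sup>2)"
proof -
  note [measurable] = fourier_measurable[OF H_half_L2[OF u]]
  show 1: "integrable lborel (\<lambda>\<xi>. \<xi> * (cmod (fourier u \<xi>))\<^sup>2)"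
    by (rule Bochner_Integration.integrable_bound[OF H_half_integrable_abs[OF u]]) (auto simp: abs_mult)
  have "integrable lborel (\<lambda>\<xi>. \<bar>\<xi>\<bar> * (cmod (fourier u \<xi>))\<^sup>2 - v * (\<xi> * (cmod (fourier u \<xi>))\<^sup>2))"
    using 1 H_half_integrable_abs[OF u] by simp
  then show "integrable lborel (\<lambda>\<xi>. (\<bar>\<xi>\<bar> - v * \<xi>) * (cmod (fourier u \<xi>))\<^sup>2)"
    by (simp add: algebra_simps)
qed

lemma kinetic_0: "kinetic 0 u = (LINT \<xi>|lborel. \<bar>\<xi>\<bar> * (cmod (fourier u \<xi>))\<^sup>2)"
  by (simp add: kinetic_def)

lemma nkin_eq_kinetic: "u \<in> H_half \<Longrightarrow> nkin u = ennreal (kinetic 0 u)"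
  unfolding nkin_def kinetic_0 by (intro nn_integral_eq_integral H_half_integrable_abs) auto

lemma kinetic_0_nonneg: "0 \<le> kinetic 0 u"
  unfolding kinetic_0 by (intro Bochner_Integration.integral_nonneg) auto

lemma kinetic_decomp:
  assumes u: "u \<in> H_half"
  shows "kinetic v u = kinetic 0 u - v * momentum u"
proof -
  have "kinetic v u = (LINT \<xi>|lborel. \<bar>\<xi>\<bar> * (cmod (fourier u \<xi>))\<^sup>2 - v * (\<xi> * (cmod (fourier u \<xi>))\<^sup>2))"
    by (simp add: kinetic_def algebra_simps)
  then show ?thesis
    using H_half_integrable(1)[OF u] H_half_integrable_abs[OF u] by (simp add: kinetic_0 momentum_def)
qed

lemma momentum_bound:
  assumes u: "u \<in> H_half"
  shows "\<bar>momentum u\<bar> \<le> kinetic 0 u"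
proof -
  have "\<bar>momentum u\<bar> \<le> (LINT \<xi>|lborel. norm (\<xi> * (cmod (fourier u \<xi>))\<^sup>2))"
    using integral_norm_bound[of lborel "\<lambda>\<xi>. \<xi> * (cmod (fourier u \<xi>))\<^sup>2"] by (simp add: momentum_def)
  then show ?thesis by (simp add: kinetic_0 abs_mult)
qed

text \<open>The momentum is at most \<open>kinetic 0\<close> in absolute value, so for |v| < 1 the
  form with symbol |\<xi>| - v \<xi> is comparable to the one with symbol |\<xi>|. All coercivity in
  v comes from here.\<close>

lemma kinetic_lower:
  assumes u: "u \<in> H_half"
  shows "(1 - \<bar>v\<bar>) * kinetic 0 u \<le> kinetic v u" "kinetic v u \<le> (1 + \<bar>v\<bar>) * kinetic 0 u"
proof -
  have "\<bar>v * momentum u\<bar> \<le> \<bar>v\<bar> * kinetic 0 u"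
    using momentum_bound[OF u] by (simp add: abs_mult mult_left_mono)
  then show "(1 - \<bar>v\<bar>) * kinetic 0 u \<le> kinetic v u" "kinetic v u \<le> (1 + \<bar>v\<bar>) * kinetic 0 u"
    unfolding kinetic_decomp[OF u, of v] by (auto simp: abs_le_iff left_diff_distrib distrib_right)
qed

lemma H_half_norm_bounds:
  assumes u: "u \<in> H_half"
  shows "mass u \<le> (H_half_norm u)\<^sup>2" "kinetic 0 u \<le> (H_half_norm u)\<^sup>2"
    "(H_half_norm u)\<^sup>2 \<le> mass u + kinetic 0 u" "0 \<le> H_half_norm u"
proof -
  let ?w = "\<lambda>\<xi>::real. (1 + \<xi>\<^sup>2) powr (1/2)"
  have i: "integrable lborel (\<lambda>\<xi>. ?w \<xi> * (cmod (fourier u \<xi>))\<^sup>2)" using u by (simp add: H_half_def)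
  have "0 \<le> (LINT \<xi>|lborel. ?w \<xi> * (cmod (fourier u \<xi>))\<^sup>2)"
    by (intro Bochner_Integration.integral_nonneg) auto
  then have sq: "(H_half_norm u)\<^sup>2 = (LINT \<xi>|lborel. ?w \<xi> * (cmod (fourier u \<xi>))\<^sup>2)"
    and "0 \<le> H_half_norm u" by (auto simp: H_half_norm_def)
  show "0 \<le> H_half_norm u" by fact
  have j: "integrable lborel (\<lambda>\<xi>. (cmod (fourier u \<xi>))\<^sup>2)"
    using fourier_L2[OF H_half_L2[OF u]] by (simp add: L2_def)
  have m: "mass u = (LINT \<xi>|lborel. (cmod (fourier u \<xi>))\<^sup>2)"
    using mass_fourier[OF H_half_L2[OF u]] by (simp add: mass_def)
  have bb: "1 * (cmod (fourier u \<xi>))\<^sup>2 \<le> ?w \<xi> * (cmod (fourier u \<xi>))\<^sup>2"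
    "\<bar>\<xi>\<bar> * (cmod (fourier u \<xi>))\<^sup>2 \<le> ?w \<xi> * (cmod (fourier u \<xi>))\<^sup>2"
    "?w \<xi> * (cmod (fourier u \<xi>))\<^sup>2 \<le> (1 + \<bar>\<xi>\<bar>) * (cmod (fourier u \<xi>))\<^sup>2" for \<xi>
    by (intro mult_right_mono bracket_bounds; simp)+
  show "mass u \<le> (H_half_norm u)\<^sup>2"
    unfolding m sq using bb(1) by (intro integral_mono i j) auto
  show "kinetic 0 u \<le> (H_half_norm u)\<^sup>2"
    unfolding kinetic_0 sq using bb(2) by (intro integral_mono i H_half_integrable_abs[OF u])
  have "(H_half_norm u)\<^sup>2 \<le> (LINT \<xi>|lborel. (cmod (fourier u \<xi>))\<^sup>2 + \<bar>\<xi>\<bar> * (cmod (fourier u \<xi>))\<^sup>2)"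
    unfolding sq using bb(3) j H_half_integrable_abs[OF u]
    by (intro integral_mono i) (auto simp: distrib_right)
  then show "(H_half_norm u)\<^sup>2 \<le> mass u + kinetic 0 u"
    unfolding m kinetic_0 using j H_half_integrable_abs[OF u] by simp
qed

text \<open>These quantities see only the modulus of the transform, which translations and constant
  phases multiply by unimodular factors.\<close>

lemma cong_cmod_fourier:
  assumes u: "u \<in> L2" and w: "w \<in> L2" and ae: "AE \<xi> in lborel. cmod (fourier u \<xi>) = cmod (fourier w \<xi>)"
  shows "nkin u = nkin w" "kinetic v u = kinetic v w" "momentum u = momentum w" "H_half_norm u = H_half_norm w"
proof -
  note [measurable] = fourier_measurable[OF u] fourier_measurable[OF w]
  show "nkin u = nkin w" unfolding nkin_def by (intro nn_integral_cong_AE) (use ae in auto)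
  show "kinetic v u = kinetic v w" unfolding kinetic_def
    by (intro integral_cong_AE) (use ae in auto)
  show "momentum u = momentum w" unfolding momentum_def
    by (intro integral_cong_AE) (use ae in auto)
  show "H_half_norm u = H_half_norm w" unfolding H_half_norm_def
    by (intro arg_cong[where f = sqrt] integral_cong_AE) (use ae in auto)
qed

lemma translate_invariance:
  assumes u: "u \<in> L2"
  shows "nkin (\<lambda>x. u (x + y)) = nkin u" "kinetic v (\<lambda>x. u (x + y)) = kinetic v u"
    "momentum (\<lambda>x. u (x + y)) = momentum u" "H_half_norm (\<lambda>x. u (x + y)) = H_half_norm u"
proof -
  have "AE \<xi> in lborel. cmod (fourier (\<lambda>x. u (x + y)) \<xi>) = cmod (fourier u \<xi>)"
    using fourier_translate[OF u, of y] by eventually_elim (simp add: norm_mult)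
  from cong_cmod_fourier[OF L2_translate[OF u] u this]
  show "nkin (\<lambda>x. u (x + y)) = nkin u" "kinetic v (\<lambda>x. u (x + y)) = kinetic v u"
    "momentum (\<lambda>x. u (x + y)) = momentum u" "H_half_norm (\<lambda>x. u (x + y)) = H_half_norm u" by auto
qed

lemma phase_invariance:
  assumes u: "u \<in> L2" and c: "cmod c = 1"
  shows "nkin (\<lambda>x. c * u x) = nkin u" "kinetic v (\<lambda>x. c * u x) = kinetic v u"
    "momentum (\<lambda>x. c * u x) = momentum u" "H_half_norm (\<lambda>x. c * u x) = H_half_norm u"
proof -
  have "AE \<xi> in lborel. cmod (fourier (\<lambda>x. c * u x) \<xi>) = cmod (fourier u \<xi>)"
    using fourier_cmult[OF u, of c] by eventually_elim (simp add: norm_mult c)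
  from cong_cmod_fourier[OF L2_cmult[OF u] u this]
  show "nkin (\<lambda>x. c * u x) = nkin u" "kinetic v (\<lambda>x. c * u x) = kinetic v u"
    "momentum (\<lambda>x. c * u x) = momentum u" "H_half_norm (\<lambda>x. c * u x) = H_half_norm u" by auto
qed

lemma H_half_translate: "u \<in> H_half \<Longrightarrow> (\<lambda>x. u (x + y)) \<in> H_half"
  by (simp add: H_half_iff L2_translate translate_invariance)

lemma H_half_phase: "u \<in> H_half \<Longrightarrow> cmod c = 1 \<Longrightarrow> (\<lambda>x. c * u x) \<in> H_half"
  by (simp add: H_half_iff L2_cmult phase_invariance)

lemma nkin_diff_le:
  assumes u: "u \<in> L2" and w: "w \<in> L2"
  shows "nkin (\<lambda>x. u x - w x) \<le> 2 * nkin u + 2 * nkin w"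
proof -
  note [measurable] = fourier_measurable[OF u] fourier_measurable[OF w]
  have "nkin (\<lambda>x. u x - w x) = (\<integral>\<^sup>+\<xi>. ennreal (\<bar>\<xi>\<bar> * (cmod (fourier u \<xi> - fourier w \<xi>))\<^sup>2) \<partial>lborel)"
    unfolding nkin_def by (rule nn_integral_cong_AE) (use fourier_diff[OF u w] in auto)
  also have "\<dots> \<le> (\<integral>\<^sup>+\<xi>. 2 * ennreal (\<bar>\<xi>\<bar> * (cmod (fourier u \<xi>))\<^sup>2) + 2 * ennreal (\<bar>\<xi>\<bar> * (cmod (fourier w \<xi>))\<^sup>2) \<partial>lborel)"
  proof (intro nn_integral_mono)
    fix \<xi>
    have "\<bar>\<xi>\<bar> * (cmod (fourier u \<xi> - fourier w \<xi>))\<^sup>2 \<le> \<bar>\<xi>\<bar> * (2 * (cmod (fourier u \<xi>))\<^sup>2 + 2 * (cmod (fourier w \<xi>))\<^sup>2)"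
      using norm_add_square_le[of "fourier u \<xi>" "- fourier w \<xi>"] by (intro mult_left_mono) auto
    then have "\<bar>\<xi>\<bar> * (cmod (fourier u \<xi> - fourier w \<xi>))\<^sup>2
       \<le> 2 * (\<bar>\<xi>\<bar> * (cmod (fourier u \<xi>))\<^sup>2) + 2 * (\<bar>\<xi>\<bar> * (cmod (fourier w \<xi>))\<^sup>2)"
      by (simp only: distrib_left mult.left_commute)
    from ennreal_leI[OF this] show "ennreal (\<bar>\<xi>\<bar> * (cmod (fourier u \<xi> - fourier w \<xi>))\<^sup>2)
       \<le> 2 * ennreal (\<bar>\<xi>\<bar> * (cmod (fourier u \<xi>))\<^sup>2) + 2 * ennreal (\<bar>\<xi>\<bar> * (cmod (fourier w \<xi>))\<^sup>2)"
      by (subst ennreal_double_add) simp_all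
  qed
  also have "\<dots> = 2 * nkin u + 2 * nkin w"
    unfolding nkin_def by (simp add: nn_integral_add nn_integral_cmult)
  finally show ?thesis .
qed

lemma H_half_diff:
  assumes "u \<in> H_half" "w \<in> H_half"
  shows "(\<lambda>x. u x - w x) \<in> H_half"
  using assms le_less_trans[OF nkin_diff_le[of u w]]
  by (simp add: H_half_iff L2_diff ennreal_mult_less_top)

text \<open>The squared transform of the dilate brings a factor l^2: one l turns |\<xi>| into |l
  \<xi>|, the other is the Jacobian of the substitution.\<close>

lemma nkin_dilate:
  assumes u: "u \<in> L2" and l: "0 < l"
  shows "nkin (\<lambda>x. u (x / l)) = nkin u"
proof -
  note [measurable] = fourier_measurable[OF u]
  have "nkin (\<lambda>x. u (x / l)) = (\<integral>\<^sup>+\<xi>. ennreal (\<bar>\<xi>\<bar> * (cmod (complex_of_real l * fourier u (l * \<xi>)))\<^sup>2) \<partial>lborel)"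
    unfolding nkin_def by (rule nn_integral_cong_AE) (use fourier_dilate[OF u l] in auto)
  also have "\<dots> = ennreal l * (\<integral>\<^sup>+\<xi>. ennreal (\<bar>l * \<xi>\<bar> * (cmod (fourier u (l * \<xi>)))\<^sup>2) \<partial>lborel)"
    using l by (subst nn_integral_cmult[symmetric])
      (auto simp: norm_mult power_mult_distrib abs_mult power2_eq_square mult_ac intro!: nn_integral_cong simp flip: ennreal_mult)
  also have "\<dots> = nkin u"
    unfolding nkin_def using l by (subst nn_integral_real_affine[where c = l and t = 0]) auto
  finally show ?thesis .
qed

lemma H_half_dilate: "u \<in> H_half \<Longrightarrow> 0 < l \<Longrightarrow> (\<lambda>x. u (x / l)) \<in> H_half"
  by (simp add: H_half_iff L2_dilate nkin_dilate)

lemma kinetic_dilate: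
  assumes u: "u \<in> L2" and l: "0 < l"
  shows "kinetic v (\<lambda>x. u (x / l)) = kinetic v u"
proof -
  note [measurable] = fourier_measurable[OF u] fourier_measurable[OF L2_dilate[OF u l]]
  have "kinetic v (\<lambda>x. u (x / l)) = (LINT \<xi>|lborel. (\<bar>\<xi>\<bar> - v * \<xi>) * (cmod (complex_of_real l * fourier u (l * \<xi>)))\<^sup>2)"
    unfolding kinetic_def by (rule integral_cong_AE) (use fourier_dilate[OF u l] in auto)
  also have "\<dots> = (LINT \<xi>|lborel. l * ((\<bar>l * \<xi>\<bar> - v * (l * \<xi>)) * (cmod (fourier u (l * \<xi>)))\<^sup>2))"
    using l by (intro Bochner_Integration.integral_cong)
      (auto simp: norm_mult power_mult_distrib abs_mult power2_eq_square algebra_simps)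
  also have "\<dots> = kinetic v u"
    unfolding kinetic_def using l by (subst lborel_integral_real_affine[where c = l and t = 0]) auto
  finally show ?thesis .
qed

section \<open>The double integral of squared difference quotients\<close>

text \<open>The increment h is the outer variable, so that Plancherel can be applied to each
  increment separately. At h = 0 the quotient is 0 by convention, on a null set.\<close>

definition gagliardo :: "(real \<Rightarrow> complex) \<Rightarrow> ennreal" where
  "gagliardo u = (\<integral>\<^sup>+h. (\<integral>\<^sup>+x. ennreal ((cmod (u (x + h) - u x))\<^sup>2 / h\<^sup>2) \<partial>lborel) \<partial>lborel)"

text \<open>Its value is 2 pi; the argument works with its positivity and finiteness.\<close>

definition gagliardo_const :: ennreal where
  "gagliardo_const = (\<integral>\<^sup>+h. ennreal ((cmod (cis h - 1))\<^sup>2 / h\<^sup>2) \<partial>lborel)"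

lemma cmod_cis_minus_1: "(cmod (cis h - 1))\<^sup>2 = 2 - 2 * cos h"
proof -
  have "(cmod (cis h - 1))\<^sup>2 = (cos h - 1)\<^sup>2 + (sin h)\<^sup>2" by (simp add: cmod_power2)
  also have "\<dots> = 2 - 2 * cos h"
    using sin_cos_squared_add[of h] by (simp add: power2_eq_square algebra_simps)
  finally show ?thesis .
qed

lemma cmod_cis_minus_1_le: "(cmod (cis h - 1))\<^sup>2 \<le> h\<^sup>2" "(cmod (cis h - 1))\<^sup>2 \<le> 4"
proof -
  have "2 - 2 * cos h = 4 * (sin (h / 2))\<^sup>2"
    using cos_double_sin[of "h / 2"] by simp
  also have "\<dots> \<le> 4 * (h / 2)\<^sup>2"
    using abs_sin_x_le_abs_x[of "h/2"] by (intro mult_left_mono) (auto simp: abs_le_square_iff[symmetric])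
  finally show "(cmod (cis h - 1))\<^sup>2 \<le> h\<^sup>2" by (simp add: cmod_cis_minus_1 power_divide)
  show "(cmod (cis h - 1))\<^sup>2 \<le> 4" using cos_ge_minus_one[of h] by (simp add: cmod_cis_minus_1 minus_le_iff)
qed

lemma gagliardo_const_finite: "gagliardo_const < \<infinity>"
proof -
  \<comment> \<open>In the product with 1 + h^2, the summand 1 is paired with the bound h^2 and the
    summand h^2 with the bound 4, which gives 5 h^2.\<close>
  have "(cmod (cis h - 1))\<^sup>2 / h\<^sup>2 \<le> 5 * (1 / (1 + h\<^sup>2))" for h
  proof (cases "h = 0")
    case False
    then have "(cmod (cis h - 1))\<^sup>2 * (1 + h\<^sup>2) \<le> 5 * h\<^sup>2"
      using cmod_cis_minus_1_le(1)[of h] mult_right_mono[OF cmod_cis_minus_1_le(2)[of h] zero_le_power2[of h]]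
      by (simp only: distrib_left)
    then show ?thesis using False one_plus_square_pos[of h] by (simp add: field_simps)
  qed simp
  then have "gagliardo_const \<le> (\<integral>\<^sup>+h. ennreal 5 * ennreal (1 / (1 + h\<^sup>2)) \<partial>lborel)"
    unfolding gagliardo_const_def
    by (intro nn_integral_mono, subst ennreal_mult[symmetric])
      (auto simp: less_imp_le[OF one_plus_square_pos] intro!: ennreal_leI)
  also have "\<dots> = ennreal 5 * emeasure weighted UNIV"
    by (simp add: nn_integral_cmult emeasure_weighted)
  also have "\<dots> < \<infinity>" using finite_weighted by (simp add: ennreal_mult_less_top)
  finally show ?thesis .
qed

lemma gagliardo_const_pos: "0 < gagliardo_const"
proof (rule ccontr)
  assume "\<not> 0 < gagliardo_const"
  then have "AE h in lborel. ennreal ((cmod (cis h - 1))\<^sup>2 / h\<^sup>2) = 0"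
    unfolding gagliardo_const_def by (subst (asm) not_gr_zero, subst (asm) nn_integral_0_iff_AE) auto
  then have "AE h in lborel. \<not> (h \<in> {1..2::real})"
  proof eventually_elim
    case (elim h)
    show ?case
    proof
      assume h: "h \<in> {1..2::real}"
      then have "cos h < cos 0" using pi_gt3 by (intro cos_monotone_0_pi) auto
      then have "0 < (cmod (cis h - 1))\<^sup>2 / h\<^sup>2" using h by (auto simp: cmod_cis_minus_1)
      with elim show False by (simp only: ennreal_eq_0_iff)
    qed
  qed
  then have "{1..2::real} \<in> null_sets lborel" by (subst (asm) AE_iff_null) (auto simp: atLeastAtMost_def atLeast_def atMost_def Int_def)
  then show False by (simp add: null_sets_def)
qed

text \<open>For fixed h, Plancherel turns the increment of u into (cis (h \<xi>) - 1) times the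
  transform. After Tonelli, the substitution of h / \<xi> for h in the integral over increments
  extracts the factor |\<xi>|.\<close>

lemma gagliardo_eq:
  assumes u: "u \<in> L2"
  shows "gagliardo u = gagliardo_const * nkin u"
proof -
  note [measurable] = L2_measurable[OF u] fourier_measurable[OF u]
  have inner: "(\<integral>\<^sup>+x. ennreal ((cmod (u (x + h) - u x))\<^sup>2 / h\<^sup>2) \<partial>lborel)
     = (\<integral>\<^sup>+\<xi>. ennreal ((cmod (cis (h * \<xi>) - 1))\<^sup>2 / h\<^sup>2 * (cmod (fourier u \<xi>))\<^sup>2) \<partial>lborel)" for h
  proof -
    note d = L2_diff[OF L2_translate[OF u, of h] u]
    have "(\<integral>\<^sup>+x. ennreal ((cmod (u (x + h) - u x))\<^sup>2 / h\<^sup>2) \<partial>lborel)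
      = (\<integral>\<^sup>+x. ennreal (1 / h\<^sup>2) * ennreal ((cmod (u (x + h) - u x))\<^sup>2) \<partial>lborel)"
      by (intro nn_integral_cong) (simp flip: ennreal_mult)
    also have "\<dots> = ennreal (1 / h\<^sup>2) * nmass (\<lambda>x. u (x + h) - u x)"
      by (simp add: nn_integral_cmult nmass_def)
    also have "nmass (\<lambda>x. u (x + h) - u x) = nmass (fourier (\<lambda>x. u (x + h) - u x))"
      by (rule nmass_fourier[OF d, symmetric])
    also have "\<dots> = nmass (\<lambda>\<xi>. (cis (h * \<xi>) - 1) * fourier u \<xi>)"
    proof (rule nmass_cong_AE)
      show "AE \<xi> in lborel. fourier (\<lambda>x. u (x + h) - u x) \<xi> = (cis (h * \<xi>) - 1) * fourier u \<xi>"
        using fourier_diff[OF L2_translate[OF u, of h] u] fourier_translate[OF u, of h]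
        by eventually_elim (simp add: left_diff_distrib)
    qed
    also have "ennreal (1 / h\<^sup>2) * nmass (\<lambda>\<xi>. (cis (h * \<xi>) - 1) * fourier u \<xi>)
       = (\<integral>\<^sup>+\<xi>. ennreal (1 / h\<^sup>2) * ennreal ((cmod ((cis (h * \<xi>) - 1) * fourier u \<xi>))\<^sup>2) \<partial>lborel)"
      by (simp add: nn_integral_cmult nmass_def)
    also have "\<dots> = (\<integral>\<^sup>+\<xi>. ennreal ((cmod (cis (h * \<xi>) - 1))\<^sup>2 / h\<^sup>2 * (cmod (fourier u \<xi>))\<^sup>2) \<partial>lborel)"
      by (intro nn_integral_cong) (simp add: norm_mult power_mult_distrib flip: ennreal_mult)
    finally show ?thesis .
  qed
  have outer: "(\<integral>\<^sup>+h. ennreal ((cmod (cis (h * \<xi>) - 1))\<^sup>2 / h\<^sup>2) \<partial>lborel) = ennreal \<bar>\<xi>\<bar> * gagliardo_const" for \<xi>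
  proof (cases "\<xi> = 0")
    case False
    have "(\<integral>\<^sup>+h. ennreal ((cmod (cis (h * \<xi>) - 1))\<^sup>2 / h\<^sup>2) \<partial>lborel)
      = \<bar>1 / \<xi>\<bar> * (\<integral>\<^sup>+h. ennreal ((cmod (cis (0 + 1 / \<xi> * h * \<xi>) - 1))\<^sup>2 / (0 + 1 / \<xi> * h)\<^sup>2) \<partial>lborel)"
      using False by (subst nn_integral_real_affine[where c = "1 / \<xi>" and t = 0]) auto
    also have "\<dots> = ennreal \<bar>1 / \<xi>\<bar> * (\<integral>\<^sup>+h. ennreal (\<xi>\<^sup>2) * ennreal ((cmod (cis h - 1))\<^sup>2 / h\<^sup>2) \<partial>lborel)"
      using False by (intro arg_cong2[where f = "(*)"] refl nn_integral_cong)
        (simp add: power_divide flip: ennreal_mult)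
    also have "\<dots> = (ennreal \<bar>1 / \<xi>\<bar> * ennreal (\<xi>\<^sup>2)) * gagliardo_const"
      unfolding gagliardo_const_def by (subst nn_integral_cmult) (auto simp: mult.assoc)
    also have "ennreal \<bar>1 / \<xi>\<bar> * ennreal (\<xi>\<^sup>2) = ennreal \<bar>\<xi>\<bar>"
      using False by (simp add: power2_eq_square abs_if field_simps flip: ennreal_mult)
    finally show ?thesis .
  qed simp
  have "gagliardo u = (\<integral>\<^sup>+h. (\<integral>\<^sup>+\<xi>. ennreal ((cmod (cis (h * \<xi>) - 1))\<^sup>2 / h\<^sup>2 * (cmod (fourier u \<xi>))\<^sup>2) \<partial>lborel) \<partial>lborel)"
    unfolding gagliardo_def inner ..
  also have "\<dots> = (\<integral>\<^sup>+\<xi>. (\<integral>\<^sup>+h. ennreal ((cmod (cis (h * \<xi>) - 1))\<^sup>2 / h\<^sup>2 * (cmod (fourier u \<xi>))\<^sup>2) \<partial>lborel) \<partial>lborel)"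
    by (rule lborel_pair.Fubini') measurable
  also have "\<dots> = (\<integral>\<^sup>+\<xi>. gagliardo_const * ennreal (\<bar>\<xi>\<bar> * (cmod (fourier u \<xi>))\<^sup>2) \<partial>lborel)"
  proof (rule nn_integral_cong)
    fix \<xi>
    have "(\<integral>\<^sup>+h. ennreal ((cmod (cis (h * \<xi>) - 1))\<^sup>2 / h\<^sup>2 * (cmod (fourier u \<xi>))\<^sup>2) \<partial>lborel)
       = (\<integral>\<^sup>+h. ennreal ((cmod (cis (h * \<xi>) - 1))\<^sup>2 / h\<^sup>2) \<partial>lborel) * ennreal ((cmod (fourier u \<xi>))\<^sup>2)"
      by (subst nn_integral_multc[symmetric]) (auto intro!: nn_integral_cong simp flip: ennreal_mult)
    then show "(\<integral>\<^sup>+h. ennreal ((cmod (cis (h * \<xi>) - 1))\<^sup>2 / h\<^sup>2 * (cmod (fourier u \<xi>))\<^sup>2) \<partial>lborel)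
      = gagliardo_const * ennreal (\<bar>\<xi>\<bar> * (cmod (fourier u \<xi>))\<^sup>2)"
      unfolding outer by (simp add: ennreal_mult mult_ac)
  qed
  also have "\<dots> = gagliardo_const * nkin u"
    unfolding nkin_def by (rule nn_integral_cmult) measurable
  finally show ?thesis .
qed

section \<open>Local mass, local seminorm and the quartic bound\<close>

definition local_gagliardo :: "(real \<Rightarrow> complex) \<Rightarrow> real \<Rightarrow> ennreal" where
  "local_gagliardo u x = (\<integral>\<^sup>+h. ennreal ((cmod (u (x + h) - u x))\<^sup>2 / h\<^sup>2) \<partial>lborel)"

definition local_mass :: "(real \<Rightarrow> complex) \<Rightarrow> real \<Rightarrow> ennreal" where
  "local_mass u x = (\<integral>\<^sup>+h. indicator {0..1} h * ennreal ((cmod (u (x + h)))\<^sup>2) \<partial>lborel)"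

lemma borel_measurable_local[measurable]:
  assumes [measurable]: "u \<in> borel_measurable borel"
  shows "local_gagliardo u \<in> borel_measurable borel" "local_mass u \<in> borel_measurable borel"
  unfolding local_gagliardo_def[abs_def] local_mass_def[abs_def] by measurable

lemma nn_integral_local_gagliardo:
  assumes [measurable]: "u \<in> borel_measurable borel"
  shows "(\<integral>\<^sup>+x. local_gagliardo u x \<partial>lborel) = gagliardo u"
  unfolding gagliardo_def local_gagliardo_def by (rule lborel_pair.Fubini') measurable

lemma nn_integral_local_mass:
  assumes [measurable]: "u \<in> borel_measurable borel"
  shows "(\<integral>\<^sup>+x. local_mass u x \<partial>lborel) = nmass u"
proof -
  have "(\<integral>\<^sup>+x. local_mass u x \<partial>lborel) =
      (\<integral>\<^sup>+h. (\<integral>\<^sup>+x. indicator {0..1} h * ennreal ((cmod (u (x + h)))\<^sup>2) \<partial>lborel) \<partial>lborel)"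
    unfolding local_mass_def by (rule lborel_pair.Fubini') measurable
  also have "\<dots> = (\<integral>\<^sup>+h. nmass u * indicator {0..1::real} h \<partial>lborel)"
  proof (rule nn_integral_cong)
    fix h :: real
    have "(\<integral>\<^sup>+x. indicator {0..1} h * ennreal ((cmod (u (x + h)))\<^sup>2) \<partial>lborel) = indicator {0..1} h * nmass (\<lambda>x. u (x + h))"
      unfolding nmass_def by (rule nn_integral_cmult) measurable
    then show "(\<integral>\<^sup>+x. indicator {0..1} h * ennreal ((cmod (u (x + h)))\<^sup>2) \<partial>lborel) = nmass u * indicator {0..1::real} h"
      by (simp add: nmass_translate mult.commute)
  qed
  also have "\<dots> = nmass u * 1" by (subst nn_integral_cmult_indicator) auto
  finally show ?thesis by simp
qed

lemma local_mass_le: "u \<in> borel_measurable borel \<Longrightarrow> local_mass u x \<le> nmass u"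
proof -
  assume [measurable]: "u \<in> borel_measurable borel"
  have "local_mass u x \<le> (\<integral>\<^sup>+h. ennreal ((cmod (u (h + x)))\<^sup>2) \<partial>lborel)"
    unfolding local_mass_def by (intro nn_integral_mono) (auto simp: indicator_def add.commute)
  also have "\<dots> = nmass u"
    unfolding nmass_def by (rule nn_integral_translate[of "\<lambda>x. ennreal ((cmod (u x))\<^sup>2)"]) measurable
  finally show "local_mass u x \<le> nmass u" .
qed

text \<open>Optimisation over the scale. For d \<le> m the choice is s = 1; otherwise s = sqrt (m /
  d) is at most 1 and makes both terms on the right equal to 2 m. The degenerate case m = 0
  corresponds to s tending to 0.\<close>

lemma quartic_from_scales:
  fixes a d m :: real
  assumes nn: "0 \<le> a" "0 \<le> d" "0 \<le> m"
    and le: "\<And>s. 0 < s \<Longrightarrow> s \<le> 1 \<Longrightarrow> s * a \<le> 2 * s\<^sup>2 * d + 2 * m"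
  shows "a\<^sup>2 \<le> 16 * m * (d + m)"
proof (cases "d \<le> m")
  case True
  then have "a \<le> 4 * m" using le[of 1] by simp
  then have "a\<^sup>2 \<le> (4 * m)\<^sup>2" using nn by (intro power_mono) auto
  also have "\<dots> \<le> 16 * m * (d + m)" using nn by (simp add: power2_eq_square algebra_simps)
  finally show ?thesis .
next
  case False
  show ?thesis
  proof (cases "m = 0")
    case True
    have "a \<le> 0"
    proof (rule ccontr)
      assume a: "\<not> a \<le> 0"
      \<comment> \<open>Small enough that 2 s d \<le> a / 2, which contradicts a \<le> 2 s
        d.\<close>
      define s where "s = min 1 (a / (4 * d))"
      have s: "0 < s" "s \<le> 1" "s \<le> a / (4 * d)" using a False nn by (auto simp: s_def)
      have "s * a \<le> s * (2 * s * d)" using le[OF s(1,2)] True by (simp add: power2_eq_square algebra_simps)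
      then have "a \<le> 2 * s * d" using s by simp
      also have "\<dots> \<le> 2 * (a / (4 * d)) * d" using s nn by (intro mult_right_mono mult_left_mono) auto
      also have "\<dots> = a / 2" using False nn by simp
      finally show False using a by simp
    qed
    then show ?thesis using nn True by simp
  next
    case m: False
    define s where "s = sqrt (m / d)"
    have s: "0 < s" "s \<le> 1" "s\<^sup>2 = m / d" using m nn False by (auto simp: s_def)
    have "s * a \<le> 4 * m" using le[OF s(1,2)] s(3) False nn by simp
    then have "(s * a)\<^sup>2 \<le> (4 * m)\<^sup>2" using nn s by (intro power_mono) auto
    then have "m / d * a\<^sup>2 \<le> 16 * m\<^sup>2" using s(3) by (simp add: power_mult_distrib)
    then have "m * a\<^sup>2 \<le> m * (16 * m * d)" using False nn m by (simp add: field_simps power2_eq_square)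
    then have "a\<^sup>2 \<le> 16 * m * d" using m nn by simp
    also have "\<dots> \<le> 16 * m * (d + m)" using nn by (intro mult_left_mono) auto
    finally show ?thesis .
  qed
qed

lemma ennreal_lincomb:
  assumes "0 \<le> a" "0 \<le> b" "0 \<le> p" "0 \<le> q"
  shows "ennreal (a * p + b * q) = ennreal a * ennreal p + ennreal b * ennreal q"
  using assms by (simp add: ennreal_mult)

text \<open>The estimate of |u(x)|^2 by the increment and by |u(x + h)|^2 is integrated over 0 \<le>
  h \<le> s. Inserting the weight 1 / h^2 costs the factor s^2, and the window of the second term is
  enlarged to [0, 1].\<close>

lemma pointwise_scale_bound:
  assumes [measurable]: "u \<in> borel_measurable borel" and s: "0 < s" "s \<le> 1"
  shows "ennreal s * ennreal ((cmod (u x))\<^sup>2) \<le> ennreal (2 * s\<^sup>2) * local_gagliardo u x + ennreal 2 * local_mass u x"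
proof -
  have "ennreal s * ennreal ((cmod (u x))\<^sup>2) = (\<integral>\<^sup>+h. ennreal ((cmod (u x))\<^sup>2) * indicator {0..s} h \<partial>lborel)"
    using s by (subst nn_integral_cmult_indicator) (auto simp: mult.commute)
  also have "\<dots> \<le> (\<integral>\<^sup>+h. ennreal (2 * s\<^sup>2) * ennreal ((cmod (u (x + h) - u x))\<^sup>2 / h\<^sup>2)
      + ennreal 2 * (indicator {0..1} h * ennreal ((cmod (u (x + h)))\<^sup>2)) \<partial>lborel)"
  proof (rule nn_integral_mono)
    fix h
    show "ennreal ((cmod (u x))\<^sup>2) * indicator {0..s} h \<le> ennreal (2 * s\<^sup>2) * ennreal ((cmod (u (x + h) - u x))\<^sup>2 / h\<^sup>2)
      + ennreal 2 * (indicator {0..1} h * ennreal ((cmod (u (x + h)))\<^sup>2))"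
    proof (cases "h \<in> {0..s}")
      case h: True
      have "(cmod (u (x + h) - u x))\<^sup>2 \<le> s\<^sup>2 * ((cmod (u (x + h) - u x))\<^sup>2 / h\<^sup>2)"
      proof (cases "h = 0")
        case False
        then have "h\<^sup>2 \<le> s\<^sup>2" using h by (intro power_mono) auto
        then have "h\<^sup>2 * (cmod (u (x + h) - u x))\<^sup>2 \<le> s\<^sup>2 * (cmod (u (x + h) - u x))\<^sup>2" by (rule mult_right_mono) simp
        then show ?thesis using False by (simp add: field_simps)
      qed simp
      moreover have "(cmod (u x))\<^sup>2 \<le> 2 * (cmod (u (x + h) - u x))\<^sup>2 + 2 * (cmod (u (x + h)))\<^sup>2"
        using norm_add_square_le[of "u x - u (x + h)" "u (x + h)"] by (simp add: norm_minus_commute)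
      ultimately have "(cmod (u x))\<^sup>2 \<le> 2 * s\<^sup>2 * ((cmod (u (x + h) - u x))\<^sup>2 / h\<^sup>2) + 2 * (cmod (u (x + h)))\<^sup>2"
        by linarith
      then have "ennreal ((cmod (u x))\<^sup>2) \<le> ennreal (2 * s\<^sup>2 * ((cmod (u (x + h) - u x))\<^sup>2 / h\<^sup>2) + 2 * (cmod (u (x + h)))\<^sup>2)"
        by (rule ennreal_leI)
      also have "\<dots> = ennreal (2 * s\<^sup>2) * ennreal ((cmod (u (x + h) - u x))\<^sup>2 / h\<^sup>2) + ennreal 2 * ennreal ((cmod (u (x + h)))\<^sup>2)"
        by (rule ennreal_lincomb) auto
      finally show ?thesis using h s by (simp add: indicator_def)
    qed auto
  qed
  also have "\<dots> = ennreal (2 * s\<^sup>2) * local_gagliardo u x + ennreal 2 * local_mass u x"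
    unfolding local_gagliardo_def local_mass_def by (simp add: nn_integral_add nn_integral_cmult)
  finally show ?thesis .
qed

lemma pointwise_quartic_bound:
  assumes u: "u \<in> borel_measurable borel" and \<mu>: "0 < \<mu>" "local_mass u x \<le> ennreal \<mu>"
  shows "ennreal ((cmod (u x)) ^ 4) \<le> ennreal (16 * \<mu>) * (local_gagliardo u x + local_mass u x)"
proof (cases "local_gagliardo u x = \<infinity>")
  case True
  then show ?thesis using \<mu> by (simp add: ennreal_mult_top)
next
  case False
  then obtain d where d: "0 \<le> d" "local_gagliardo u x = ennreal d"
    by (cases "local_gagliardo u x") auto
  obtain m where m: "0 \<le> m" "local_mass u x = ennreal m"
    using \<mu>(2) by (cases "local_mass u x") (auto simp: top_unique)
  have m\<mu>: "m \<le> \<mu>" using \<mu> m by simp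
  have "((cmod (u x))\<^sup>2)\<^sup>2 \<le> 16 * m * (d + m)"
  proof (rule quartic_from_scales)
    fix s :: real assume s: "0 < s" "s \<le> 1"
    have "ennreal (s * (cmod (u x))\<^sup>2) \<le> ennreal (2 * s\<^sup>2 * d + 2 * m)"
      using pointwise_scale_bound[OF u s, of x] s m d by (simp add: ennreal_mult)
    then show "s * (cmod (u x))\<^sup>2 \<le> 2 * s\<^sup>2 * d + 2 * m"
      by (subst (asm) ennreal_le_iff) (use m d in auto)
  qed (use m d in auto)
  also have "\<dots> \<le> 16 * \<mu> * (d + m)" using m\<mu> m d by (intro mult_right_mono) auto
  finally have "ennreal ((cmod (u x)) ^ 4) \<le> ennreal (16 * \<mu> * (d + m))"
    by (intro ennreal_leI) (simp flip: power_mult)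
  then show ?thesis using \<mu> m d by (simp add: ennreal_mult)
qed

text \<open>Bounding one factor of the pointwise product by \<mu> leaves an expression linear in the
  local quantities, which integrates to global ones. A \<mu> above the total mass gives the
  embedding, a small \<mu> the decay under vanishing.\<close>

lemma L4_local_bound:
  assumes u: "u \<in> L2" and \<mu>: "0 < \<mu>" "\<And>x. local_mass u x \<le> ennreal \<mu>"
  shows "(\<integral>\<^sup>+x. ennreal ((cmod (u x)) ^ 4) \<partial>lborel) \<le> ennreal (16 * \<mu>) * (gagliardo_const * nkin u + nmass u)"
proof -
  note [measurable] = L2_measurable[OF u]
  have "(\<integral>\<^sup>+x. ennreal ((cmod (u x)) ^ 4) \<partial>lborel)
      \<le> (\<integral>\<^sup>+x. ennreal (16 * \<mu>) * (local_gagliardo u x + local_mass u x) \<partial>lborel)"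
    by (intro nn_integral_mono pointwise_quartic_bound \<mu>) measurable
  also have "\<dots> = ennreal (16 * \<mu>) * (gagliardo u + nmass u)"
    by (simp add: nn_integral_cmult nn_integral_add nn_integral_local_gagliardo nn_integral_local_mass)
  finally show ?thesis by (simp add: gagliardo_eq[OF u])
qed

section \<open>Approximation by averages over grid cells\<close>

text \<open>The mean over a cell of length 1 / k, with value 0 for k = 0. Each function yields
  countably many such numbers, so a diagonal subsequence makes all of them converge.\<close>

definition grid_average :: "nat \<Rightarrow> (real \<Rightarrow> complex) \<Rightarrow> int \<Rightarrow> complex" where
  "grid_average k u j = complex_of_real (real k) *
     (LINT y|lborel. indicator {real_of_int j / real k..(real_of_int j + 1) / real k} y *\<^sub>R u y)"

lemma grid_cell_integrable:
  assumes u: "u \<in> L2"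
  shows "integrable lborel (\<lambda>y. indicator {a..b} y *\<^sub>R u y)"
proof -
  have "integrable lborel (\<lambda>y. indicator {a..b} y *\<^sub>R cutoff (\<bar>a\<bar> + \<bar>b\<bar>) u y)"
    using cutoff_integrable[OF u] by (intro integrable_mult_indicator) auto
  moreover have "indicator {a..b} y *\<^sub>R cutoff (\<bar>a\<bar> + \<bar>b\<bar>) u y = indicator {a..b} y *\<^sub>R u y" for y
    by (auto simp: cutoff_def indicator_def)
  ultimately show ?thesis by simp
qed

lemma grid_average_bound:
  assumes u: "u \<in> L2" and m: "mass u \<le> A"
  shows "cmod (grid_average k u j) \<le> real k * (1 + A)"
proof (cases "k = 0")
  case False
  let ?J = "{real_of_int j / real k..(real_of_int j + 1) / real k}"
  have em: "emeasure lborel ?J = ennreal (1 / real k)" using False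
    by (subst emeasure_lborel_Icc) (auto simp: field_simps)
  have "cmod (LINT y|lborel. indicator ?J y *\<^sub>R u y) \<le> (LINT y|lborel. cmod (indicator ?J y *\<^sub>R u y))"
    by (rule integral_norm_bound)
  also have "\<dots> \<le> (LINT y|lborel. indicator ?J y + (cmod (u y))\<^sup>2)"
  proof (rule integral_mono)
    show "integrable lborel (\<lambda>y. cmod (indicator ?J y *\<^sub>R u y))" using grid_cell_integrable[OF u] by (rule integrable_norm)
    show "integrable lborel (\<lambda>y. indicator ?J y + (cmod (u y))\<^sup>2)"
      by (intro Bochner_Integration.integrable_add square_integrable[OF u]) (simp add: em)
    have *: "cmod z \<le> 1 + (cmod z)\<^sup>2" for z
      using product_le_weighted_squares[of 1 1 "cmod z"] by simp
    show "cmod (indicator ?J y *\<^sub>R u y) \<le> indicator ?J y + (cmod (u y))\<^sup>2" for y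
      using * by (auto simp: indicator_def)
  qed
  also have "\<dots> = measure lborel ?J + mass u"
    using square_integrable[OF u] em by (simp add: mass_def)
  also have "\<dots> \<le> 1 + A"
  proof -
    have "1 \<le> real k" using False by simp
    then have "1 / real k \<le> 1" by simp
    then show ?thesis using em m by (simp add: measure_def)
  qed
  finally show ?thesis by (simp add: grid_average_def norm_mult mult_left_mono)
qed (simp add: grid_average_def)

text \<open>With b = u(y) - u(x), one has |b| \<le> 1 / sqrt k + sqrt k |b|^2, and |y - x| \<le> 1 /
  k inserts the Gagliardo weight; after averaging both terms are of order 1 / sqrt k. The summand 1
  is not integrable over the line, which is why the error is later measured in
  \<open>weighted\<close>.\<close>

lemma grid_average_error:
  assumes u: "u \<in> L2" and k: "0 < k"
  shows "ennreal (cmod (u x - grid_average k u \<lfloor>real k * x\<rfloor>)) \<le> ennreal (1 / sqrt (real k)) * (1 + local_gagliardo u x)"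
proof -
  note [measurable] = L2_measurable[OF u]
  define j where "j = \<lfloor>real k * x\<rfloor>"
  let ?J = "{real_of_int j / real k..(real_of_int j + 1) / real k}"
  have em: "emeasure lborel ?J = ennreal (1 / real k)" using k
    by (subst emeasure_lborel_Icc) (auto simp: field_simps)
  have xJ: "x \<in> ?J" unfolding j_def using k by (auto simp: field_simps) linarith+
  have ic: "integrable lborel (\<lambda>y. indicator ?J y *\<^sub>R u x)" using em by (intro integrable_scaleR_left) auto
  have "u x - grid_average k u j = complex_of_real (real k) * (LINT y|lborel. indicator ?J y *\<^sub>R u x - indicator ?J y *\<^sub>R u y)"
  proof -
    have "(LINT y|lborel. indicator ?J y *\<^sub>R u x) = (1 / real k) *\<^sub>R u x"
      using em by (subst integral_scaleR_left) (auto simp: measure_def)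
    then have "complex_of_real (real k) * (LINT y|lborel. indicator ?J y *\<^sub>R u x) = u x"
      using k by (simp add: scaleR_conv_of_real)
    then show ?thesis
      using ic grid_cell_integrable[OF u] by (simp add: grid_average_def right_diff_distrib)
  qed
  then have "ennreal (cmod (u x - grid_average k u j))
     = ennreal (real k) * ennreal (cmod (LINT y|lborel. indicator ?J y *\<^sub>R u x - indicator ?J y *\<^sub>R u y))"
    by (simp only: norm_mult norm_of_real abs_of_nat ennreal_mult of_nat_0_le_iff norm_ge_zero)
  also have "\<dots> \<le> ennreal (real k) * (\<integral>\<^sup>+y. ennreal (cmod (indicator ?J y *\<^sub>R u x - indicator ?J y *\<^sub>R u y)) \<partial>lborel)"
    using ic grid_cell_integrable[OF u] by (intro mult_left_mono integral_norm_bound_ennreal) auto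
  also have "\<dots> \<le> ennreal (real k) * (\<integral>\<^sup>+y. ennreal (1 / sqrt (real k)) * indicator ?J y
      + ennreal (1 / (real k * sqrt (real k))) * ennreal ((cmod (u y - u x))\<^sup>2 / (y - x)\<^sup>2) \<partial>lborel)"
  proof (intro mult_left_mono nn_integral_mono)
    fix y
    let ?b = "cmod (u y - u x)"
    show "ennreal (cmod (indicator ?J y *\<^sub>R u x - indicator ?J y *\<^sub>R u y)) \<le> ennreal (1 / sqrt (real k)) * indicator ?J y
      + ennreal (1 / (real k * sqrt (real k))) * ennreal (?b\<^sup>2 / (y - x)\<^sup>2)"
    proof (cases "y \<in> ?J")
      case y: True
      have "\<bar>y - x\<bar> \<le> 1 / real k" using y xJ k by (auto simp: abs_le_iff add_divide_distrib)
      then have d2: "(y - x)\<^sup>2 \<le> (1 / real k)\<^sup>2" by (metis abs_ge_zero power2_abs power_mono)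
      have "?b\<^sup>2 \<le> (1 / real k)\<^sup>2 * (?b\<^sup>2 / (y - x)\<^sup>2)"
      proof (cases "y = x")
        case False
        have "(y - x)\<^sup>2 * ?b\<^sup>2 \<le> (1 / real k)\<^sup>2 * ?b\<^sup>2" by (rule mult_right_mono[OF d2]) simp
        moreover have "0 < (y - x)\<^sup>2" using False by simp
        ultimately show ?thesis by (simp add: pos_le_divide_eq mult.commute)
      qed simp
      then have q: "sqrt (real k) * ?b\<^sup>2 \<le> sqrt (real k) * ((1 / real k)\<^sup>2 * (?b\<^sup>2 / (y - x)\<^sup>2))"
        by (intro mult_left_mono) auto
      have sk: "sqrt (real k) * (1 / real k)\<^sup>2 = 1 / (real k * sqrt (real k))"
        using k by (simp add: power2_eq_square field_simps)
      have "?b \<le> 1 / sqrt (real k) + sqrt (real k) * ?b\<^sup>2"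
        using product_le_weighted_squares[of "1 / sqrt (real k)" 1 ?b] k by simp
      also have "\<dots> \<le> 1 / sqrt (real k) + 1 / (real k * sqrt (real k)) * (?b\<^sup>2 / (y - x)\<^sup>2)"
        using q unfolding sk[symmetric] by (simp add: mult.assoc)
      finally have "ennreal ?b \<le> ennreal (1 / sqrt (real k) + 1 / (real k * sqrt (real k)) * (?b\<^sup>2 / (y - x)\<^sup>2))"
        by (rule ennreal_leI)
      also have "\<dots> = ennreal (1 / sqrt (real k)) + ennreal (1 / (real k * sqrt (real k))) * ennreal (?b\<^sup>2 / (y - x)\<^sup>2)"
        by (subst ennreal_plus) (auto simp: ennreal_mult simp del: times_divide_eq_right times_divide_eq_left)
      finally show ?thesis using y by (simp add: norm_minus_commute)
    qed auto
  qed auto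
  also have "\<dots> = ennreal (real k) * (ennreal (1 / sqrt (real k)) * ennreal (1 / real k)
      + ennreal (1 / (real k * sqrt (real k))) * (\<integral>\<^sup>+y. ennreal ((cmod (u y - u x))\<^sup>2 / (y - x)\<^sup>2) \<partial>lborel))"
    by (subst nn_integral_add) (auto simp: nn_integral_cmult em nn_integral_cmult_indicator)
  also have "(\<integral>\<^sup>+y. ennreal ((cmod (u y - u x))\<^sup>2 / (y - x)\<^sup>2) \<partial>lborel) = local_gagliardo u x"
    unfolding local_gagliardo_def using nn_integral_translate[of "\<lambda>y. ennreal ((cmod (u y - u x))\<^sup>2 / (y - x)\<^sup>2)" x]
    by (simp add: add.commute)
  also have "ennreal (real k) * (ennreal (1 / sqrt (real k)) * ennreal (1 / real k)
      + ennreal (1 / (real k * sqrt (real k))) * local_gagliardo u x)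
    = ennreal (1 / sqrt (real k)) * (1 + local_gagliardo u x)"
  proof -
    have "ennreal (real k) * (ennreal (1 / sqrt (real k)) * ennreal (1 / real k)) = ennreal (1 / sqrt (real k))"
      "ennreal (real k) * ennreal (1 / (real k * sqrt (real k))) = ennreal (1 / sqrt (real k))"
      using k by (simp_all flip: ennreal_mult)
    then show ?thesis by (simp add: distrib_left flip: mult.assoc)
  qed
  finally show ?thesis unfolding j_def .
qed

section \<open>Splitting and local compactness\<close>

lemma AE_translate:
  assumes "AE x in lborel. P (x::real)"
  shows "AE x in lborel. P (x + h)"
proof -
  obtain N where N: "N \<in> null_sets lborel" "{x. \<not> P x} \<subseteq> N"
    using AE_E[OF assms] by (auto simp: null_sets_def)
  have [measurable]: "N \<in> sets borel" using N by auto
  have "AE x in lborel. x \<notin> N" using N(1) by (rule AE_not_in)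
  from AE_borel_affine[of 1 "\<lambda>x. x \<notin> N" h, OF _ _ this]
  have "AE x in lborel. h + x \<notin> N" by simp
  then show ?thesis by eventually_elim (use N(2) in \<open>auto simp: add.commute\<close>)
qed

text \<open>Provides convergence of difference quotients at almost every pair: for each fixed h, an
  exceptional null set and its translate are both null.\<close>

lemma AE_pair_translate:
  assumes "AE x in lborel. P (x::real)"
  shows "AE z in lborel \<Otimes>\<^sub>M lborel. P (snd z) \<and> P (snd z + fst z)"
proof -
  obtain N where N: "N \<in> null_sets lborel" "{x. \<not> P x} \<subseteq> N"
    using AE_E[OF assms] by (auto simp: null_sets_def)
  have [measurable]: "N \<in> sets borel" using N by auto
  have n: "AE x in lborel. x \<notin> N" using N(1) by (rule AE_not_in)
  have "AE z in lborel \<Otimes>\<^sub>M lborel. snd z \<notin> N \<and> snd z + fst z \<notin> N"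
  proof (rule lborel_pair.AE_pair_measure)
    show "AE h in lborel. AE x in lborel. snd (h, x) \<notin> N \<and> snd (h, x) + fst (h, x) \<notin> N"
    proof (rule AE_I2)
      fix h :: real
      show "AE x in lborel. snd (h, x) \<notin> N \<and> snd (h, x) + fst (h, x) \<notin> N"
        using n AE_translate[OF n, of h] by eventually_elim simp
    qed
  qed measurable
  then show ?thesis by eventually_elim (use N(2) in blast)
qed

section \<open>The Brezis-Lieb lemma and the splitting of the form with symbol |\<xi>|\<close>

text \<open>A general measure space is allowed because the lemma is applied to functions on the line
  and to difference quotients on the plane. The defect tends to zero pointwise and is at most
  \<epsilon> |f - g|^r + (C + 1) |g|^r, the added 1 absorbing the term |g|^r itself.\<close>

theorem Brezis_Lieb:
  fixes f :: "nat \<Rightarrow> 'a \<Rightarrow> complex"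
  assumes r: "0 < r"
    and f: "\<And>n. f n \<in> borel_measurable M" and g: "g \<in> borel_measurable M"
    and ae: "AE x in M. (\<lambda>n. f n x) \<longlonglongrightarrow> g x"
    and fi: "\<And>n. integrable M (\<lambda>x. cmod (f n x) powr r)"
    and gi: "integrable M (\<lambda>x. cmod (g x) powr r)"
    and di: "\<And>n. integrable M (\<lambda>x. cmod (f n x - g x) powr r)"
    and B: "\<And>n. (LINT x|M. cmod (f n x - g x) powr r) \<le> B"
  shows "(\<lambda>n. (LINT x|M. cmod (f n x) powr r) - (LINT x|M. cmod (f n x - g x) powr r))
    \<longlonglongrightarrow> (LINT x|M. cmod (g x) powr r)"
proof -
  note [measurable] = f g
  define F where "F n x = \<bar>cmod (f n x) powr r - cmod (f n x - g x) powr r - cmod (g x) powr r\<bar>" for n x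
  have Fi: "integrable M (F n)" for n unfolding F_def using fi gi di by simp
  have "(\<lambda>n. \<integral>\<^sup>+x. ennreal (F n x) \<partial>M) \<longlonglongrightarrow> 0"
  proof (rule vanishing_nn_integral[where G = "\<lambda>n x. cmod (f n x - g x) powr r" and H = "\<lambda>x. cmod (g x) powr r"])
    show "AE x in M. (\<lambda>n. F n x) \<longlonglongrightarrow> 0"
      using ae
    proof eventually_elim
      case (elim x)
      have "(\<lambda>n. cmod (f n x) powr r) \<longlonglongrightarrow> cmod (g x) powr r"
        using r by (intro tendsto_powr' tendsto_norm elim tendsto_const) auto
      moreover have "(\<lambda>n. cmod (f n x - g x) powr r) \<longlonglongrightarrow> cmod (g x - g x) powr r"
        using r by (intro tendsto_powr' tendsto_norm tendsto_diff elim tendsto_const) auto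
      ultimately have "(\<lambda>n. \<bar>cmod (f n x) powr r - cmod (f n x - g x) powr r - cmod (g x) powr r\<bar>)
          \<longlonglongrightarrow> \<bar>cmod (g x) powr r - cmod (g x - g x) powr r - cmod (g x) powr r\<bar>"
        by (intro tendsto_rabs tendsto_diff tendsto_const)
      then show ?case by (simp add: F_def)
    qed
    show "(\<integral>\<^sup>+x. ennreal (cmod (f n x - g x) powr r) \<partial>M) \<le> ennreal B" for n
      using B[of n] by (subst nn_integral_eq_integral[OF di]) (auto intro: ennreal_leI)
    show "(\<integral>\<^sup>+x. ennreal (cmod (g x) powr r) \<partial>M) < \<infinity>"
      by (subst nn_integral_eq_integral[OF gi]) auto
    fix \<epsilon> :: real assume "0 < \<epsilon>"
    then obtain C where C: "0 \<le> C"
      "\<And>a b :: complex. \<bar>norm (a + b) powr r - norm a powr r\<bar> \<le> \<epsilon> * norm a powr r + C * norm b powr r"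
      using powr_norm_add_bound[OF r, of \<epsilon>, where 'a = complex] by blast
    have "F n x \<le> \<epsilon> * cmod (f n x - g x) powr r + (C + 1) * cmod (g x) powr r" for n x
    proof -
      have "\<bar>cmod (f n x) powr r - cmod (f n x - g x) powr r\<bar> \<le> \<epsilon> * cmod (f n x - g x) powr r + C * cmod (g x) powr r"
        using C(2)[of "f n x - g x" "g x"] by simp
      moreover have "0 \<le> cmod (g x) powr r" by simp
      ultimately show ?thesis unfolding F_def distrib_right mult_1 by linarith
    qed
    then show "\<exists>C\<ge>0. \<forall>n x. F n x \<le> \<epsilon> * cmod (f n x - g x) powr r + C * cmod (g x) powr r"
      using C(1) by (intro exI[of _ "C + 1"]) auto
  qed (auto simp: F_def)
  moreover have "(\<integral>\<^sup>+x. ennreal (F n x) \<partial>M) = ennreal (LINT x|M. F n x)" for n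
    by (rule nn_integral_eq_integral[OF Fi]) (simp add: F_def)
  ultimately have "(\<lambda>n. ennreal (LINT x|M. F n x)) \<longlonglongrightarrow> ennreal 0" by simp
  then have lim: "(\<lambda>n. LINT x|M. F n x) \<longlonglongrightarrow> 0"
  proof (rule iffD1[OF tendsto_ennreal_iff, rotated 2])
    show "\<forall>\<^sub>F n in sequentially. 0 \<le> (LINT x|M. F n x)"
      by (intro always_eventually allI Bochner_Integration.integral_nonneg) (simp add: F_def)
  qed auto
  have "norm ((LINT x|M. cmod (f n x) powr r) - (LINT x|M. cmod (f n x - g x) powr r) - (LINT x|M. cmod (g x) powr r))
     \<le> (LINT x|M. F n x)" for n
  proof -
    have "(LINT x|M. cmod (f n x) powr r) - (LINT x|M. cmod (f n x - g x) powr r) - (LINT x|M. cmod (g x) powr r)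
       = (LINT x|M. cmod (f n x) powr r - cmod (f n x - g x) powr r - cmod (g x) powr r)"
      using fi gi di by simp
    also have "norm \<dots> \<le> (LINT x|M. norm (cmod (f n x) powr r - cmod (f n x - g x) powr r - cmod (g x) powr r))"
      by (rule integral_norm_bound)
    finally show ?thesis by (simp add: F_def)
  qed
  from Lim_null_comparison[OF always_eventually[OF allI, OF this] lim]
  show ?thesis by (subst (asm) LIM_zero_iff)
qed

text \<open>The pair consists of increment and base point, in the order of integration of
  \<open>gagliardo\<close>. In this form the kinetic term is a squared \<open>L^2\<close> norm of a
  function that depends linearly on u.\<close>

definition difference_quotient :: "(real \<Rightarrow> complex) \<Rightarrow> real \<times> real \<Rightarrow> complex" where
  "difference_quotient u z = (u (snd z + fst z) - u (snd z)) / complex_of_real (fst z)"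

lemma borel_measurable_difference_quotient[measurable]:
  assumes [measurable]: "u \<in> borel_measurable borel"
  shows "difference_quotient u \<in> borel_measurable (lborel \<Otimes>\<^sub>M lborel)"
  unfolding difference_quotient_def[abs_def] by measurable

lemma nn_integral_difference_quotient:
  assumes [measurable]: "u \<in> borel_measurable borel"
  shows "(\<integral>\<^sup>+z. ennreal ((cmod (difference_quotient u z))\<^sup>2) \<partial>(lborel \<Otimes>\<^sub>M lborel)) = gagliardo u"
proof -
  have "(\<integral>\<^sup>+z. ennreal ((cmod (difference_quotient u z))\<^sup>2) \<partial>(lborel \<Otimes>\<^sub>M lborel))
    = (\<integral>\<^sup>+h. (\<integral>\<^sup>+x. ennreal ((cmod (difference_quotient u (h, x)))\<^sup>2) \<partial>lborel) \<partial>lborel)"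
    by (rule lborel.nn_integral_fst[symmetric]) measurable
  then show ?thesis by (simp add: gagliardo_def difference_quotient_def norm_divide power_divide)
qed

definition gagliardo_real :: real where
  "gagliardo_real = enn2real gagliardo_const"

lemma gagliardo_real: "0 < gagliardo_real" "gagliardo_const = ennreal gagliardo_real"
  using gagliardo_const_finite gagliardo_const_pos
  by (auto simp: gagliardo_real_def enn2real_positive_iff less_top)

lemma gagliardo_kinetic:
  "u \<in> H_half \<Longrightarrow> gagliardo u = ennreal (gagliardo_real * kinetic 0 u)"
  using gagliardo_real(1)
  by (simp add: gagliardo_eq H_half_L2 nkin_eq_kinetic gagliardo_real(2) ennreal_mult kinetic_0_nonneg)

lemma difference_quotient_integral:
  assumes u: "u \<in> H_half"
  shows "integrable (lborel \<Otimes>\<^sub>M lborel) (\<lambda>z. cmod (difference_quotient u z) powr 2)"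
    "(LINT z|(lborel \<Otimes>\<^sub>M lborel). cmod (difference_quotient u z) powr 2) = gagliardo_real * kinetic 0 u"
proof -
  note [measurable] = L2_measurable[OF H_half_L2[OF u]]
  have nn: "(\<integral>\<^sup>+z. ennreal (cmod (difference_quotient u z) powr 2) \<partial>(lborel \<Otimes>\<^sub>M lborel)) = ennreal (gagliardo_real * kinetic 0 u)"
    using nn_integral_difference_quotient[of u] gagliardo_kinetic[OF u] by simp
  show "integrable (lborel \<Otimes>\<^sub>M lborel) (\<lambda>z. cmod (difference_quotient u z) powr 2)"
    by (rule integrableI_bounded) (use nn in auto)
  show "(LINT z|(lborel \<Otimes>\<^sub>M lborel). cmod (difference_quotient u z) powr 2) = gagliardo_real * kinetic 0 u"
    using nn gagliardo_real(1) kinetic_0_nonneg[of u] by (subst integral_eq_nn_integral) auto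
qed

lemma kinetic_0_split:
  fixes u :: "nat \<Rightarrow> real \<Rightarrow> complex"
  assumes u: "\<And>n. u n \<in> H_half" and w: "w \<in> H_half"
    and ae: "AE x in lborel. (\<lambda>n. u n x) \<longlonglongrightarrow> w x"
    and B: "\<And>n. kinetic 0 (\<lambda>x. u n x - w x) \<le> B"
  shows "(\<lambda>n. kinetic 0 (u n) - kinetic 0 (\<lambda>x. u n x - w x)) \<longlonglongrightarrow> kinetic 0 w"
proof -
  note [measurable] = L2_measurable[OF H_half_L2[OF u]] L2_measurable[OF H_half_L2[OF w]]
  note d = H_half_diff[OF u w]
  have dq: "difference_quotient (\<lambda>x. u n x - w x) z = difference_quotient (u n) z - difference_quotient w z" for n z
    by (simp add: difference_quotient_def diff_divide_distrib)
  have "(\<lambda>n. (LINT z|(lborel \<Otimes>\<^sub>M lborel). cmod (difference_quotient (u n) z) powr 2) -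
      (LINT z|(lborel \<Otimes>\<^sub>M lborel). cmod (difference_quotient (u n) z - difference_quotient w z) powr 2))
    \<longlonglongrightarrow> (LINT z|(lborel \<Otimes>\<^sub>M lborel). cmod (difference_quotient w z) powr 2)"
  proof (rule Brezis_Lieb)
    show "AE z in lborel \<Otimes>\<^sub>M lborel. (\<lambda>n. difference_quotient (u n) z) \<longlonglongrightarrow> difference_quotient w z"
      using AE_pair_translate[OF ae]
    proof eventually_elim
      case (elim z)
      have "(\<lambda>n. (u n (snd z + fst z) - u n (snd z)) * inverse (complex_of_real (fst z)))
        \<longlonglongrightarrow> (w (snd z + fst z) - w (snd z)) * inverse (complex_of_real (fst z))"
        using elim by (intro tendsto_intros) auto
      then show ?case by (simp add: difference_quotient_def divide_inverse)
    qed
    show "(LINT z|(lborel \<Otimes>\<^sub>M lborel). cmod (difference_quotient (u n) z - difference_quotient w z) powr 2)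
        \<le> gagliardo_real * B" for n
      using difference_quotient_integral(2)[OF d[of n]] B[of n] gagliardo_real(1) by (simp add: dq)
    show "integrable (lborel \<Otimes>\<^sub>M lborel) (\<lambda>z. cmod (difference_quotient (u n) z - difference_quotient w z) powr 2)" for n
      using difference_quotient_integral(1)[OF d[of n]] by (simp add: dq)
  qed (use difference_quotient_integral(1)[OF u] difference_quotient_integral(1)[OF w] in auto)
  then have "(\<lambda>n. gagliardo_real * (kinetic 0 (u n) - kinetic 0 (\<lambda>x. u n x - w x))) \<longlonglongrightarrow> gagliardo_real * kinetic 0 w"
    unfolding dq[symmetric] difference_quotient_integral(2)[OF u] difference_quotient_integral(2)[OF d]
      difference_quotient_integral(2)[OF w] by (simp only: right_diff_distrib)
  from tendsto_mult_left[OF this, of "1 / gagliardo_real"]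
  show ?thesis using gagliardo_real(1) by simp
qed

text \<open>Fatou's lemma for the inner and then for the outer integral; it puts almost everywhere
  limits of bounded sequences back into the Sobolev space.\<close>

lemma gagliardo_Fatou:
  fixes f :: "nat \<Rightarrow> real \<Rightarrow> complex"
  assumes [measurable]: "\<And>n. f n \<in> borel_measurable borel" "g \<in> borel_measurable borel"
    and ae: "AE x in lborel. (\<lambda>n. f n x) \<longlonglongrightarrow> g x"
    and le: "\<And>n. gagliardo (f n) \<le> B"
  shows "gagliardo g \<le> B"
proof -
  have "gagliardo g \<le> (\<integral>\<^sup>+h. liminf (\<lambda>n. \<integral>\<^sup>+x. ennreal ((cmod (f n (x + h) - f n x))\<^sup>2 / h\<^sup>2) \<partial>lborel) \<partial>lborel)"
    unfolding gagliardo_def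
  proof (rule nn_integral_mono)
    fix h
    have "(\<integral>\<^sup>+x. ennreal ((cmod (g (x + h) - g x))\<^sup>2 / h\<^sup>2) \<partial>lborel)
      = (\<integral>\<^sup>+x. liminf (\<lambda>n. ennreal ((cmod (f n (x + h) - f n x))\<^sup>2 / h\<^sup>2)) \<partial>lborel)"
    proof (rule nn_integral_cong_AE, use ae AE_translate[OF ae, of h] in eventually_elim)
      case (elim x)
      have "(\<lambda>n. ennreal ((cmod (f n (x + h) - f n x))\<^sup>2 * inverse (h\<^sup>2))) \<longlonglongrightarrow> ennreal ((cmod (g (x + h) - g x))\<^sup>2 * inverse (h\<^sup>2))"
        by (intro tendsto_intros elim)
      then have "(\<lambda>n. ennreal ((cmod (f n (x + h) - f n x))\<^sup>2 / h\<^sup>2)) \<longlonglongrightarrow> ennreal ((cmod (g (x + h) - g x))\<^sup>2 / h\<^sup>2)"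
        by (simp only: divide_inverse)
      then show ?case by (intro lim_imp_Liminf[symmetric]) simp
    qed
    also have "\<dots> \<le> liminf (\<lambda>n. \<integral>\<^sup>+x. ennreal ((cmod (f n (x + h) - f n x))\<^sup>2 / h\<^sup>2) \<partial>lborel)"
      by (rule nn_integral_liminf) measurable
    finally show "(\<integral>\<^sup>+x. ennreal ((cmod (g (x + h) - g x))\<^sup>2 / h\<^sup>2) \<partial>lborel)
      \<le> liminf (\<lambda>n. \<integral>\<^sup>+x. ennreal ((cmod (f n (x + h) - f n x))\<^sup>2 / h\<^sup>2) \<partial>lborel)" .
  qed
  also have "\<dots> \<le> liminf (\<lambda>n. gagliardo (f n))"
    unfolding gagliardo_def by (rule nn_integral_liminf) measurable
  also have "\<dots> \<le> limsup (\<lambda>n. gagliardo (f n))" by (rule Liminf_le_Limsup) simp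
  also have "\<dots> \<le> B" by (rule Limsup_bounded) (use le in auto)
  finally show ?thesis .
qed

section \<open>Almost everywhere convergent subsequences\<close>

lemma borel_measurable_grid[measurable]:
  fixes F :: "int \<Rightarrow> complex"
  shows "(\<lambda>x. F \<lfloor>real k * x\<rfloor>) \<in> borel_measurable (borel :: real measure)"
  by measurable

lemma weighted_grid_error:
  assumes u: "u \<in> L2" and k: "0 < k"
  shows "(\<integral>\<^sup>+x. ennreal (cmod (u x - grid_average k u \<lfloor>real k * x\<rfloor>)) \<partial>weighted)
     \<le> ennreal (1 / sqrt (real k)) * (emeasure weighted UNIV + gagliardo u)"
proof -
  note [measurable] = L2_measurable[OF u]
  have "(\<integral>\<^sup>+x. ennreal (cmod (u x - grid_average k u \<lfloor>real k * x\<rfloor>)) \<partial>weighted)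
     \<le> (\<integral>\<^sup>+x. ennreal (1 / sqrt (real k)) * (1 + local_gagliardo u x) \<partial>weighted)"
    by (intro nn_integral_mono grid_average_error u k)
  also have "\<dots> = ennreal (1 / sqrt (real k)) * (emeasure weighted UNIV + (\<integral>\<^sup>+x. local_gagliardo u x \<partial>weighted))"
    by (simp add: nn_integral_cmult nn_integral_add)
  also have "(\<integral>\<^sup>+x. local_gagliardo u x \<partial>weighted) \<le> (\<integral>\<^sup>+x. local_gagliardo u x \<partial>lborel)"
  proof (subst nn_integral_weighted, measurable, intro nn_integral_mono)
    fix x
    have "ennreal (1 / (1 + x\<^sup>2)) \<le> ennreal 1" by (intro ennreal_leI) (simp add: divide_le_eq one_plus_square_pos)
    then have "ennreal (1 / (1 + x\<^sup>2)) * local_gagliardo u x \<le> 1 * local_gagliardo u x"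
      by (intro mult_right_mono) auto
    then show "ennreal (1 / (1 + x\<^sup>2)) * local_gagliardo u x \<le> local_gagliardo u x" by simp
  qed
  also have "(\<integral>\<^sup>+x. local_gagliardo u x \<partial>lborel) = gagliardo u" by (simp add: nn_integral_local_gagliardo)
  finally show ?thesis by (simp add: add_left_mono mult_left_mono)
qed

text \<open>On a fine grid all functions are uniformly close to their step functions, and on each
  fixed grid the step functions converge along the diagonal subsequence. That subsequence is
  therefore Cauchy in the weighted \<open>L^1\<close> distance.\<close>

theorem H_half_local_compactness:
  fixes u :: "nat \<Rightarrow> real \<Rightarrow> complex"
  assumes u: "\<And>n. u n \<in> H_half" and A: "\<And>n. mass (u n) \<le> A" and B: "\<And>n. kinetic 0 (u n) \<le> B"
  obtains r w where "strict_mono r" "w \<in> H_half" "AE x in lborel. (\<lambda>n. u (r n) x) \<longlonglongrightarrow> w x"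
proof -
  note uL = H_half_L2[OF u]
  note [measurable] = L2_measurable[OF uL]
  have A0: "0 \<le> A" using order_trans[OF mass_nonneg A[of 0]] .
  have B0: "0 \<le> B" using order_trans[OF kinetic_0_nonneg B[of 0]] .
  \<comment> \<open>The averages grow at most linearly in k; dividing by 1 + k yields one bound for
    all index pairs, as the diagonal extraction requires. The factor is undone right
    afterwards.\<close>
  define f where "f n p = (case p of (k, j) \<Rightarrow> grid_average k (u n) j / (1 + of_nat k))" for n and p :: "nat \<times> int"
  have f_bound: "norm (f n p) \<le> 1 + A" if "p \<in> UNIV" for n p
  proof (cases p)
    case (Pair k j)
    have "cmod (grid_average k (u n) j) \<le> real k * (1 + A)" by (rule grid_average_bound[OF uL A])
    also have "\<dots> \<le> (1 + real k) * (1 + A)" using A0 by (intro mult_right_mono) auto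
    finally have "cmod (grid_average k (u n) j) / (1 + real k) \<le> 1 + A" by (simp add: pos_divide_le_eq mult.commute add_pos_nonneg)
    moreover have "cmod (1 + of_nat k) = 1 + real k"
      using norm_of_nat[of "Suc k", where 'a = complex] by simp
    ultimately show ?thesis by (simp add: f_def Pair norm_divide)
  qed
  obtain r1 where r1: "strict_mono (r1 :: nat \<Rightarrow> nat)"
    and conv: "\<And>p. p \<in> UNIV \<Longrightarrow> \<exists>l. (\<lambda>n. f (r1 n) p) \<longlonglongrightarrow> l"
    by (rule function_convergent_subsequence[of "UNIV :: (nat \<times> int) set" f "1 + A"])
      (simp, erule f_bound, blast)
  have "\<exists>l. (\<lambda>n. grid_average k (u (r1 n)) j) \<longlonglongrightarrow> l" for k j
  proof -
    obtain l where "(\<lambda>n. grid_average k (u (r1 n)) j / (1 + of_nat k)) \<longlonglongrightarrow> l"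
      using conv[of "(k, j)"] by (auto simp: f_def)
    from tendsto_mult_right[OF this, of "1 + of_nat k"]
    have "(\<lambda>n. grid_average k (u (r1 n)) j / (1 + of_nat k) * (1 + of_nat k)) \<longlonglongrightarrow> l * (1 + of_nat k)" .
    moreover have "(1 + of_nat k :: complex) \<noteq> 0" using of_nat_neq_0[of k, where 'a = complex] by simp
    ultimately have "(\<lambda>n. grid_average k (u (r1 n)) j) \<longlonglongrightarrow> l * (1 + of_nat k)" by simp
    then show ?thesis by blast
  qed
  then obtain L where L: "\<And>k j. (\<lambda>n. grid_average k (u (r1 n)) j) \<longlonglongrightarrow> L k j" by metis
  obtain W where W: "emeasure weighted UNIV = ennreal W" "0 \<le> W"
    using finite_weighted by (cases "emeasure weighted UNIV") auto
  define v where "v n = u (r1 n)" for n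
  have vm[measurable]: "v n \<in> borel_measurable borel" for n by (simp add: v_def)
  have cau: "\<exists>N. \<forall>i\<ge>N. \<forall>j\<ge>N. (\<integral>\<^sup>+x. ennreal (norm (v i x - v j x)) \<partial>weighted) \<le> ennreal e" if e: "0 < e" for e :: real
  proof -
    define Z where "Z = W + gagliardo_real * B"
    have Z: "0 \<le> Z" using W B0 gagliardo_real(1) by (simp add: Z_def)
    \<comment> \<open>The grid is fixed before the index n: each replacement by a step function then
      costs at most e / 4, uniformly in n. Two replacements and two comparisons with the limiting
      step function add up to e.\<close>
    obtain k :: nat where k: "(4 * Z / e)\<^sup>2 + 1 \<le> real k" using real_arch_simple by blast
    have k0: "0 < k" using k by (metis add_nonneg_pos less_le_trans of_nat_0_less_iff zero_le_power2 zero_less_one)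
    have "4 * Z / e \<le> sqrt (real k)" using k by (intro real_le_rsqrt) simp
    then have small: "1 / sqrt (real k) * Z \<le> e / 4" using e k0 by (simp add: field_simps)
    have err: "(\<integral>\<^sup>+x. ennreal (cmod (v n x - grid_average k (v n) \<lfloor>real k * x\<rfloor>)) \<partial>weighted) \<le> ennreal (e / 4)" for n
    proof -
      have "(\<integral>\<^sup>+x. ennreal (cmod (v n x - grid_average k (v n) \<lfloor>real k * x\<rfloor>)) \<partial>weighted)
        \<le> ennreal (1 / sqrt (real k)) * (emeasure weighted UNIV + gagliardo (v n))"
        unfolding v_def by (rule weighted_grid_error[OF uL k0])
      also have "\<dots> \<le> ennreal (1 / sqrt (real k)) * (ennreal W + ennreal (gagliardo_real * B))"
        using B[of "r1 n"] gagliardo_real(1) unfolding W(1) v_def gagliardo_kinetic[OF u]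
        by (intro mult_left_mono add_left_mono ennreal_leI) auto
      also have "\<dots> = ennreal (1 / sqrt (real k) * Z)"
      proof -
        have "ennreal W + ennreal (gagliardo_real * B) = ennreal Z"
          using W B0 gagliardo_real(1) by (simp add: Z_def)
        then show ?thesis using ennreal_mult[of "1 / sqrt (real k)" Z] Z by (simp only:) simp
      qed
      also have "\<dots> \<le> ennreal (e / 4)" by (rule ennreal_leI[OF small])
      finally show ?thesis .
    qed
    have "(\<lambda>n. \<integral>\<^sup>+x. ennreal (cmod (grid_average k (v n) \<lfloor>real k * x\<rfloor> - L k \<lfloor>real k * x\<rfloor>)) \<partial>weighted)
      \<longlonglongrightarrow> (\<integral>\<^sup>+x. 0 \<partial>weighted)"
    proof (rule nn_integral_dominated_convergence[where w = "\<lambda>x. ennreal (2 * (real k * (1 + A)))"])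
      show "(\<lambda>x. ennreal (cmod (grid_average k (v n) \<lfloor>real k * x\<rfloor> - L k \<lfloor>real k * x\<rfloor>))) \<in> borel_measurable weighted" for n
        using borel_measurable_grid[of "\<lambda>j. grid_average k (v n) j - L k j" k] by measurable
      have Lb: "cmod (L k j) \<le> real k * (1 + A)" for j
        by (rule LIMSEQ_le_const2[OF tendsto_norm[OF L]]) (use grid_average_bound[OF uL A] in auto)
      have "cmod (grid_average k (v n) j - L k j) \<le> 2 * (real k * (1 + A))" for n j
        using norm_triangle_ineq4[of "grid_average k (v n) j" "L k j"] Lb[of j] grid_average_bound[OF uL A, of k "r1 n" j]
        by (simp add: v_def)
      then show "AE x in weighted. ennreal (cmod (grid_average k (v n) \<lfloor>real k * x\<rfloor> - L k \<lfloor>real k * x\<rfloor>)) \<le> ennreal (2 * (real k * (1 + A)))" for n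
        by (intro AE_I2 ennreal_leI)
      show "(\<integral>\<^sup>+x. ennreal (2 * (real k * (1 + A))) \<partial>weighted) < \<infinity>"
        using W by (simp add: ennreal_mult_less_top)
      show "AE x in weighted. (\<lambda>n. ennreal (cmod (grid_average k (v n) \<lfloor>real k * x\<rfloor> - L k \<lfloor>real k * x\<rfloor>))) \<longlonglongrightarrow> 0"
      proof (rule AE_I2)
        fix x
        have "(\<lambda>n. grid_average k (v n) \<lfloor>real k * x\<rfloor> - L k \<lfloor>real k * x\<rfloor>) \<longlonglongrightarrow> 0"
          using LIM_zero[OF L[of k "\<lfloor>real k * x\<rfloor>"]] by (simp add: v_def)
        from tendsto_ennrealI[OF tendsto_norm[OF this]]
        show "(\<lambda>n. ennreal (cmod (grid_average k (v n) \<lfloor>real k * x\<rfloor> - L k \<lfloor>real k * x\<rfloor>))) \<longlonglongrightarrow> 0" by simp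
      qed
    qed auto
    then have "(\<lambda>n. \<integral>\<^sup>+x. ennreal (cmod (grid_average k (v n) \<lfloor>real k * x\<rfloor> - L k \<lfloor>real k * x\<rfloor>)) \<partial>weighted) \<longlonglongrightarrow> 0"
      by simp
    from ennreal_tendsto_0D[OF this, of "e / 4"] e
    obtain N where N: "\<And>n. n \<ge> N \<Longrightarrow> (\<integral>\<^sup>+x. ennreal (cmod (grid_average k (v n) \<lfloor>real k * x\<rfloor> - L k \<lfloor>real k * x\<rfloor>)) \<partial>weighted) < ennreal (e / 4)"
      by (auto simp: eventually_sequentially)
    have "(\<integral>\<^sup>+x. ennreal (norm (v i x - v j x)) \<partial>weighted) \<le> ennreal e" if ij: "i \<ge> N" "j \<ge> N" for i j
    proof -
      let ?g = "\<lambda>n x. grid_average k (v n) \<lfloor>real k * x\<rfloor>" and ?L = "\<lambda>x. L k \<lfloor>real k * x\<rfloor>"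
      have [measurable]: "?g n \<in> borel_measurable borel" "?L \<in> borel_measurable borel" for n
        by (rule borel_measurable_grid)+
      have "(\<integral>\<^sup>+x. ennreal (norm (v i x - v j x)) \<partial>weighted)
        \<le> (\<integral>\<^sup>+x. ((ennreal (cmod (v i x - ?g i x)) + ennreal (cmod (?g i x - ?L x))) +
             (ennreal (cmod (v j x - ?g j x)) + ennreal (cmod (?g j x - ?L x)))) \<partial>weighted)"
      proof (rule nn_integral_mono)
        fix x
        have "norm (v i x - v j x) \<le> (cmod (v i x - ?g i x) + cmod (?g i x - ?L x)) + (cmod (v j x - ?g j x) + cmod (?g j x - ?L x))"
          by norm
        from ennreal_leI[OF this]
        show "ennreal (norm (v i x - v j x)) \<le> ((ennreal (cmod (v i x - ?g i x)) + ennreal (cmod (?g i x - ?L x))) +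
             (ennreal (cmod (v j x - ?g j x)) + ennreal (cmod (?g j x - ?L x))))"
          by simp
      qed
      also have "\<dots> = ((\<integral>\<^sup>+x. ennreal (cmod (v i x - ?g i x)) \<partial>weighted) + (\<integral>\<^sup>+x. ennreal (cmod (?g i x - ?L x)) \<partial>weighted)) +
             ((\<integral>\<^sup>+x. ennreal (cmod (v j x - ?g j x)) \<partial>weighted) + (\<integral>\<^sup>+x. ennreal (cmod (?g j x - ?L x)) \<partial>weighted))"
        by (simp add: nn_integral_add)
      also have "\<dots> \<le> (ennreal (e / 4) + ennreal (e / 4)) + (ennreal (e / 4) + ennreal (e / 4))"
        using N[OF ij(1)] N[OF ij(2)] err[of i] err[of j] by (intro add_mono) auto
      also have "\<dots> = ennreal e" using e by (simp flip: ennreal_plus)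
      finally show ?thesis .
    qed
    then show ?thesis by blast
  qed
  have vw: "v n \<in> borel_measurable weighted" for n by simp
  obtain r2 w where r2: "strict_mono r2" and wm: "w \<in> borel_measurable weighted"
    and ae: "AE x in weighted. (\<lambda>n. v (r2 n) x) \<longlonglongrightarrow> w x"
    using Cauchy_L1_AE_subseq[OF vw cau] by blast
  have wm[measurable]: "w \<in> borel_measurable borel" using wm by simp
  have ae: "AE x in lborel. (\<lambda>n. v (r2 n) x) \<longlonglongrightarrow> w x" using ae by (simp add: AE_weighted)
  have "nmass (v n) \<le> ennreal A" for n
    using A nmass_eq_mass[OF uL] by (simp add: v_def ennreal_leI)
  then have "nmass w \<le> ennreal A" by (intro L2_Fatou[OF _ _ ae]) auto
  then have wL: "w \<in> L2" by (auto simp: L2_iff intro: le_less_trans)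
  have "gagliardo (v n) \<le> ennreal (gagliardo_real * B)" for n
    using B gagliardo_real(1) unfolding v_def gagliardo_kinetic[OF u] by (intro ennreal_leI) simp
  then have "gagliardo w \<le> ennreal (gagliardo_real * B)" by (intro gagliardo_Fatou[OF _ _ ae]) auto
  then have "gagliardo_const * nkin w < \<infinity>" unfolding gagliardo_eq[OF wL] by (auto intro: le_less_trans)
  then have "nkin w < \<infinity>" using gagliardo_const_pos by (auto simp: ennreal_mult_less_top)
  then have "w \<in> H_half" using wL by (simp add: H_half_iff)
  moreover have "strict_mono (r1 \<circ> r2)" using r1 r2 by (rule strict_mono_o)
  ultimately show ?thesis using that[of "r1 \<circ> r2" w] ae by (simp add: v_def)
qed

section \<open>Energy estimates\<close>

definition Lr_integral :: "real \<Rightarrow> (real \<Rightarrow> complex) \<Rightarrow> real" where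
  "Lr_integral r u = (LINT x|lborel. cmod (u x) powr r)"

lemma energy_eq:
  "energy v p q u = 1 / 2 * kinetic v u + 1 / (q + 1) * Lr_integral (q + 1) u - 1 / (p + 1) * Lr_integral (p + 1) u"
  by (simp add: energy_def Lr_integral_def)

lemma Lr_integral_nonneg: "0 \<le> Lr_integral r u"
  unfolding Lr_integral_def by (intro Bochner_Integration.integral_nonneg) simp

lemma Lr_integral_2: "Lr_integral 2 u = mass u"
  by (simp add: Lr_integral_def mass_def)

text \<open>Above the threshold T the larger exponent dominates, below it the smaller one. Moving T
  decides which coefficient is small.\<close>

lemma powr_interpolate:
  fixes a b r t T :: real
  assumes "a \<le> r" "r \<le> b" "0 < T" "0 \<le> t"
  shows "t powr r \<le> T powr (r - b) * t powr b + T powr (r - a) * t powr a"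
proof (cases "t = 0")
  case False
  then have t: "0 < t" using assms by simp
  have nn: "0 \<le> T powr (r - b) * t powr b" "0 \<le> T powr (r - a) * t powr a" by simp_all
  show ?thesis
  proof (cases "T \<le> t")
    case True
    have "t powr r = t powr (r - b) * t powr b" by (simp flip: powr_add)
    also have "\<dots> \<le> T powr (r - b) * t powr b"
      using True t assms by (intro mult_right_mono powr_mono2') auto
    finally show ?thesis using nn by linarith
  next
    case False
    have "t powr r = t powr (r - a) * t powr a" by (simp flip: powr_add)
    also have "\<dots> \<le> T powr (r - a) * t powr a"
      using False t assms by (intro mult_right_mono powr_mono2) auto
    finally show ?thesis using nn by linarith
  qed
qed simp

lemma H_half_L4:
  assumes u: "u \<in> H_half" and \<mu>: "0 < \<mu>" "\<And>x. local_mass u x \<le> ennreal \<mu>"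
  shows "integrable lborel (\<lambda>x. cmod (u x) powr 4)"
    "Lr_integral 4 u \<le> 16 * \<mu> * (gagliardo_real * kinetic 0 u + mass u)"
proof -
  note uL = H_half_L2[OF u]
  note [measurable] = L2_measurable[OF uL]
  have "(\<integral>\<^sup>+x. ennreal (cmod (u x) powr 4) \<partial>lborel) \<le> ennreal (16 * \<mu>) * (gagliardo_const * nkin u + nmass u)"
    using L4_local_bound[OF uL \<mu>] by simp
  also have "\<dots> = ennreal (16 * \<mu> * (gagliardo_real * kinetic 0 u + mass u))"
    using \<mu>(1) gagliardo_real(1) kinetic_0_nonneg[of u] mass_nonneg[of u]
    by (simp add: gagliardo_real(2) nkin_eq_kinetic[OF u] nmass_eq_mass[OF uL] ennreal_mult)
  finally have le: "(\<integral>\<^sup>+x. ennreal (cmod (u x) powr 4) \<partial>lborel) \<le> ennreal (16 * \<mu> * (gagliardo_real * kinetic 0 u + mass u))" .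
  show i: "integrable lborel (\<lambda>x. cmod (u x) powr 4)"
    by (rule integrableI_bounded) (use le in \<open>auto intro: le_less_trans\<close>)
  have "ennreal (Lr_integral 4 u) \<le> ennreal (16 * \<mu> * (gagliardo_real * kinetic 0 u + mass u))"
    using le unfolding Lr_integral_def by (subst (asm) nn_integral_eq_integral[OF i]) auto
  then show "Lr_integral 4 u \<le> 16 * \<mu> * (gagliardo_real * kinetic 0 u + mass u)"
    using \<mu>(1) gagliardo_real(1) kinetic_0_nonneg[of u] mass_nonneg[of u] by (subst (asm) ennreal_le_iff) auto
qed

text \<open>No window carries more than the total mass; the added 1 keeps \<mu> positive when u
  vanishes.\<close>

lemma H_half_L4_global:
  assumes u: "u \<in> H_half"
  shows "integrable lborel (\<lambda>x. cmod (u x) powr 4)"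
    "Lr_integral 4 u \<le> 16 * (mass u + 1) * (gagliardo_real * kinetic 0 u + mass u)"
proof -
  have *: "0 < mass u + 1" "local_mass u x \<le> ennreal (mass u + 1)" for x
  proof -
    show "0 < mass u + 1" using mass_nonneg[of u] by simp
    have "local_mass u x \<le> nmass u" by (rule local_mass_le[OF L2_measurable[OF H_half_L2[OF u]]])
    also have "\<dots> \<le> ennreal (mass u + 1)" unfolding nmass_eq_mass[OF H_half_L2[OF u]] by (rule ennreal_leI) simp
    finally show "local_mass u x \<le> ennreal (mass u + 1)" .
  qed
  show "integrable lborel (\<lambda>x. cmod (u x) powr 4)"
    "Lr_integral 4 u \<le> 16 * (mass u + 1) * (gagliardo_real * kinetic 0 u + mass u)"
    using H_half_L4[OF u *] by auto
qed

lemma H_half_Lr_integrable: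
  assumes u: "u \<in> H_half" and r: "2 \<le> r" "r \<le> 4"
  shows "integrable lborel (\<lambda>x. cmod (u x) powr r)"
proof -
  note [measurable] = L2_measurable[OF H_half_L2[OF u]]
  have i2: "integrable lborel (\<lambda>x. cmod (u x) powr 2)" using square_integrable[OF H_half_L2[OF u]] by simp
  note i4 = H_half_L4_global(1)[OF u]
  have *: "cmod (u x) powr r \<le> cmod (u x) powr 2 + cmod (u x) powr 4" for x
    using powr_interpolate[OF r, of 1 "cmod (u x)"] by (simp del: powr_numeral)
  show ?thesis
  proof (rule Bochner_Integration.integrable_bound)
    show "integrable lborel (\<lambda>x. cmod (u x) powr 2 + cmod (u x) powr 4)" using i2 i4 by (rule Bochner_Integration.integrable_add)
    show "AE x in lborel. norm (cmod (u x) powr r) \<le> norm (cmod (u x) powr 2 + cmod (u x) powr 4)"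
      using * by (intro AE_I2) (simp del: powr_numeral)
  qed measurable
qed

lemma Lr_integral_interpolate:
  assumes r: "2 \<le> r" "r \<le> 4" and T: "0 < T" and u: "u \<in> H_half"
  shows "Lr_integral r u \<le> T powr (r - 4) * Lr_integral 4 u + T powr (r - 2) * mass u"
proof -
  note i = H_half_Lr_integrable[OF u, of r] H_half_Lr_integrable[OF u, of 4] H_half_Lr_integrable[OF u, of 2]
  have "Lr_integral r u \<le> (LINT x|lborel. T powr (r - 4) * cmod (u x) powr 4 + T powr (r - 2) * cmod (u x) powr 2)"
    unfolding Lr_integral_def using i r powr_interpolate[OF r T]
    by (intro integral_mono Bochner_Integration.integrable_add integrable_mult_right) auto
  also have "\<dots> = T powr (r - 4) * Lr_integral 4 u + T powr (r - 2) * Lr_integral 2 u"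
    unfolding Lr_integral_def using i
    by (subst Bochner_Integration.integral_add) (auto intro!: integrable_mult_right simp del: powr_numeral)
  finally show ?thesis by (simp add: Lr_integral_2)
qed

text \<open>The threshold solves \<open>T powr (r - 4) = \<delta>\<close>. This version serves when
  the \<open>L^4\<close> integral is only controlled linearly or bounded, as in the coercivity
  estimate and when the mass tends to zero.\<close>

lemma Lr_interpolate:
  assumes r: "2 < r" "r < 4" and \<delta>: "0 < \<delta>"
  obtains C where "0 \<le> C" "\<And>u. u \<in> H_half \<Longrightarrow> Lr_integral r u \<le> \<delta> * Lr_integral 4 u + C * mass u"
proof -
  define T where "T = \<delta> powr (1 / (r - 4))"
  have T: "0 < T" "T powr (r - 4) = \<delta>" using r \<delta> by (simp_all add: T_def powr_powr)
  then show ?thesis using that[of "T powr (r - 2)"] Lr_integral_interpolate[of r T] r by auto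
qed

text \<open>The threshold solves \<open>T powr (r - 2) = \<delta>\<close>. This version serves when
  the mass is only bounded and the \<open>L^4\<close> integral is small, as under vanishing.\<close>

lemma Lr_interpolate':
  assumes r: "2 < r" "r < 4" and \<delta>: "0 < \<delta>"
  obtains C where "0 \<le> C" "\<And>u. u \<in> H_half \<Longrightarrow> Lr_integral r u \<le> \<delta> * mass u + C * Lr_integral 4 u"
proof -
  define T where "T = \<delta> powr (1 / (r - 2))"
  have T: "0 < T" "T powr (r - 2) = \<delta>" using r \<delta> by (simp_all add: T_def powr_powr)
  then show ?thesis using that[of "T powr (r - 4)"] Lr_integral_interpolate[of r T] r by (auto simp: add.commute)
qed

lemma L4_bounded:
  assumes u: "u \<in> H_half" and A: "mass u \<le> A" and B: "kinetic 0 u \<le> B"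
  shows "Lr_integral 4 u \<le> 16 * (A + 1) * (gagliardo_real * B + A)"
proof -
  have nn: "0 \<le> A" "0 \<le> B" using A B mass_nonneg[of u] kinetic_0_nonneg[of u] by auto
  have "Lr_integral 4 u \<le> 16 * (mass u + 1) * (gagliardo_real * kinetic 0 u + mass u)"
    by (rule H_half_L4_global(2)[OF u])
  also have "\<dots> \<le> 16 * (A + 1) * (gagliardo_real * B + A)"
    using A B nn gagliardo_real(1) mass_nonneg[of u] kinetic_0_nonneg[of u]
    by (intro mult_mono add_mono mult_nonneg_nonneg add_nonneg_nonneg) auto
  finally show ?thesis .
qed

lemma Lr_bounded:
  assumes r: "2 < r" "r < 4"
  obtains M where "\<And>u. u \<in> H_half \<Longrightarrow> mass u \<le> A \<Longrightarrow> kinetic 0 u \<le> B \<Longrightarrow> Lr_integral r u \<le> M"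
proof -
  obtain C where C: "0 \<le> C" "\<And>u. u \<in> H_half \<Longrightarrow> Lr_integral r u \<le> 1 * Lr_integral 4 u + C * mass u"
    using Lr_interpolate[OF r, of 1] by auto
  show ?thesis
  proof (rule that[of "16 * (A + 1) * (gagliardo_real * B + A) + C * A"])
    fix u assume u: "u \<in> H_half" and A: "mass u \<le> A" and B: "kinetic 0 u \<le> B"
    have "C * mass u \<le> C * A" using C(1) A by (intro mult_left_mono) auto
    then show "Lr_integral r u \<le> 16 * (A + 1) * (gagliardo_real * B + A) + C * A"
      using C(2)[OF u] L4_bounded[OF u A B] by linarith
  qed
qed

section \<open>Symmetries and dilations of the energy\<close>

lemma Lr_integral_translate: "Lr_integral r (\<lambda>x. u (x + y)) = Lr_integral r u"
  unfolding Lr_integral_def by (rule integral_translate[of "\<lambda>x. cmod (u x) powr r"])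

lemma mass_translate: "mass (\<lambda>x. u (x + y)) = mass u"
  by (simp add: Lr_integral_translate flip: Lr_integral_2)

lemma Lr_integral_phase: "cmod c = 1 \<Longrightarrow> Lr_integral r (\<lambda>x. c * u x) = Lr_integral r u"
  by (simp add: Lr_integral_def norm_mult)

lemma mass_phase: "cmod c = 1 \<Longrightarrow> mass (\<lambda>x. c * u x) = mass u"
  by (simp add: Lr_integral_phase flip: Lr_integral_2)

lemma Lr_integral_dilate: "0 < l \<Longrightarrow> Lr_integral r (\<lambda>x. u (x / l)) = l * Lr_integral r u"
  unfolding Lr_integral_def
  using lborel_integral_real_affine[of l "\<lambda>x. cmod (u (x / l)) powr r" 0] by simp

lemma mass_dilate: "0 < l \<Longrightarrow> mass (\<lambda>x. u (x / l)) = l * mass u"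
  by (simp add: Lr_integral_dilate flip: Lr_integral_2)

lemma energy_translate: "u \<in> L2 \<Longrightarrow> energy v p q (\<lambda>x. u (x + y)) = energy v p q u"
  by (simp add: energy_eq Lr_integral_translate translate_invariance)

lemma energy_phase: "u \<in> L2 \<Longrightarrow> cmod c = 1 \<Longrightarrow> energy v p q (\<lambda>x. c * u x) = energy v p q u"
  by (simp add: energy_eq Lr_integral_phase phase_invariance)

text \<open>Only the \<open>L^r\<close> terms pick up the factor l. Writing the result as l times
  the full energy leaves a kinetic correction whose sign is responsible for the strict inequality in
  the mass splitting.\<close>

lemma energy_dilate:
  assumes "u \<in> L2" "0 < l"
  shows "energy v p q (\<lambda>x. u (x / l)) = l * energy v p q u - (l - 1) / 2 * kinetic v u"
  using assms by (simp add: energy_eq Lr_integral_dilate kinetic_dilate field_simps)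

section \<open>Coercivity and continuity of the energy\<close>

text \<open>Here p < 3 enters: the focusing term is at most \<delta> times an \<open>L^4\<close>
  integral that is linear in \<open>kinetic 0\<close> for bounded mass, up to a constant, and the
  coercive part of the energy absorbs it. The defocusing term has the favourable sign.\<close>

lemma kinetic_bounded_by_energy:
  fixes v p q A E0 :: real
  assumes v: "\<bar>v\<bar> < 1" and pq: "1 < q" "q < p" "p < 3" and A: "0 \<le> A"
  obtains B where "\<And>u. u \<in> H_half \<Longrightarrow> mass u \<le> A \<Longrightarrow> energy v p q u \<le> E0 \<Longrightarrow> kinetic 0 u \<le> B"
proof -
  \<comment> \<open>The 16 of the quartic bound times 4: the focusing term then uses up (1 - |v|) /
    4 of the available (1 - |v|) / 2.\<close>
  define \<delta> where "\<delta> = (1 - \<bar>v\<bar>) / (64 * (A + 1) * gagliardo_real)"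
  have \<delta>: "0 < \<delta>" using v A gagliardo_real(1) by (simp add: \<delta>_def)
  obtain C where C: "0 \<le> C" "\<And>u. u \<in> H_half \<Longrightarrow> Lr_integral (p + 1) u \<le> \<delta> * Lr_integral 4 u + C * mass u"
    using Lr_interpolate[of "p + 1" \<delta>] pq \<delta> by auto
  define B where "B = 4 / (1 - \<bar>v\<bar>) * (E0 + \<delta> * (16 * (A + 1) * A) + C * A)"
  show ?thesis
  proof
    fix u assume u: "u \<in> H_half" and mA: "mass u \<le> A" and en: "energy v p q u \<le> E0"
    note nn = mass_nonneg[of u] kinetic_0_nonneg[of u] Lr_integral_nonneg[of _ u]
    have "\<delta> * Lr_integral 4 u \<le> \<delta> * (16 * (A + 1) * (gagliardo_real * kinetic 0 u + A))"
      using L4_bounded[OF u mA order_refl] \<delta> by (intro mult_left_mono) auto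
    also have "\<dots> = (1 - \<bar>v\<bar>) / 4 * kinetic 0 u + \<delta> * (16 * (A + 1) * A)"
    proof -
      have "\<delta> * (16 * (A + 1) * gagliardo_real) = (1 - \<bar>v\<bar>) / 4"
      proof -
        have "64 * (A + 1) * gagliardo_real \<noteq> 0" using A gagliardo_real(1) by simp
        then have "\<delta> * (64 * (A + 1) * gagliardo_real) = 1 - \<bar>v\<bar>" unfolding \<delta>_def by (rule nonzero_eq_divide_eq[THEN iffD1, OF _ refl])
        then have "4 * (\<delta> * (16 * (A + 1) * gagliardo_real)) = 1 - \<bar>v\<bar>" by (simp add: algebra_simps)
        from this[symmetric] show ?thesis by simp
      qed
      then have "\<delta> * (16 * (A + 1) * gagliardo_real) * kinetic 0 u = (1 - \<bar>v\<bar>) / 4 * kinetic 0 u" by simp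
      then show ?thesis by (simp add: distrib_left mult.assoc)
    qed
    finally have 1: "\<delta> * Lr_integral 4 u \<le> (1 - \<bar>v\<bar>) / 4 * kinetic 0 u + \<delta> * (16 * (A + 1) * A)" .
    have 2: "C * mass u \<le> C * A" using C(1) mA by (intro mult_left_mono)
    have 3: "1 / (p + 1) * Lr_integral (p + 1) u \<le> Lr_integral (p + 1) u"
      using pq nn(3)[of "p + 1"] by (intro mult_left_le_one_le) auto
    have 4: "0 \<le> 1 / (q + 1) * Lr_integral (q + 1) u" using pq nn(3)[of "q + 1"] by simp
    have "(1 - \<bar>v\<bar>) / 2 * kinetic 0 u \<le> 1 / 2 * kinetic v u" using kinetic_lower(1)[OF u, of v] by simp
    also have "\<dots> \<le> E0 + Lr_integral (p + 1) u" using en 3 4 unfolding energy_eq by linarith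
    also have "\<dots> \<le> E0 + ((1 - \<bar>v\<bar>) / 4 * kinetic 0 u + \<delta> * (16 * (A + 1) * A) + C * A)"
      using C(2)[OF u] 1 2 by linarith
    finally have "(1 - \<bar>v\<bar>) / 4 * kinetic 0 u \<le> E0 + \<delta> * (16 * (A + 1) * A) + C * A"
      by (simp add: field_simps)
    then have "4 / (1 - \<bar>v\<bar>) * ((1 - \<bar>v\<bar>) / 4 * kinetic 0 u) \<le> B"
      unfolding B_def using v by (intro mult_left_mono) auto
    then show "kinetic 0 u \<le> B" using v by simp
  qed
qed

text \<open>The common last step for all parts of the energy: \<epsilon> is chosen against the bound
  M, and only then does the factor C meet the vanishing sequence.\<close>

lemma functional_close:
  fixes X Y Y' D :: "nat \<Rightarrow> real"
  assumes b: "\<And>\<epsilon>. 0 < \<epsilon> \<Longrightarrow> \<exists>C\<ge>0. \<forall>n. \<bar>X n - Y n\<bar> \<le> \<epsilon> * Y' n + C * D n"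
    and Y': "\<And>n. Y' n \<le> M" and D: "D \<longlonglongrightarrow> 0"
  shows "(\<lambda>n. X n - Y n) \<longlonglongrightarrow> 0"
proof (rule LIMSEQ_I)
  fix e :: real assume e: "0 < e"
  define \<epsilon> where "\<epsilon> = e / (2 * (\<bar>M\<bar> + 1))"
  have \<epsilon>: "0 < \<epsilon>" "\<epsilon> * \<bar>M\<bar> \<le> e / 2" using e by (auto simp: \<epsilon>_def field_simps)
  obtain C where C: "0 \<le> C" "\<And>n. \<bar>X n - Y n\<bar> \<le> \<epsilon> * Y' n + C * D n" using b[OF \<epsilon>(1)] by blast
  have "(\<lambda>n. C * D n) \<longlonglongrightarrow> C * 0" by (intro tendsto_mult_left D)
  from LIMSEQ_D[OF this, of "e / 2"] e obtain N where N: "\<And>n. n \<ge> N \<Longrightarrow> \<bar>C * D n\<bar> < e / 2" by auto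
  have "norm (X n - Y n - 0) < e" if "n \<ge> N" for n
  proof -
    have "\<epsilon> * Y' n \<le> \<epsilon> * \<bar>M\<bar>" using \<epsilon>(1) Y'[of n] by (intro mult_left_mono) auto
    then show ?thesis using C(2)[of n] \<epsilon>(2) N[OF that] unfolding diff_0_right real_norm_def by linarith
  qed
  then show "\<exists>N. \<forall>n\<ge>N. norm (X n - Y n - 0) < e" by blast
qed

lemma Lr_integral_close:
  assumes r: "2 \<le> r" "r \<le> 4" and \<epsilon>: "0 < \<epsilon>"
  obtains C where "0 \<le> C" "\<And>u w. u \<in> H_half \<Longrightarrow> w \<in> H_half \<Longrightarrow>
     \<bar>Lr_integral r u - Lr_integral r w\<bar> \<le> \<epsilon> * Lr_integral r w + C * Lr_integral r (\<lambda>x. u x - w x)"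
proof -
  obtain C where C: "0 \<le> C"
      "\<And>a b :: complex. \<bar>norm (a + b) powr r - norm a powr r\<bar> \<le> \<epsilon> * norm a powr r + C * norm b powr r"
    using powr_norm_add_bound[of r \<epsilon>, where 'a = complex] r \<epsilon> by auto
  show ?thesis
  proof (rule that[OF C(1)])
    fix u w assume u: "u \<in> H_half" and w: "w \<in> H_half"
    note i = H_half_Lr_integrable[OF u r] H_half_Lr_integrable[OF w r] H_half_Lr_integrable[OF H_half_diff[OF u w] r]
    have "\<bar>Lr_integral r u - Lr_integral r w\<bar> = norm (LINT x|lborel. cmod (u x) powr r - cmod (w x) powr r)"
      unfolding Lr_integral_def using i by simp
    also have "\<dots> \<le> (LINT x|lborel. norm (cmod (u x) powr r - cmod (w x) powr r))" by (rule integral_norm_bound)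
    also have "\<dots> \<le> (LINT x|lborel. \<epsilon> * cmod (w x) powr r + C * cmod (u x - w x) powr r)"
    proof (rule integral_mono)
      show "norm (cmod (u x) powr r - cmod (w x) powr r) \<le> \<epsilon> * cmod (w x) powr r + C * cmod (u x - w x) powr r" for x
        using C(2)[of "w x" "u x - w x"] by simp
    qed (use i in auto)
    also have "\<dots> = \<epsilon> * Lr_integral r w + C * Lr_integral r (\<lambda>x. u x - w x)"
      unfolding Lr_integral_def using i by simp
    finally show "\<bar>Lr_integral r u - Lr_integral r w\<bar> \<le> \<epsilon> * Lr_integral r w + C * Lr_integral r (\<lambda>x. u x - w x)" .
  qed
qed

text \<open>For |v| < 1 the symbol |\<xi>| - v \<xi> is nonnegative, so the pointwise inequality for
  squares can be multiplied by it and integrated.\<close>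

lemma kinetic_close:
  assumes \<epsilon>: "0 < \<epsilon>" and v: "\<bar>v\<bar> < 1"
  obtains C where "0 \<le> C" "\<And>u w. u \<in> H_half \<Longrightarrow> w \<in> H_half \<Longrightarrow>
     \<bar>kinetic v u - kinetic v w\<bar> \<le> \<epsilon> * kinetic v w + C * kinetic v (\<lambda>x. u x - w x)"
proof -
  obtain C where C: "0 \<le> C"
      "\<And>a b :: complex. \<bar>(norm (a + b))\<^sup>2 - (norm a)\<^sup>2\<bar> \<le> \<epsilon> * (norm a)\<^sup>2 + C * (norm b)\<^sup>2"
    using square_norm_add_bound[OF \<epsilon>, where 'a = complex] by auto
  show ?thesis
  proof (rule that[OF C(1)])
    fix u w assume u: "u \<in> H_half" and w: "w \<in> H_half"
    note d = H_half_diff[OF u w]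
    note [measurable] = fourier_measurable[OF H_half_L2[OF u]] fourier_measurable[OF H_half_L2[OF w]] fourier_measurable[OF H_half_L2[OF d]]
    note i = H_half_integrable(2)[OF u, of v] H_half_integrable(2)[OF w, of v] H_half_integrable(2)[OF d, of v]
    let ?m = "\<lambda>\<xi>. \<bar>\<xi>\<bar> - v * \<xi>"
    have m: "0 \<le> ?m \<xi>" for \<xi>
    proof -
      have "v * \<xi> \<le> \<bar>v\<bar> * \<bar>\<xi>\<bar>" by (metis abs_ge_self abs_mult)
      also have "\<dots> \<le> 1 * \<bar>\<xi>\<bar>" using v by (intro mult_right_mono) auto
      finally show ?thesis by simp
    qed
    have "\<bar>kinetic v u - kinetic v w\<bar> = norm (LINT \<xi>|lborel. ?m \<xi> * (cmod (fourier u \<xi>))\<^sup>2 - ?m \<xi> * (cmod (fourier w \<xi>))\<^sup>2)"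
      unfolding kinetic_def using i by simp
    also have "\<dots> \<le> (LINT \<xi>|lborel. norm (?m \<xi> * (cmod (fourier u \<xi>))\<^sup>2 - ?m \<xi> * (cmod (fourier w \<xi>))\<^sup>2))" by (rule integral_norm_bound)
    also have "\<dots> \<le> (LINT \<xi>|lborel. \<epsilon> * (?m \<xi> * (cmod (fourier w \<xi>))\<^sup>2) + C * (?m \<xi> * (cmod (fourier (\<lambda>x. u x - w x) \<xi>))\<^sup>2))"
    proof (rule integral_mono_AE)
      show "AE \<xi> in lborel. norm (?m \<xi> * (cmod (fourier u \<xi>))\<^sup>2 - ?m \<xi> * (cmod (fourier w \<xi>))\<^sup>2)
          \<le> \<epsilon> * (?m \<xi> * (cmod (fourier w \<xi>))\<^sup>2) + C * (?m \<xi> * (cmod (fourier (\<lambda>x. u x - w x) \<xi>))\<^sup>2)"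
        using fourier_diff[OF H_half_L2[OF u] H_half_L2[OF w]]
      proof eventually_elim
        case (elim \<xi>)
        have "norm (?m \<xi> * (cmod (fourier u \<xi>))\<^sup>2 - ?m \<xi> * (cmod (fourier w \<xi>))\<^sup>2) = ?m \<xi> * \<bar>(cmod (fourier u \<xi>))\<^sup>2 - (cmod (fourier w \<xi>))\<^sup>2\<bar>"
          using m[of \<xi>] by (simp only: real_norm_def right_diff_distrib[symmetric] abs_mult abs_of_nonneg)
        also have "\<dots> \<le> ?m \<xi> * (\<epsilon> * (cmod (fourier w \<xi>))\<^sup>2 + C * (cmod (fourier (\<lambda>x. u x - w x) \<xi>))\<^sup>2)"
          using C(2)[of "fourier w \<xi>" "fourier u \<xi> - fourier w \<xi>"] m[of \<xi>] elim by (intro mult_left_mono) auto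
        finally show ?case by (simp only: distrib_left mult.left_commute)
      qed
    qed (use i in auto)
    also have "\<dots> = \<epsilon> * kinetic v w + C * kinetic v (\<lambda>x. u x - w x)"
      unfolding kinetic_def using i by simp
    finally show "\<bar>kinetic v u - kinetic v w\<bar> \<le> \<epsilon> * kinetic v w + C * kinetic v (\<lambda>x. u x - w x)" .
  qed
qed

lemma Lr_integral_tendsto_0:
  fixes d :: "nat \<Rightarrow> real \<Rightarrow> complex"
  assumes r: "2 < r" "r < 4" and d: "\<And>n. d n \<in> H_half" and B: "\<And>n. kinetic 0 (d n) \<le> B"
    and m: "(\<lambda>n. mass (d n)) \<longlonglongrightarrow> 0"
  shows "(\<lambda>n. Lr_integral r (d n)) \<longlonglongrightarrow> 0"
proof -
  obtain A where A: "\<And>n. mass (d n) \<le> A"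
    using convergent_imp_Bseq[OF convergentI[OF m]] by (auto simp: Bseq_def abs_le_iff)
  have "(\<lambda>n. Lr_integral r (d n) - 0) \<longlonglongrightarrow> 0"
  proof (rule functional_close[where Y' = "\<lambda>n. Lr_integral 4 (d n)" and D = "\<lambda>n. mass (d n)"
      and M = "16 * (A + 1) * (gagliardo_real * B + A)"])
    fix \<epsilon> :: real assume \<epsilon>: "0 < \<epsilon>"
    obtain C where "0 \<le> C" "\<And>u. u \<in> H_half \<Longrightarrow> Lr_integral r u \<le> \<epsilon> * Lr_integral 4 u + C * mass u"
      using Lr_interpolate[OF r \<epsilon>] by blast
    then show "\<exists>C\<ge>0. \<forall>n. \<bar>Lr_integral r (d n) - 0\<bar> \<le> \<epsilon> * Lr_integral 4 (d n) + C * mass (d n)"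
      using d Lr_integral_nonneg by (intro exI[of _ C]) auto
  qed (rule L4_bounded[OF d A B], rule m)
  then show ?thesis by simp
qed

text \<open>Both sequences vary, because initial data approach the set of ground states and not a
  single one. Hence continuity has to be uniform on bounded sets.\<close>

lemma energy_close:
  fixes u w :: "nat \<Rightarrow> real \<Rightarrow> complex"
  assumes v: "\<bar>v\<bar> < 1" and pq: "1 < q" "q < p" "p < 3"
    and u: "\<And>n. u n \<in> H_half" and w: "\<And>n. w n \<in> H_half"
    and A: "\<And>n. mass (w n) \<le> A" and B: "\<And>n. kinetic 0 (w n) \<le> B"
    and lim: "(\<lambda>n. H_half_norm (\<lambda>x. u n x - w n x)) \<longlonglongrightarrow> 0"
  shows "(\<lambda>n. energy v p q (u n) - energy v p q (w n)) \<longlonglongrightarrow> 0"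
    "(\<lambda>n. mass (u n) - mass (w n)) \<longlonglongrightarrow> 0"
proof -
  let ?d = "\<lambda>n x. u n x - w n x"
  note d = H_half_diff[OF u w]
  have sq: "(\<lambda>n. (H_half_norm (?d n))\<^sup>2) \<longlonglongrightarrow> 0" using tendsto_power[OF lim, of 2] by simp
  have m0: "(\<lambda>n. mass (?d n)) \<longlonglongrightarrow> 0"
    using H_half_norm_bounds(1)[OF d] mass_nonneg
    by (intro Lim_null_comparison[OF _ sq]) (auto intro!: always_eventually)
  have k0: "(\<lambda>n. kinetic 0 (?d n)) \<longlonglongrightarrow> 0"
    using H_half_norm_bounds(2)[OF d] kinetic_0_nonneg
    by (intro Lim_null_comparison[OF _ sq]) (auto intro!: always_eventually)
  have kb: "0 \<le> kinetic v (?d n) \<and> kinetic v (?d n) \<le> (1 + \<bar>v\<bar>) * kinetic 0 (?d n)" for n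
  proof -
    have "0 \<le> (1 - \<bar>v\<bar>) * kinetic 0 (?d n)" using v kinetic_0_nonneg by simp
    then show ?thesis using kinetic_lower[OF H_half_diff[OF u[of n] w[of n]], of v] by linarith
  qed
  have "(\<lambda>n. (1 + \<bar>v\<bar>) * kinetic 0 (?d n)) \<longlonglongrightarrow> (1 + \<bar>v\<bar>) * 0" by (intro tendsto_mult_left k0)
  then have kv: "(\<lambda>n. kinetic v (?d n)) \<longlonglongrightarrow> 0"
    using kb by (intro Lim_null_comparison[of "\<lambda>n. kinetic v (?d n)" "\<lambda>n. (1 + \<bar>v\<bar>) * kinetic 0 (?d n)"]) (auto intro!: always_eventually)
  obtain B' where B': "\<And>n. kinetic 0 (?d n) \<le> B'"
    using convergent_imp_Bseq[OF convergentI[OF k0]] by (auto simp: Bseq_def abs_le_iff)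
  have T: "(\<lambda>n. kinetic v (u n) - kinetic v (w n)) \<longlonglongrightarrow> 0"
  proof (rule functional_close[OF _ _ kv, where Y' = "\<lambda>n. kinetic v (w n)" and M = "(1 + \<bar>v\<bar>) * B"])
    show "\<exists>C\<ge>0. \<forall>n. \<bar>kinetic v (u n) - kinetic v (w n)\<bar> \<le> \<epsilon> * kinetic v (w n) + C * kinetic v (?d n)" if "0 < \<epsilon>" for \<epsilon>
      using kinetic_close[OF that v] u w by metis
    fix n
    have "(1 + \<bar>v\<bar>) * kinetic 0 (w n) \<le> (1 + \<bar>v\<bar>) * B" using B by (intro mult_left_mono) auto
    then show "kinetic v (w n) \<le> (1 + \<bar>v\<bar>) * B" using kinetic_lower(2)[OF w[of n], of v] by linarith
  qed
  have L: "(\<lambda>n. Lr_integral r (u n) - Lr_integral r (w n)) \<longlonglongrightarrow> 0"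
    if r: "2 \<le> r" "r \<le> 4" and D: "(\<lambda>n. Lr_integral r (?d n)) \<longlonglongrightarrow> 0" and M: "\<And>n. Lr_integral r (w n) \<le> M" for r M
  proof (rule functional_close[OF _ M D])
    show "\<exists>C\<ge>0. \<forall>n. \<bar>Lr_integral r (u n) - Lr_integral r (w n)\<bar> \<le> \<epsilon> * Lr_integral r (w n) + C * Lr_integral r (?d n)" if "0 < \<epsilon>" for \<epsilon>
      using Lr_integral_close[OF r that] u w by metis
  qed
  show "(\<lambda>n. mass (u n) - mass (w n)) \<longlonglongrightarrow> 0"
    using L[of 2 A] m0 A by (simp add: Lr_integral_2)
  have Lb: "\<exists>M. \<forall>n. Lr_integral r (w n) \<le> M" if r: "2 < r" "r < 4" for r
    using Lr_bounded[OF r, of A B] w A B by metis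
  have LL: "(\<lambda>n. Lr_integral r (u n) - Lr_integral r (w n)) \<longlonglongrightarrow> 0" if r: "2 < r" "r < 4" for r
    using Lb[OF r] L[of r] Lr_integral_tendsto_0[OF r d B' m0] r by auto
  have "(\<lambda>n. 1 / 2 * (kinetic v (u n) - kinetic v (w n)) + 1 / (q + 1) * (Lr_integral (q + 1) (u n) - Lr_integral (q + 1) (w n))
      - 1 / (p + 1) * (Lr_integral (p + 1) (u n) - Lr_integral (p + 1) (w n))) \<longlonglongrightarrow>
      1 / 2 * 0 + 1 / (q + 1) * 0 - 1 / (p + 1) * 0"
    using pq by (intro tendsto_diff tendsto_add tendsto_mult_left T LL) auto
  then show "(\<lambda>n. energy v p q (u n) - energy v p q (w n)) \<longlonglongrightarrow> 0"
    unfolding energy_eq by (simp add: right_diff_distrib algebra_simps)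
qed

section \<open>Momentum and non-vanishing\<close>

lemma cmod_add_square: "(cmod (a + b))\<^sup>2 = (cmod a)\<^sup>2 + (cmod b)\<^sup>2 + 2 * Re (a * cnj b)"
  unfolding cmod_power2 by (simp add: power2_eq_square algebra_simps)

lemma integral_add_twice:
  fixes f g h :: "'a \<Rightarrow> real"
  assumes "integrable M f" "integrable M g" "integrable M h"
  shows "(LINT x|M. f x + g x + 2 * h x) = (LINT x|M. f x) + (LINT x|M. g x) + 2 * (LINT x|M. h x)"
  using assms by simp

text \<open>Polarisation: twice the real pairing is the mass of d + g minus the two masses, and this
  difference tends to zero by the Brezis-Lieb lemma. The real part is what occurs in the cross term
  of a squared modulus.\<close>

lemma weak_convergence_fourier:
  fixes d :: "nat \<Rightarrow> real \<Rightarrow> complex"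
  assumes d: "\<And>n. d n \<in> L2" and A: "\<And>n. mass (d n) \<le> A"
    and ae: "AE x in lborel. (\<lambda>n. d n x) \<longlonglongrightarrow> 0" and g: "g \<in> L2"
  shows "(\<lambda>n. LINT \<xi>|lborel. Re (fourier (d n) \<xi> * cnj (fourier g \<xi>))) \<longlonglongrightarrow> 0"
proof -
  note s = L2_add[OF d g]
  note [measurable] = L2_measurable[OF d] L2_measurable[OF g] fourier_measurable[OF d] fourier_measurable[OF g]
    fourier_measurable[OF s]
  have i: "integrable lborel (\<lambda>\<xi>. Re (fourier (d n) \<xi> * cnj (fourier g \<xi>)))" for n
    by (intro integrable_Re integrable_L2_product fourier_L2 d g)
  have eq: "mass (\<lambda>x. d n x + g x) = mass (d n) + mass g + 2 * (LINT \<xi>|lborel. Re (fourier (d n) \<xi> * cnj (fourier g \<xi>)))" for n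
  proof -
    have "mass (\<lambda>x. d n x + g x) = (LINT \<xi>|lborel. (cmod (fourier (\<lambda>x. d n x + g x) \<xi>))\<^sup>2)"
      using mass_fourier[OF s[of n]] by (simp add: mass_def)
    also have "\<dots> = (LINT \<xi>|lborel. (cmod (fourier (d n) \<xi>))\<^sup>2 + (cmod (fourier g \<xi>))\<^sup>2 + 2 * Re (fourier (d n) \<xi> * cnj (fourier g \<xi>)))"
    proof (rule integral_cong_AE)
      show "AE \<xi> in lborel. (cmod (fourier (\<lambda>x. d n x + g x) \<xi>))\<^sup>2 =
          (cmod (fourier (d n) \<xi>))\<^sup>2 + (cmod (fourier g \<xi>))\<^sup>2 + 2 * Re (fourier (d n) \<xi> * cnj (fourier g \<xi>))"
        using fourier_linear[OF d[of n] g, of 1 1] by eventually_elim (simp add: cmod_add_square)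
    qed measurable
    also have "\<dots> = mass (fourier (d n)) + mass (fourier g) + 2 * (LINT \<xi>|lborel. Re (fourier (d n) \<xi> * cnj (fourier g \<xi>)))"
      unfolding mass_def
      by (rule integral_add_twice[OF square_integrable[OF fourier_L2[OF d]] square_integrable[OF fourier_L2[OF g]] i])
    finally show ?thesis by (simp only: mass_fourier d g)
  qed
  have "(\<lambda>n. (LINT x|lborel. cmod (d n x + g x) powr 2) - (LINT x|lborel. cmod ((d n x + g x) - g x) powr 2))
      \<longlonglongrightarrow> (LINT x|lborel. cmod (g x) powr 2)"
  proof (rule Brezis_Lieb[where B = A])
    show "AE x in lborel. (\<lambda>n. d n x + g x) \<longlonglongrightarrow> g x"
      using ae by eventually_elim (rule tendsto_eq_intros, assumption, rule tendsto_const, simp)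
    show "(LINT x|lborel. cmod ((d n x + g x) - g x) powr 2) \<le> A" for n using A[of n] by (simp add: mass_def)
  qed (use square_integrable[OF d] square_integrable[OF g] square_integrable[OF s] in auto)
  then have "(\<lambda>n. mass (\<lambda>x. d n x + g x) - mass (d n)) \<longlonglongrightarrow> mass g" by (simp add: mass_def)
  then have "(\<lambda>n. mass g + 2 * (LINT \<xi>|lborel. Re (fourier (d n) \<xi> * cnj (fourier g \<xi>)))) \<longlonglongrightarrow> mass g"
    unfolding eq by simp
  from tendsto_diff[OF this tendsto_const[of "mass g"]]
  have "(\<lambda>n. 2 * (LINT \<xi>|lborel. Re (fourier (d n) \<xi> * cnj (fourier g \<xi>)))) \<longlonglongrightarrow> 0" by simp
  from tendsto_mult_left[OF this, of "1/2"] show ?thesis by simp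
qed

lemma abs_sin_quotient_le:
  fixes \<xi> \<delta> :: real
  assumes "0 < \<delta>"
  shows "\<bar>\<xi> - sin (\<delta> * \<xi>) / \<delta>\<bar> \<le> 2 * \<bar>\<xi>\<bar>"
proof -
  have "\<bar>sin (\<delta> * \<xi>) / \<delta>\<bar> \<le> \<bar>\<xi>\<bar>"
    using abs_sin_x_le_abs_x[of "\<delta> * \<xi>"] assms by (simp add: abs_mult field_simps)
  then show ?thesis by linarith
qed

lemma sin_quotient_tendsto: "(\<lambda>k. sin (1 / real (Suc k) * \<xi>) / (1 / real (Suc k))) \<longlonglongrightarrow> (\<xi>::real)"
proof -
  have "((\<lambda>t::real. sin (t * \<xi>)) has_real_derivative \<xi>) (at 0)"
    by (auto intro!: derivative_eq_intros)
  then have "((\<lambda>t. sin (t * \<xi>) / t) \<longlongrightarrow> \<xi>) (at 0)"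
    by (simp add: has_field_derivative_iff)
  moreover have "filterlim (\<lambda>k. 1 / real (Suc k)) (at 0) sequentially"
    unfolding filterlim_at using LIMSEQ_Suc[OF lim_1_over_n] by (auto intro!: always_eventually)
  ultimately show ?thesis by (rule filterlim_compose)
qed

text \<open>
  Pointwise convergence controls the cross terms only after multiplication by trigonometric
  polynomials, which are translations; \<open>sin (\<delta> * \<xi>) / \<delta>\<close> replaces the symbol \<open>\<xi>\<close>.
\<close>

lemma momentum_split:
  fixes u :: "nat \<Rightarrow> real \<Rightarrow> complex"
  assumes u: "\<And>n. u n \<in> H_half" and w: "w \<in> H_half"
    and ae: "AE x in lborel. (\<lambda>n. u n x) \<longlonglongrightarrow> w x"
    and A: "\<And>n. mass (\<lambda>x. u n x - w x) \<le> A"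
    and B: "\<And>n. kinetic 0 (\<lambda>x. u n x - w x) \<le> B"
  shows "(\<lambda>n. momentum (u n) - momentum (\<lambda>x. u n x - w x)) \<longlonglongrightarrow> momentum w"
proof -
  define d where "d n = (\<lambda>x. u n x - w x)" for n
  have d: "d n \<in> H_half" for n unfolding d_def by (rule H_half_diff[OF u w])
  note dL = H_half_L2[OF d] and wL = H_half_L2[OF w] and uL = H_half_L2[OF u]
  note [measurable] = fourier_measurable[OF dL] fourier_measurable[OF wL] fourier_measurable[OF uL]
  have d0: "AE x in lborel. (\<lambda>n. d n x) \<longlonglongrightarrow> 0"
    using ae unfolding d_def by eventually_elim (rule LIM_zero)
  define c where "c n \<xi> = Re (fourier (d n) \<xi> * cnj (fourier w \<xi>))" for n \<xi>
  have [measurable]: "c n \<in> borel_measurable borel" for n unfolding c_def by measurable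
  have cb: "\<bar>c n \<xi>\<bar> \<le> \<eta> * (cmod (fourier (d n) \<xi>))\<^sup>2 + 1 / \<eta> * (cmod (fourier w \<xi>))\<^sup>2" if "0 < \<eta>" for n \<xi> \<eta>
  proof -
    have "\<bar>c n \<xi>\<bar> \<le> cmod (fourier (d n) \<xi> * cnj (fourier w \<xi>))" unfolding c_def by (rule abs_Re_le_cmod)
    also have "\<dots> = cmod (fourier (d n) \<xi>) * cmod (fourier w \<xi>)" by (simp add: norm_mult)
    also have "\<dots> \<le> \<eta> * (cmod (fourier (d n) \<xi>))\<^sup>2 + 1 / \<eta> * (cmod (fourier w \<xi>))\<^sup>2"
      by (rule product_le_weighted_squares[OF that]) auto
    finally show ?thesis .
  qed
  note kd = H_half_integrable_abs[OF d] and kw = H_half_integrable_abs[OF w]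
  have mi: "integrable lborel (\<lambda>\<xi>. m \<xi> * c n \<xi>)"
    if [measurable]: "m \<in> borel_measurable borel" and m: "\<And>\<xi>. \<bar>m \<xi>\<bar> \<le> K * \<bar>\<xi>\<bar>" "0 \<le> K" for m K n
  proof (rule Bochner_Integration.integrable_bound)
    show "integrable lborel (\<lambda>\<xi>. K * (\<bar>\<xi>\<bar> * (cmod (fourier (d n) \<xi>))\<^sup>2 + \<bar>\<xi>\<bar> * (cmod (fourier w \<xi>))\<^sup>2))"
      using kd[of n] kw by simp
    show "AE \<xi> in lborel. norm (m \<xi> * c n \<xi>) \<le> norm (K * (\<bar>\<xi>\<bar> * (cmod (fourier (d n) \<xi>))\<^sup>2 + \<bar>\<xi>\<bar> * (cmod (fourier w \<xi>))\<^sup>2))"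
    proof (rule AE_I2)
      fix \<xi>
      have "norm (m \<xi> * c n \<xi>) \<le> (K * \<bar>\<xi>\<bar>) * ((cmod (fourier (d n) \<xi>))\<^sup>2 + (cmod (fourier w \<xi>))\<^sup>2)"
        unfolding real_norm_def abs_mult using m cb[of 1 n \<xi>] by (intro mult_mono) auto
      also have "\<dots> \<le> norm (K * (\<bar>\<xi>\<bar> * (cmod (fourier (d n) \<xi>))\<^sup>2 + \<bar>\<xi>\<bar> * (cmod (fourier w \<xi>))\<^sup>2))"
        by (simp add: distrib_left mult.assoc)
      finally show "norm (m \<xi> * c n \<xi>) \<le> norm (K * (\<bar>\<xi>\<bar> * (cmod (fourier (d n) \<xi>))\<^sup>2 + \<bar>\<xi>\<bar> * (cmod (fourier w \<xi>))\<^sup>2))" .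
    qed
  qed measurable
  \<comment> \<open>Half of the cross term in the expansion of the momentum of d + w; the splitting
    is equivalent to its vanishing in the limit.\<close>
  define X where "X n = (LINT \<xi>|lborel. \<xi> * c n \<xi>)" for n
  have mom: "momentum (u n) = momentum (d n) + momentum w + 2 * X n" for n
  proof -
    have "momentum (u n) = (LINT \<xi>|lborel. \<xi> * (cmod (fourier (d n) \<xi>))\<^sup>2 + \<xi> * (cmod (fourier w \<xi>))\<^sup>2 + 2 * (\<xi> * c n \<xi>))"
      unfolding momentum_def
    proof (rule integral_cong_AE)
      show "AE \<xi> in lborel. \<xi> * (cmod (fourier (u n) \<xi>))\<^sup>2 = \<xi> * (cmod (fourier (d n) \<xi>))\<^sup>2 + \<xi> * (cmod (fourier w \<xi>))\<^sup>2 + 2 * (\<xi> * c n \<xi>)"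
        using fourier_diff[OF uL[of n] wL]
      proof eventually_elim
        case (elim \<xi>)
        then have "fourier (u n) \<xi> = fourier (d n) \<xi> + fourier w \<xi>" by (simp add: d_def)
        then have "(cmod (fourier (u n) \<xi>))\<^sup>2 = (cmod (fourier (d n) \<xi>))\<^sup>2 + (cmod (fourier w \<xi>))\<^sup>2 + 2 * c n \<xi>"
          by (simp only: cmod_add_square c_def)
        then show ?case by (simp only: distrib_left mult.left_commute)
      qed
    qed measurable
    also have "\<dots> = momentum (d n) + momentum w + 2 * X n"
      unfolding momentum_def X_def using mi[of "\<lambda>\<xi>. \<xi>" 1 n]
      by (intro integral_add_twice H_half_integrable(1) d w) auto
    finally show ?thesis .
  qed
  have B0: "0 \<le> B" using B[of 0] kinetic_0_nonneg[of "\<lambda>x. u 0 x - w x"] by linarith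
  have "X \<longlonglongrightarrow> 0"
  proof (rule LIMSEQ_I)
    fix e :: real assume e: "0 < e"
    \<comment> \<open>Order of choices: \<eta> handles the part with d through its bounded kinetic
      form, then k handles the symbol error through w alone, and n comes last, for the pairing with
      a fixed function.\<close>
    define \<eta> where "\<eta> = e / (6 * (B + 1))"
    have \<eta>: "0 < \<eta>" "2 * \<eta> * B \<le> e / 3" using e B0 by (auto simp: \<eta>_def field_simps)
    define t where "t k \<xi> = \<bar>\<xi> - sin (1 / real (Suc k) * \<xi>) / (1 / real (Suc k))\<bar>" for k \<xi>
    have [measurable]: "t k \<in> borel_measurable borel" for k unfolding t_def by measurable
    have tb: "t k \<xi> \<le> 2 * \<bar>\<xi>\<bar>" "0 \<le> t k \<xi>" for k \<xi> unfolding t_def using abs_sin_quotient_le[of "1 / real (Suc k)" \<xi>] by auto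
    have ti: "integrable lborel (\<lambda>\<xi>. t k \<xi> * (cmod (fourier g \<xi>))\<^sup>2)" if "g \<in> H_half" for k g
    proof -
      note [measurable] = fourier_measurable[OF H_half_L2[OF that]]
      show ?thesis
      proof (rule Bochner_Integration.integrable_bound)
        show "integrable lborel (\<lambda>\<xi>. 2 * (\<bar>\<xi>\<bar> * (cmod (fourier g \<xi>))\<^sup>2))" using H_half_integrable_abs[OF that] by simp
        have "t k \<xi> * (cmod (fourier g \<xi>))\<^sup>2 \<le> (2 * \<bar>\<xi>\<bar>) * (cmod (fourier g \<xi>))\<^sup>2" for \<xi> by (intro mult_right_mono tb) auto
        then show "AE \<xi> in lborel. norm (t k \<xi> * (cmod (fourier g \<xi>))\<^sup>2) \<le> norm (2 * (\<bar>\<xi>\<bar> * (cmod (fourier g \<xi>))\<^sup>2))"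
          using tb(2) by (intro AE_I2) (simp add: abs_mult mult.assoc)
      qed measurable
    qed
    have "(\<lambda>k. LINT \<xi>|lborel. t k \<xi> * (cmod (fourier w \<xi>))\<^sup>2) \<longlonglongrightarrow> (LINT \<xi>|(lborel :: real measure). 0)"
    proof (rule integral_dominated_convergence[where w = "\<lambda>\<xi>. 2 * (\<bar>\<xi>\<bar> * (cmod (fourier w \<xi>))\<^sup>2)"])
      show "integrable lborel (\<lambda>\<xi>. 2 * (\<bar>\<xi>\<bar> * (cmod (fourier w \<xi>))\<^sup>2))" using kw by simp
      have "t k \<xi> * (cmod (fourier w \<xi>))\<^sup>2 \<le> (2 * \<bar>\<xi>\<bar>) * (cmod (fourier w \<xi>))\<^sup>2" for k \<xi> by (intro mult_right_mono tb) auto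
      then show "AE \<xi> in lborel. norm (t k \<xi> * (cmod (fourier w \<xi>))\<^sup>2) \<le> 2 * (\<bar>\<xi>\<bar> * (cmod (fourier w \<xi>))\<^sup>2)" for k
        using tb(2) by (intro AE_I2) (simp add: abs_mult mult.assoc)
      show "AE \<xi> in lborel. (\<lambda>k. t k \<xi> * (cmod (fourier w \<xi>))\<^sup>2) \<longlonglongrightarrow> 0"
      proof (rule AE_I2)
        fix \<xi>
        have "(\<lambda>k. \<bar>\<xi> - sin (1 / real (Suc k) * \<xi>) / (1 / real (Suc k))\<bar> * (cmod (fourier w \<xi>))\<^sup>2) \<longlonglongrightarrow> \<bar>\<xi> - \<xi>\<bar> * (cmod (fourier w \<xi>))\<^sup>2"
          by (intro tendsto_mult tendsto_rabs tendsto_diff tendsto_const sin_quotient_tendsto)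
        then show "(\<lambda>k. t k \<xi> * (cmod (fourier w \<xi>))\<^sup>2) \<longlonglongrightarrow> 0" by (simp add: t_def)
      qed
    qed measurable
    then have "(\<lambda>k. 1 / \<eta> * (LINT \<xi>|lborel. t k \<xi> * (cmod (fourier w \<xi>))\<^sup>2)) \<longlonglongrightarrow> 1 / \<eta> * 0"
      by (intro tendsto_mult_left) simp
    from LIMSEQ_D[OF this, of "e / 3"] e obtain k where
      "norm (1 / \<eta> * (LINT \<xi>|lborel. t k \<xi> * (cmod (fourier w \<xi>))\<^sup>2) - 1 / \<eta> * 0) < e / 3" by auto
    then have k: "1 / \<eta> * (LINT \<xi>|lborel. t k \<xi> * (cmod (fourier w \<xi>))\<^sup>2) < e / 3"
      unfolding mult_zero_right diff_0_right real_norm_def by linarith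
    define \<delta> where "\<delta> = 1 / real (Suc k)"
    have \<delta>: "0 < \<delta>" by (simp add: \<delta>_def)
    define g where "g = (\<lambda>x. (1 / (2 * \<i>)) * w (x + \<delta>) + (- 1 / (2 * \<i>)) * w (x + - \<delta>))"
    have gL: "g \<in> L2" unfolding g_def by (intro L2_add L2_cmult L2_translate wL)
    have gF: "AE \<xi> in lborel. fourier g \<xi> = complex_of_real (sin (\<delta> * \<xi>)) * fourier w \<xi>"
      unfolding g_def
      using fourier_linear[OF L2_translate[OF wL, of \<delta>] L2_translate[OF wL, of "- \<delta>"], of "1 / (2 * \<i>)" "- 1 / (2 * \<i>)"]
        fourier_translate[OF wL, of \<delta>] fourier_translate[OF wL, of "- \<delta>"]
    proof eventually_elim
      case (elim \<xi>)
      have "(1 / (2 * \<i>)) * cis (\<delta> * \<xi>) + (- 1 / (2 * \<i>)) * cis (- \<delta> * \<xi>) = complex_of_real (sin (\<delta> * \<xi>))"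
        by (simp add: complex_eq_iff Re_divide Im_divide)
      then show ?case unfolding elim by (metis (no_types) distrib_right mult.assoc)
    qed
    note [measurable] = fourier_measurable[OF gL]
    have "(\<lambda>n. LINT \<xi>|lborel. Re (fourier (d n) \<xi> * cnj (fourier g \<xi>))) \<longlonglongrightarrow> 0"
      by (rule weak_convergence_fourier[OF dL _ d0 gL]) (use A in \<open>simp add: d_def\<close>)
    moreover have "(LINT \<xi>|lborel. Re (fourier (d n) \<xi> * cnj (fourier g \<xi>))) = (LINT \<xi>|lborel. sin (\<delta> * \<xi>) * c n \<xi>)" for n
    proof (rule integral_cong_AE)
      show "AE \<xi> in lborel. Re (fourier (d n) \<xi> * cnj (fourier g \<xi>)) = sin (\<delta> * \<xi>) * c n \<xi>"
        using gF by eventually_elim (simp add: c_def algebra_simps)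
    qed measurable
    ultimately have "(\<lambda>n. LINT \<xi>|lborel. sin (\<delta> * \<xi>) * c n \<xi>) \<longlonglongrightarrow> 0" by simp
    from tendsto_mult_left[OF this, of "1 / \<delta>"]
    have "(\<lambda>n. 1 / \<delta> * (LINT \<xi>|lborel. sin (\<delta> * \<xi>) * c n \<xi>)) \<longlonglongrightarrow> 0" by simp
    from LIMSEQ_D[OF this, of "e / 3"] e obtain N where
      N: "\<And>n. n \<ge> N \<Longrightarrow> \<bar>1 / \<delta> * (LINT \<xi>|lborel. sin (\<delta> * \<xi>) * c n \<xi>)\<bar> < e / 3" by auto
    have "norm (X n - 0) < e" if n: "n \<ge> N" for n
    proof -
      have i1: "integrable lborel (\<lambda>\<xi>. \<xi> * c n \<xi>)" using mi[of "\<lambda>\<xi>. \<xi>" 1 n] by simp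
      have "\<bar>sin (\<delta> * \<xi>)\<bar> \<le> \<delta> * \<bar>\<xi>\<bar>" for \<xi> using abs_sin_x_le_abs_x[of "\<delta> * \<xi>"] \<delta> by (simp add: abs_mult)
      then have i2: "integrable lborel (\<lambda>\<xi>. sin (\<delta> * \<xi>) * c n \<xi>)" using \<delta> by (intro mi[where K = \<delta>]) auto
      have "X n = (LINT \<xi>|lborel. (\<xi> - sin (\<delta> * \<xi>) / \<delta>) * c n \<xi>) + 1 / \<delta> * (LINT \<xi>|lborel. sin (\<delta> * \<xi>) * c n \<xi>)"
      proof -
        have "(LINT \<xi>|lborel. (\<xi> - sin (\<delta> * \<xi>) / \<delta>) * c n \<xi>) = (LINT \<xi>|lborel. \<xi> * c n \<xi> - 1 / \<delta> * (sin (\<delta> * \<xi>) * c n \<xi>))"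
          by (simp add: left_diff_distrib)
        also have "\<dots> = X n - 1 / \<delta> * (LINT \<xi>|lborel. sin (\<delta> * \<xi>) * c n \<xi>)"
          unfolding X_def using i1 i2 by (subst Bochner_Integration.integral_diff) auto
        finally show ?thesis by simp
      qed
      moreover have "\<bar>LINT \<xi>|lborel. (\<xi> - sin (\<delta> * \<xi>) / \<delta>) * c n \<xi>\<bar> \<le> 2 * \<eta> * B + 1 / \<eta> * (LINT \<xi>|lborel. t k \<xi> * (cmod (fourier w \<xi>))\<^sup>2)"
      proof -
        have "\<bar>LINT \<xi>|lborel. (\<xi> - sin (\<delta> * \<xi>) / \<delta>) * c n \<xi>\<bar> \<le> (LINT \<xi>|lborel. norm ((\<xi> - sin (\<delta> * \<xi>) / \<delta>) * c n \<xi>))"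
          using integral_norm_bound[of lborel "\<lambda>\<xi>. (\<xi> - sin (\<delta> * \<xi>) / \<delta>) * c n \<xi>"] by simp
        also have "\<dots> \<le> (LINT \<xi>|lborel. 2 * \<eta> * (\<bar>\<xi>\<bar> * (cmod (fourier (d n) \<xi>))\<^sup>2) + 1 / \<eta> * (t k \<xi> * (cmod (fourier w \<xi>))\<^sup>2))"
        proof (rule integral_mono)
          show "integrable lborel (\<lambda>\<xi>. norm ((\<xi> - sin (\<delta> * \<xi>) / \<delta>) * c n \<xi>))"
            using \<delta> abs_sin_quotient_le by (intro integrable_norm mi[where K = 2]) auto
          show "integrable lborel (\<lambda>\<xi>. 2 * \<eta> * (\<bar>\<xi>\<bar> * (cmod (fourier (d n) \<xi>))\<^sup>2) + 1 / \<eta> * (t k \<xi> * (cmod (fourier w \<xi>))\<^sup>2))"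
            by (intro Bochner_Integration.integrable_add integrable_mult_right kd ti w)
          fix \<xi>
          have "norm ((\<xi> - sin (\<delta> * \<xi>) / \<delta>) * c n \<xi>) = t k \<xi> * \<bar>c n \<xi>\<bar>" by (simp add: t_def \<delta>_def abs_mult)
          also have "\<dots> \<le> t k \<xi> * (\<eta> * (cmod (fourier (d n) \<xi>))\<^sup>2 + 1 / \<eta> * (cmod (fourier w \<xi>))\<^sup>2)"
            by (intro mult_left_mono cb \<eta>(1) tb)
          also have "\<dots> = t k \<xi> * (\<eta> * (cmod (fourier (d n) \<xi>))\<^sup>2) + 1 / \<eta> * (t k \<xi> * (cmod (fourier w \<xi>))\<^sup>2)"
            by (simp only: distrib_left mult.left_commute)
          also have "t k \<xi> * (\<eta> * (cmod (fourier (d n) \<xi>))\<^sup>2) \<le> 2 * \<bar>\<xi>\<bar> * (\<eta> * (cmod (fourier (d n) \<xi>))\<^sup>2)"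
            using \<eta>(1) by (intro mult_right_mono tb) auto
          also have "2 * \<bar>\<xi>\<bar> * (\<eta> * (cmod (fourier (d n) \<xi>))\<^sup>2) = 2 * \<eta> * (\<bar>\<xi>\<bar> * (cmod (fourier (d n) \<xi>))\<^sup>2)" by (simp add: mult_ac)
          finally show "norm ((\<xi> - sin (\<delta> * \<xi>) / \<delta>) * c n \<xi>) \<le> 2 * \<eta> * (\<bar>\<xi>\<bar> * (cmod (fourier (d n) \<xi>))\<^sup>2) + 1 / \<eta> * (t k \<xi> * (cmod (fourier w \<xi>))\<^sup>2)"
            by simp
        qed
        also have "\<dots> = 2 * \<eta> * kinetic 0 (d n) + 1 / \<eta> * (LINT \<xi>|lborel. t k \<xi> * (cmod (fourier w \<xi>))\<^sup>2)"
          unfolding kinetic_0 using kd[of n] ti[OF w, of k]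
          by (subst Bochner_Integration.integral_add, simp, simp) (simp only: integral_mult_right_zero)
        also have "\<dots> \<le> 2 * \<eta> * B + 1 / \<eta> * (LINT \<xi>|lborel. t k \<xi> * (cmod (fourier w \<xi>))\<^sup>2)"
          using B[of n] \<eta>(1) by (simp add: d_def)
        finally show ?thesis .
      qed
      ultimately show ?thesis using N[OF n] k \<eta>(2) unfolding diff_0_right real_norm_def by linarith
    qed
    then show "\<exists>N. \<forall>n\<ge>N. norm (X n - 0) < e" by blast
  qed
  from tendsto_add[OF tendsto_const[of "momentum w"] tendsto_mult_left[OF this, of 2]]
  have "(\<lambda>n. momentum w + 2 * X n) \<longlonglongrightarrow> momentum w" by simp
  then show ?thesis using mom by (simp add: d_def)
qed

lemma kinetic_split:
  fixes u :: "nat \<Rightarrow> real \<Rightarrow> complex"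
  assumes u: "\<And>n. u n \<in> H_half" and w: "w \<in> H_half"
    and ae: "AE x in lborel. (\<lambda>n. u n x) \<longlonglongrightarrow> w x"
    and A: "\<And>n. mass (\<lambda>x. u n x - w x) \<le> A"
    and B: "\<And>n. kinetic 0 (\<lambda>x. u n x - w x) \<le> B"
  shows "(\<lambda>n. kinetic v (u n) - kinetic v (\<lambda>x. u n x - w x)) \<longlonglongrightarrow> kinetic v w"
proof -
  have "(\<lambda>n. (kinetic 0 (u n) - kinetic 0 (\<lambda>x. u n x - w x)) - v * (momentum (u n) - momentum (\<lambda>x. u n x - w x)))
      \<longlonglongrightarrow> kinetic 0 w - v * momentum w"
    by (intro tendsto_diff tendsto_mult_left kinetic_0_split[OF u w ae B] momentum_split[OF u w ae A B])
  moreover have "(kinetic 0 (u n) - kinetic 0 (\<lambda>x. u n x - w x)) - v * (momentum (u n) - momentum (\<lambda>x. u n x - w x))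
      = kinetic v (u n) - kinetic v (\<lambda>x. u n x - w x)" for n
    using kinetic_decomp[OF u[of n], of v] kinetic_decomp[OF H_half_diff[OF u[of n] w], of v] by (simp add: right_diff_distrib)
  ultimately show ?thesis using kinetic_decomp[OF w, of v] by simp
qed

lemma Lr_integral_split:
  fixes u :: "nat \<Rightarrow> real \<Rightarrow> complex"
  assumes r: "2 \<le> r" "r \<le> 4" and u: "\<And>n. u n \<in> H_half" and w: "w \<in> H_half"
    and ae: "AE x in lborel. (\<lambda>n. u n x) \<longlonglongrightarrow> w x"
    and B: "\<And>n. Lr_integral r (\<lambda>x. u n x - w x) \<le> B"
  shows "(\<lambda>n. Lr_integral r (u n) - Lr_integral r (\<lambda>x. u n x - w x)) \<longlonglongrightarrow> Lr_integral r w"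
  unfolding Lr_integral_def
proof (rule Brezis_Lieb[OF _ _ _ ae])
  show "(LINT x|lborel. cmod (u n x - w x) powr r) \<le> B" for n using B by (simp add: Lr_integral_def)
qed (use r H_half_Lr_integrable[OF u r] H_half_Lr_integrable[OF w r] H_half_Lr_integrable[OF H_half_diff[OF u w] r]
    L2_measurable[OF H_half_L2[OF u]] L2_measurable[OF H_half_L2[OF w]] in auto)

section \<open>Positivity and non-vanishing\<close>

lemma kinetic_0_pos:
  assumes w: "w \<in> H_half" and m: "0 < mass w"
  shows "0 < kinetic 0 w"
proof (rule ccontr)
  assume "\<not> 0 < kinetic 0 w"
  then have "kinetic 0 w = 0" using kinetic_0_nonneg[of w] by linarith
  then have "(LINT \<xi>|lborel. \<bar>\<xi>\<bar> * (cmod (fourier w \<xi>))\<^sup>2) = 0" by (simp only: kinetic_0)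
  then have "AE \<xi> in lborel. \<bar>\<xi>\<bar> * (cmod (fourier w \<xi>))\<^sup>2 = 0"
    by (subst (asm) integral_nonneg_eq_0_iff_AE[OF H_half_integrable_abs[OF w]]) auto
  moreover have "AE \<xi> in lborel. \<xi> \<noteq> (0::real)" by (rule AE_lborel_singleton)
  ultimately have "AE \<xi> in lborel. (cmod (fourier w \<xi>))\<^sup>2 = 0" by eventually_elim simp
  then have "mass (fourier w) = 0" unfolding mass_def by (subst integral_eq_zero_AE) auto
  then show False using m mass_fourier[OF H_half_L2[OF w]] by simp
qed

lemma kinetic_pos:
  assumes "w \<in> H_half" "0 < mass w" "\<bar>v\<bar> < 1"
  shows "0 < kinetic v w"
  using kinetic_lower(1)[OF assms(1), of v] mult_pos_pos[of "1 - \<bar>v\<bar>" "kinetic 0 w"] kinetic_0_pos[OF assms(1,2)] assms(3)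
  by linarith

text \<open>An energy of at most e forces the integral of |u|^(p+1) to be at least -e. If no window
  carried more than \<mu>, the quartic bound and interpolation would make that integral
  smaller.\<close>

lemma nonvanishing:
  assumes v: "\<bar>v\<bar> < 1" and pq: "1 < q" "q < p" "p < 3" and A: "0 \<le> A" and B: "0 \<le> B" and e: "e < 0"
  obtains \<mu> where "0 < \<mu>" "\<And>u. u \<in> H_half \<Longrightarrow> mass u \<le> A \<Longrightarrow> kinetic 0 u \<le> B \<Longrightarrow> energy v p q u \<le> e \<Longrightarrow>
    \<exists>x. ennreal \<mu> < local_mass u x"
proof -
  \<comment> \<open>The budget -e is halved: \<delta> spends at most one half on the mass, and \<mu>
    below strictly less than the other half on the \<open>L^4\<close> integral.\<close>
  define \<delta> where "\<delta> = - e / (2 * (A + 1))"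
  have \<delta>: "0 < \<delta>" "\<delta> * A \<le> - e / 2" using e A by (auto simp: \<delta>_def field_simps)
  obtain C where C: "0 \<le> C" "\<And>u. u \<in> H_half \<Longrightarrow> Lr_integral (p + 1) u \<le> \<delta> * mass u + C * Lr_integral 4 u"
    using Lr_interpolate'[of "p + 1" \<delta>] pq \<delta> by auto
  define K where "K = C * 16 * (gagliardo_real * B + A)"
  have K: "0 \<le> K" using C A B gagliardo_real(1) by (simp add: K_def)
  define \<mu> where "\<mu> = - e / (4 * (K + 1))"
  have \<mu>: "0 < \<mu>" "\<mu> * K < - e / 2" using e K mult_nonneg_nonpos[of K e] by (auto simp: \<mu>_def field_simps)
  show ?thesis
  proof (rule that[OF \<mu>(1)], rule ccontr)
    fix u assume u: "u \<in> H_half" and mA: "mass u \<le> A" and kB: "kinetic 0 u \<le> B" and en: "energy v p q u \<le> e"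
      and none: "\<not> (\<exists>x. ennreal \<mu> < local_mass u x)"
    note nn = mass_nonneg[of u] kinetic_0_nonneg[of u] Lr_integral_nonneg[of _ u]
    have "Lr_integral 4 u \<le> 16 * \<mu> * (gagliardo_real * kinetic 0 u + mass u)"
      using none by (intro H_half_L4(2)[OF u \<mu>(1)]) (simp add: not_less)
    also have "\<dots> \<le> 16 * \<mu> * (gagliardo_real * B + A)"
      using mA kB \<mu>(1) gagliardo_real(1) by (intro mult_left_mono add_mono) auto
    finally have "C * Lr_integral 4 u \<le> C * (16 * \<mu> * (gagliardo_real * B + A))" using C(1) by (intro mult_left_mono)
    also have "\<dots> = \<mu> * K" by (simp add: K_def mult_ac)
    finally have 1: "C * Lr_integral 4 u \<le> \<mu> * K" .
    have 2: "\<delta> * mass u \<le> \<delta> * A" using \<delta>(1) mA by (intro mult_left_mono) auto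
    have "1 / (p + 1) * Lr_integral (p + 1) u \<le> Lr_integral (p + 1) u"
      using pq nn(3)[of "p + 1"] by (intro mult_left_le_one_le) auto
    moreover have "0 \<le> 1 / (q + 1) * Lr_integral (q + 1) u" using pq nn(3)[of "q + 1"] by simp
    moreover have "0 \<le> kinetic v u" using kinetic_lower(1)[OF u, of v] mult_nonneg_nonneg[of "1 - \<bar>v\<bar>" "kinetic 0 u"] v nn(2) by linarith
    ultimately have "- e \<le> Lr_integral (p + 1) u" using en unfolding energy_eq by linarith
    also have "\<dots> \<le> \<delta> * mass u + C * Lr_integral 4 u" by (rule C(2)[OF u])
    also have "\<dots> < - e" using 1 2 \<delta>(2) \<mu>(2) by linarith
    finally show False by simp
  qed
qed

text \<open>From |u|^2 \<le> \<epsilon> |u|^4 + 1 / \<epsilon> on [0, 1], the \<open>L^4\<close>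
  bound prevents concentration. Almost everywhere convergence to zero would thus drive the mass in
  this window to zero.\<close>

lemma local_mass_limit_pos:
  fixes u :: "nat \<Rightarrow> real \<Rightarrow> complex"
  assumes u: "\<And>n. u n \<in> H_half" and w: "w \<in> H_half"
    and ae: "AE x in lborel. (\<lambda>n. u n x) \<longlonglongrightarrow> w x"
    and B: "\<And>n. Lr_integral 4 (u n) \<le> B" and \<mu>: "0 < \<mu>" "\<And>n. ennreal \<mu> < local_mass (u n) 0"
  shows "0 < mass w"
proof (rule ccontr)
  note [measurable] = L2_measurable[OF H_half_L2[OF u]] L2_measurable[OF H_half_L2[OF w]]
  assume "\<not> 0 < mass w"
  then have "mass w = 0" using mass_nonneg[of w] by simp
  then have "nmass (\<lambda>x. w x - 0) = 0" using nmass_eq_mass[OF H_half_L2[OF w]] by simp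
  then have w0: "AE x in lborel. w x = 0" by (intro nmass_diff_0_AE) auto
  have "(\<lambda>n. \<integral>\<^sup>+x. ennreal (indicator {0..1} x * (cmod (u n x))\<^sup>2) \<partial>lborel) \<longlonglongrightarrow> 0"
  proof (rule vanishing_nn_integral[where G = "\<lambda>n x. cmod (u n x) powr 4" and H = "indicator {0..1}"])
    show "AE x in lborel. (\<lambda>n. indicator {0..1} x * (cmod (u n x))\<^sup>2) \<longlonglongrightarrow> 0"
      using ae w0
    proof eventually_elim
      case (elim x)
      have "(\<lambda>n. indicator {0..1} x * (cmod (u n x))\<^sup>2) \<longlonglongrightarrow> indicator {0..1} x * (cmod (w x))\<^sup>2"
        by (intro tendsto_intros elim(1))
      then show ?case using elim(2) by simp
    qed
    show "(\<integral>\<^sup>+x. ennreal (cmod (u n x) powr 4) \<partial>lborel) \<le> ennreal B" for n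
      using B[of n] H_half_Lr_integrable[OF u[of n], of 4] unfolding Lr_integral_def
      by (subst nn_integral_eq_integral) (auto intro: ennreal_leI simp del: powr_numeral)
    show "(\<integral>\<^sup>+x. ennreal (indicator {0..1::real} x) \<partial>lborel) < \<infinity>"
      by (simp add: ennreal_indicator)
    fix \<epsilon> :: real assume \<epsilon>: "0 < \<epsilon>"
    have "indicator {0..1} x * (cmod (u n x))\<^sup>2 \<le> \<epsilon> * cmod (u n x) powr 4 + 1 / \<epsilon> * indicator {0..1} x" for n x
    proof -
      have "(cmod (u n x))\<^sup>2 * 1 \<le> \<epsilon> * ((cmod (u n x))\<^sup>2)\<^sup>2 + 1 / \<epsilon> * 1\<^sup>2"
        by (rule product_le_weighted_squares[OF \<epsilon>]) auto
      moreover have "((cmod (u n x))\<^sup>2)\<^sup>2 = cmod (u n x) powr 4" by (simp flip: power_mult)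
      ultimately show ?thesis using \<epsilon> by (simp add: indicator_def)
    qed
    then show "\<exists>C\<ge>0. \<forall>n x. indicator {0..1} x * (cmod (u n x))\<^sup>2 \<le> \<epsilon> * cmod (u n x) powr 4 + C * indicator {0..1} x"
      using \<epsilon> by (intro exI[of _ "1 / \<epsilon>"]) auto
  qed auto
  moreover have "(\<integral>\<^sup>+x. ennreal (indicator {0..1} x * (cmod (u n x))\<^sup>2) \<partial>lborel) = local_mass (u n) 0" for n
    unfolding local_mass_def by (intro nn_integral_cong) (auto simp: indicator_def)
  ultimately have "(\<lambda>n. local_mass (u n) 0) \<longlonglongrightarrow> 0" by simp
  from eventually_happens[OF ennreal_tendsto_0D[OF this \<mu>(1)]] \<mu>(2) show False
    by (auto dest: less_asym)
qed

section \<open>Compactness of minimising sequences and stability\<close>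

lemma mass_diff_le:
  assumes "u \<in> L2" "w \<in> L2"
  shows "mass (\<lambda>x. u x - w x) \<le> 2 * mass u + 2 * mass w"
proof -
  have "ennreal (mass (\<lambda>x. u x - w x)) \<le> ennreal (2 * mass u + 2 * mass w)"
    using nmass_diff_le[of u w] assms
    by (simp add: nmass_eq_mass L2_diff L2_measurable mass_nonneg ennreal_double_add[symmetric] del: ennreal_plus)
  then show ?thesis by (subst (asm) ennreal_le_iff) (simp_all add: mass_nonneg)
qed

lemma kinetic_0_diff_le:
  assumes u: "u \<in> H_half" and w: "w \<in> H_half"
  shows "kinetic 0 (\<lambda>x. u x - w x) \<le> 2 * kinetic 0 u + 2 * kinetic 0 w"
proof -
  have "ennreal (kinetic 0 (\<lambda>x. u x - w x)) \<le> ennreal (2 * kinetic 0 u + 2 * kinetic 0 w)"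
    using nkin_diff_le[OF H_half_L2[OF u] H_half_L2[OF w]] nkin_eq_kinetic[OF u] nkin_eq_kinetic[OF w] nkin_eq_kinetic[OF H_half_diff[OF u w]]
    by (simp add: kinetic_0_nonneg ennreal_double_add[symmetric] del: ennreal_plus)
  then show ?thesis by (subst (asm) ennreal_le_iff) (simp_all add: kinetic_0_nonneg)
qed

lemma sphere_L2_iff:
  assumes "0 < \<rho>"
  shows "u \<in> sphere_L2 \<rho> \<longleftrightarrow> u \<in> H_half \<and> mass u = \<rho>\<^sup>2"
proof -
  have "L2_norm u = \<rho> \<longleftrightarrow> mass u = \<rho>\<^sup>2"
    using assms mass_nonneg[of u] real_sqrt_unique[of \<rho> "mass u"] by (auto simp: L2_norm_def mass_def)
  then show ?thesis by (auto simp: sphere_L2_def)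
qed

text \<open>
  The mass-normalising dilation leaves the kinetic part unchanged in dimension one, whence this
  quantitative form of strict subadditivity.
\<close>

lemma energy_lower_by_dilation:
  assumes \<rho>: "0 < \<rho>" and min: "\<And>z. z \<in> sphere_L2 \<rho> \<Longrightarrow> e \<le> energy v p q z"
    and u: "u \<in> H_half" and m: "0 < mass u"
  shows "mass u / \<rho>\<^sup>2 * e + (1 - mass u / \<rho>\<^sup>2) / 2 * kinetic v u \<le> energy v p q u"
proof -
  \<comment> \<open>The factor by which the dilation has to multiply the mass to reach the
    sphere.\<close>
  define l where "l = \<rho>\<^sup>2 / mass u"
  have l: "0 < l" using \<rho> m by (simp add: l_def)
  have "(\<lambda>x. u (x / l)) \<in> sphere_L2 \<rho>"
    using H_half_dilate[OF u l] m by (simp add: sphere_L2_iff[OF \<rho>] mass_dilate[OF l]) (simp add: l_def)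
  from min[OF this] have "e \<le> l * energy v p q u - (l - 1) / 2 * kinetic v u"
    by (simp add: energy_dilate[OF H_half_L2[OF u] l])
  then have "(1 / l) * e \<le> (1 / l) * (l * energy v p q u - (l - 1) / 2 * kinetic v u)"
    using l by (intro mult_left_mono) auto
  also have "\<dots> = energy v p q u - (1 - 1 / l) / 2 * kinetic v u"
    using l by (simp add: right_diff_distrib diff_divide_distrib left_diff_distrib)
  finally have "(1 / l) * e + (1 - 1 / l) / 2 * kinetic v u \<le> energy v p q u" by simp
  moreover have "1 / l = mass u / \<rho>\<^sup>2" by (simp add: l_def)
  ultimately show ?thesis by simp
qed

theorem minimizing_sequence_compactness:
  fixes u :: "nat \<Rightarrow> real \<Rightarrow> complex"
  assumes v: "\<bar>v\<bar> < 1" and pq: "1 < q" "q < p" "p < 3" and \<rho>: "0 < \<rho>" and e: "e < 0"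
    and min: "\<And>z. z \<in> sphere_L2 \<rho> \<Longrightarrow> e \<le> energy v p q z"
    and u: "\<And>n. u n \<in> H_half" and um: "(\<lambda>n. mass (u n)) \<longlonglongrightarrow> \<rho>\<^sup>2"
    and ue: "(\<lambda>n. energy v p q (u n)) \<longlonglongrightarrow> e"
  obtains r y w where "strict_mono (r :: nat \<Rightarrow> nat)" "w \<in> sphere_L2 \<rho>" "energy v p q w = e"
    "(\<lambda>n. H_half_norm (\<lambda>x. u (r n) (x + y n) - w x)) \<longlonglongrightarrow> 0"
proof -
  obtain A where A: "\<And>n. mass (u n) \<le> A"
    using convergent_imp_Bseq[OF convergentI[OF um]] by (auto simp: Bseq_def abs_le_iff)
  obtain E0 where E0: "\<And>n. energy v p q (u n) \<le> E0"
    using convergent_imp_Bseq[OF convergentI[OF ue]] by (auto simp: Bseq_def abs_le_iff)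
  have A0: "0 \<le> A" using A[of 0] mass_nonneg[of "u 0"] by simp
  obtain B where B: "\<And>n. kinetic 0 (u n) \<le> B"
    using kinetic_bounded_by_energy[OF v pq A0, of E0] u A E0 by metis
  have B0: "0 \<le> B" using B[of 0] kinetic_0_nonneg[of "u 0"] by simp
  obtain \<mu> where \<mu>: "0 < \<mu>" "\<And>u. u \<in> H_half \<Longrightarrow> mass u \<le> A \<Longrightarrow> kinetic 0 u \<le> B \<Longrightarrow> energy v p q u \<le> e / 2 \<Longrightarrow>
    \<exists>x. ennreal \<mu> < local_mass u x"
    using nonvanishing[OF v pq A0 B0, of "e / 2"] e by auto
  \<comment> \<open>As e is negative, the level e / 2 lies above the limit of the energies, so
    non-vanishing applies from some index N on.\<close>
  have "e < e / 2" using e by simp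
  from order_tendstoD(2)[OF ue this] obtain N where N: "\<And>n. n \<ge> N \<Longrightarrow> energy v p q (u n) < e / 2"
    by (auto simp: eventually_sequentially)
  have "\<exists>x. ennreal \<mu> < local_mass (u (n + N)) x" for n
    by (intro \<mu>(2) u A B less_imp_le[OF N]) simp
  then obtain c where c: "\<And>n. ennreal \<mu> < local_mass (u (n + N)) (c n)" by metis
  \<comment> \<open>Recentring moves the window of mass above \<mu> to [0, 1], which keeps the limit
    from vanishing.\<close>
  define U where "U n = (\<lambda>x. u (n + N) (x + c n))" for n
  have UH: "U n \<in> H_half" and Um: "mass (U n) = mass (u (n + N))" and Uk: "kinetic 0 (U n) = kinetic 0 (u (n + N))"
    and Ue: "energy v p q (U n) = energy v p q (u (n + N))" for n
    unfolding U_def using H_half_translate[OF u] mass_translate translate_invariance(2)[OF H_half_L2[OF u]] energy_translate[OF H_half_L2[OF u]]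
    by auto
  have Ul: "ennreal \<mu> < local_mass (U n) 0" for n
    using c[of n] by (simp add: U_def local_mass_def add.commute)
  have "mass (U n) \<le> A" "kinetic 0 (U n) \<le> B" for n using A B by (simp_all add: Um Uk)
  from H_half_local_compactness[of U A B, OF UH this]
  obtain r0 w where r0: "strict_mono r0" and w: "w \<in> H_half" and ae: "AE x in lborel. (\<lambda>n. U (r0 n) x) \<longlonglongrightarrow> w x"
    by blast
  define V where "V n = U (r0 n)" for n
  define d where "d n = (\<lambda>x. V n x - w x)" for n
  have V: "V n \<in> H_half" for n by (simp add: V_def UH)
  have dH: "d n \<in> H_half" for n unfolding d_def by (rule H_half_diff[OF V w])
  have ae: "AE x in lborel. (\<lambda>n. V n x) \<longlonglongrightarrow> w x" using ae by (simp add: V_def)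
  have sub: "strict_mono (\<lambda>n. r0 n + N)" using r0 by (simp add: strict_mono_def)
  have Vm: "(\<lambda>n. mass (V n)) \<longlonglongrightarrow> \<rho>\<^sup>2"
    using LIMSEQ_subseq_LIMSEQ[OF um sub] by (simp add: V_def Um o_def)
  have Ve: "(\<lambda>n. energy v p q (V n)) \<longlonglongrightarrow> e"
    using LIMSEQ_subseq_LIMSEQ[OF ue sub] by (simp add: V_def Ue o_def)
  have VA: "mass (V n) \<le> A" and VB: "kinetic 0 (V n) \<le> B" for n using A B by (simp_all add: V_def Um Uk)
  have wpos: "0 < mass w"
    by (rule local_mass_limit_pos[OF V w ae L4_bounded[OF V VA VB] \<mu>(1)]) (simp add: V_def Ul)
  have Tw: "0 < kinetic v w" by (rule kinetic_pos[OF w wpos v])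
  define A' where "A' = 2 * A + 2 * mass w"
  define B' where "B' = 2 * B + 2 * kinetic 0 w"
  have dA: "mass (d n) \<le> A'" for n
    using mass_diff_le[OF H_half_L2[OF V[of n]] H_half_L2[OF w]] VA[of n] by (simp add: d_def A'_def)
  have dB: "kinetic 0 (d n) \<le> B'" for n
    using kinetic_0_diff_le[OF V[of n] w] VB[of n] by (simp add: d_def B'_def)
  have dT: "0 \<le> kinetic v (d n)" for n
    using kinetic_lower(1)[OF dH[of n], of v] mult_nonneg_nonneg[OF _ kinetic_0_nonneg[of "d n"], of "1 - \<bar>v\<bar>"] v by linarith
  have "(\<lambda>n. mass (V n) - mass (d n)) \<longlonglongrightarrow> mass w"
    using Lr_integral_split[of 2 V w A', OF _ _ V w ae] dA by (simp add: Lr_integral_2 d_def)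
  from tendsto_diff[OF Vm this] have dm: "(\<lambda>n. mass (d n)) \<longlonglongrightarrow> \<rho>\<^sup>2 - mass w" by simp
  have T: "(\<lambda>n. kinetic v (V n) - kinetic v (d n)) \<longlonglongrightarrow> kinetic v w"
    using kinetic_split[OF V w ae, of A' B' v] dA dB by (simp add: d_def)
  have L: "(\<lambda>n. Lr_integral s (V n) - Lr_integral s (d n)) \<longlonglongrightarrow> Lr_integral s w" if s: "2 < s" "s < 4" for s
  proof -
    obtain M where "\<And>u. u \<in> H_half \<Longrightarrow> mass u \<le> A' \<Longrightarrow> kinetic 0 u \<le> B' \<Longrightarrow> Lr_integral s u \<le> M"
      using Lr_bounded[OF s, of A' B'] by blast
    then have "Lr_integral s (\<lambda>x. V n x - w x) \<le> M" for n using dH dA dB by (simp add: d_def)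
    from Lr_integral_split[OF _ _ V w ae this] s show ?thesis by (simp add: d_def)
  qed
  have "(\<lambda>n. 1 / 2 * (kinetic v (V n) - kinetic v (d n)) + 1 / (q + 1) * (Lr_integral (q + 1) (V n) - Lr_integral (q + 1) (d n))
      - 1 / (p + 1) * (Lr_integral (p + 1) (V n) - Lr_integral (p + 1) (d n)))
    \<longlonglongrightarrow> 1 / 2 * kinetic v w + 1 / (q + 1) * Lr_integral (q + 1) w - 1 / (p + 1) * Lr_integral (p + 1) w"
    using pq by (intro tendsto_diff tendsto_add tendsto_mult_left T L) auto
  moreover have "1 / 2 * (kinetic v (V n) - kinetic v (d n)) + 1 / (q + 1) * (Lr_integral (q + 1) (V n) - Lr_integral (q + 1) (d n))
      - 1 / (p + 1) * (Lr_integral (p + 1) (V n) - Lr_integral (p + 1) (d n)) = energy v p q (V n) - energy v p q (d n)" for n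
    unfolding energy_eq by (simp only: right_diff_distrib)
  ultimately have "(\<lambda>n. energy v p q (V n) - energy v p q (d n)) \<longlonglongrightarrow> energy v p q w"
    unfolding energy_eq[of v p q w] by simp
  from tendsto_diff[OF Ve this] have de: "(\<lambda>n. energy v p q (d n)) \<longlonglongrightarrow> e - energy v p q w" by simp
  have b0: "0 \<le> \<rho>\<^sup>2 - mass w"
    by (rule LIMSEQ_le_const[OF dm]) (auto intro: mass_nonneg)
  \<comment> \<open>Otherwise the dilation bound is strict for w, whose kinetic form is positive,
    and holds weakly in the limit for d. The two mass fractions add up to 1, so the sum of the
    bounds reads e < e.\<close>
  have b: "\<rho>\<^sup>2 - mass w = 0"
  proof (rule ccontr)
    assume "\<rho>\<^sup>2 - mass w \<noteq> 0"
    then have bpos: "0 < \<rho>\<^sup>2 - mass w" using b0 by simp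
    have \<rho>2: "0 < \<rho>\<^sup>2" using \<rho> by simp
    have "0 < (1 - mass w / \<rho>\<^sup>2) / 2 * kinetic v w" using bpos Tw \<rho>2 by (simp add: field_simps)
    then have E1: "mass w / \<rho>\<^sup>2 * e < energy v p q w"
      using energy_lower_by_dilation[OF \<rho> min w wpos] by linarith
    \<comment> \<open>The limit of the masses of d lies strictly between 0 and \<rho>^2, so
      eventually d has positive mass and the kinetic correction has the right sign.\<close>
    have "\<rho>\<^sup>2 - mass w < \<rho>\<^sup>2" using wpos by simp
    from eventually_conj[OF order_tendstoD(1)[OF dm bpos] order_tendstoD(2)[OF dm this]]
    have "\<forall>\<^sub>F n in sequentially. mass (d n) / \<rho>\<^sup>2 * e \<le> energy v p q (d n)"
    proof (rule eventually_mono)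
      fix n assume a: "0 < mass (d n) \<and> mass (d n) < \<rho>\<^sup>2"
      then have "mass (d n) / \<rho>\<^sup>2 \<le> 1" using \<rho>2 by (simp add: less_imp_le)
      then have "0 \<le> (1 - mass (d n) / \<rho>\<^sup>2) / 2 * kinetic v (d n)" by (intro mult_nonneg_nonneg dT) simp
      then show "mass (d n) / \<rho>\<^sup>2 * e \<le> energy v p q (d n)"
        using energy_lower_by_dilation[OF \<rho> min dH conjunct1[OF a]] by linarith
    qed
    moreover have "(\<lambda>n. mass (d n) / \<rho>\<^sup>2 * e) \<longlonglongrightarrow> (\<rho>\<^sup>2 - mass w) / \<rho>\<^sup>2 * e"
      using \<rho>2 by (intro tendsto_intros dm) auto
    ultimately have "(\<rho>\<^sup>2 - mass w) / \<rho>\<^sup>2 * e \<le> e - energy v p q w"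
      using tendsto_le[OF sequentially_bot de] by blast
    moreover have "(\<rho>\<^sup>2 - mass w) / \<rho>\<^sup>2 * e = e - mass w / \<rho>\<^sup>2 * e"
      using \<rho>2 by (simp add: diff_divide_distrib left_diff_distrib)
    ultimately show False using E1 by linarith
  qed
  then have wm: "mass w = \<rho>\<^sup>2" by simp
  have ws: "w \<in> sphere_L2 \<rho>" using w wm by (simp add: sphere_L2_iff[OF \<rho>])
  have dm0: "(\<lambda>n. mass (d n)) \<longlonglongrightarrow> 0" using dm b by simp
  have dL: "(\<lambda>n. Lr_integral s (d n)) \<longlonglongrightarrow> 0" if "2 < s" "s < 4" for s
    by (rule Lr_integral_tendsto_0[OF that dH dB dm0])
  \<comment> \<open>This is the energy solved for the kinetic form. With the \<open>L^r\<close>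
    terms gone, its limit is 2 (e - energy of w); nonnegativity then shows that w is a minimiser,
    and minimality that the limit is 0.\<close>
  have "(\<lambda>n. 2 * (energy v p q (d n) - 1 / (q + 1) * Lr_integral (q + 1) (d n) + 1 / (p + 1) * Lr_integral (p + 1) (d n)))
     \<longlonglongrightarrow> 2 * (e - energy v p q w - 1 / (q + 1) * 0 + 1 / (p + 1) * 0)"
    using pq by (intro tendsto_diff tendsto_add tendsto_mult_left de dL) auto
  then have dTl: "(\<lambda>n. kinetic v (d n)) \<longlonglongrightarrow> 2 * (e - energy v p q w)"
    unfolding energy_eq[of v p q "d _"] by simp
  have "0 \<le> 2 * (e - energy v p q w)" by (rule LIMSEQ_le_const[OF dTl]) (auto intro: dT)
  then have "energy v p q w \<le> e" by simp
  then have we: "energy v p q w = e" using min[OF ws] by (rule antisym)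
  have dT0: "(\<lambda>n. kinetic v (d n)) \<longlonglongrightarrow> 0" using dTl we by simp
  have up: "(\<lambda>n. mass (d n) + 1 / (1 - \<bar>v\<bar>) * kinetic v (d n)) \<longlonglongrightarrow> 0"
    using tendsto_add[OF dm0 tendsto_mult_left[OF dT0, of "1 / (1 - \<bar>v\<bar>)"]] by simp
  have "norm ((H_half_norm (d n))\<^sup>2) \<le> mass (d n) + 1 / (1 - \<bar>v\<bar>) * kinetic v (d n)" for n
  proof -
    have "(1 / (1 - \<bar>v\<bar>)) * ((1 - \<bar>v\<bar>) * kinetic 0 (d n)) \<le> (1 / (1 - \<bar>v\<bar>)) * kinetic v (d n)"
      using v by (intro mult_left_mono kinetic_lower(1)[OF dH]) auto
    then have "kinetic 0 (d n) \<le> 1 / (1 - \<bar>v\<bar>) * kinetic v (d n)" using v by simp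
    then show ?thesis using H_half_norm_bounds(3)[OF dH[of n]] by simp
  qed
  from Lim_null_comparison[OF always_eventually[OF allI, OF this] up]
  have "(\<lambda>n. (H_half_norm (d n))\<^sup>2) \<longlonglongrightarrow> 0" .
  from tendsto_real_sqrt[OF this] have "(\<lambda>n. H_half_norm (d n)) \<longlonglongrightarrow> 0"
    using H_half_norm_bounds(4)[OF dH] by simp
  then show ?thesis
    using that[of "\<lambda>n. r0 n + N" w "\<lambda>n. c (r0 n)"] sub ws we by (simp add: d_def V_def U_def)
qed

section \<open>Conservation laws and orbital stability\<close>

text \<open>A given solution agrees with the one supplied by well-posedness only up to a null set at
  each time. All invariants depend on the class alone, and the transforms even coincide as
  functions.\<close>

lemma conservation:
  assumes wp: "globally_well_posed p q" and \<phi>: "\<phi> \<in> H_half" and sol: "global_solution p q \<phi> \<psi>"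
  shows "\<psi> t \<in> H_half" "mass (\<psi> t) = mass \<phi>" "energy v p q (\<psi> t) = energy v p q \<phi>"
proof -
  have en: "energy v p q z = energy 0 p q z - v / 2 * momentum z" if "z \<in> H_half" for z
    using kinetic_decomp[OF that, of v] by (simp add: energy_eq field_simps)
  obtain \<theta> where \<theta>: "global_solution p q \<phi> \<theta>"
    "\<And>t. AE x in lborel. \<psi> t x = \<theta> t x"
    "\<And>t. mass (\<theta> t) = mass \<phi>" "\<And>t. energy 0 p q (\<theta> t) = energy 0 p q \<phi>" "\<And>t. momentum (\<theta> t) = momentum \<phi>"
    using wp \<phi> sol unfolding globally_well_posed_def by blast
  have H: "\<psi> t \<in> H_half" "\<theta> t \<in> H_half" using sol \<theta>(1) by (auto simp: global_solution_def)
  show "\<psi> t \<in> H_half" by (rule H)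
  note [measurable] = L2_measurable[OF H_half_L2[OF H(1)]] L2_measurable[OF H_half_L2[OF H(2)]]
  have F: "fourier (\<psi> t) = fourier (\<theta> t)" by (rule fourier_cong_AE[OF \<theta>(2)]) measurable
  have Lr: "Lr_integral r (\<psi> t) = Lr_integral r (\<theta> t)" for r
    unfolding Lr_integral_def by (rule integral_cong_AE) (use \<theta>(2)[of t] in auto)
  show "mass (\<psi> t) = mass \<phi>" using Lr[of 2] \<theta>(3)[of t] by (simp add: Lr_integral_2)
  have "energy 0 p q (\<psi> t) = energy 0 p q \<phi>" using \<theta>(4)[of t] by (simp add: energy_eq Lr kinetic_def F)
  moreover have "momentum (\<psi> t) = momentum \<phi>" using \<theta>(5)[of t] by (simp add: momentum_def F)
  ultimately show "energy v p q (\<psi> t) = energy v p q \<phi>" using en[OF H(1)] en[OF \<phi>] by simp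
qed

theorem corollary1p6:
  fixes v p q \<rho>0 \<rho> :: real
  assumes "\<bar>v\<bar> < 1" and "1 < q" and "q < p" and "p < 3"
    and well_posed: "globally_well_posed p q"
    and "0 < \<rho>0"
    and "\<And>r. r \<in> {0<..\<rho>0} \<Longrightarrow> min_energy v p q r = 0"
    and "\<And>r. r \<in> {\<rho>0<..} \<Longrightarrow> min_energy v p q r < 0"
    and "\<rho>0 < \<rho>"
  shows "\<forall>\<epsilon>::real. 0 < \<epsilon> \<longrightarrow>
          (\<exists>\<delta>::real. 0 < \<delta> \<and>
            (\<forall>\<psi>0\<in>H_half. H_half_dist_set \<psi>0 (ground_states v p q \<rho>) < ereal \<delta> \<longrightarrow>
              (\<forall>\<psi>. global_solution p q \<psi>0 \<psi> \<longrightarrow>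
                (SUP t. H_half_dist_set (\<psi> t) (ground_states v p q \<rho>)) < ereal \<epsilon>)))"
proof (intro allI impI, rule ccontr)
  fix \<epsilon> :: real assume \<epsilon>: "0 < \<epsilon>"
  note v = assms(1) and pq = assms(2-4)
  have \<rho>: "0 < \<rho>" using assms(6,9) by simp
  let ?G = "ground_states v p q \<rho>"
  assume neg: "\<not> (\<exists>\<delta>::real. 0 < \<delta> \<and>
            (\<forall>\<psi>0\<in>H_half. H_half_dist_set \<psi>0 ?G < ereal \<delta> \<longrightarrow>
              (\<forall>\<psi>. global_solution p q \<psi>0 \<psi> \<longrightarrow> (SUP t. H_half_dist_set (\<psi> t) ?G) < ereal \<epsilon>)))"
  have "\<exists>\<phi> \<psi> t. \<phi> \<in> H_half \<and> H_half_dist_set \<phi> ?G < ereal (1 / real (Suc n)) \<and> global_solution p q \<phi> \<psi> \<and>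
      ereal (\<epsilon> / 2) < H_half_dist_set (\<psi> t) ?G" for n
  proof -
    obtain \<phi> \<psi> where 1: "\<phi> \<in> H_half" "H_half_dist_set \<phi> ?G < ereal (1 / real (Suc n))" "global_solution p q \<phi> \<psi>"
      and 2: "\<not> (SUP t. H_half_dist_set (\<psi> t) ?G) < ereal \<epsilon>"
      using neg by (metis of_nat_0_less_iff zero_less_Suc zero_less_divide_1_iff)
    \<comment> \<open>A supremum of at least \<epsilon> need not be attained; a single bad time is
      guaranteed only at a strictly lower level.\<close>
    have "ereal (\<epsilon> / 2) < ereal \<epsilon>" using \<epsilon> by simp
    also have "\<dots> \<le> (SUP t. H_half_dist_set (\<psi> t) ?G)" using 2 by simp
    finally obtain t where "ereal (\<epsilon> / 2) < H_half_dist_set (\<psi> t) ?G" by (auto simp: less_SUP_iff)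
    with 1 show ?thesis by blast
  qed
  then obtain \<phi> \<psi> t where \<phi>: "\<And>n. \<phi> n \<in> H_half" "\<And>n. H_half_dist_set (\<phi> n) ?G < ereal (1 / real (Suc n))"
    and \<psi>: "\<And>n. global_solution p q (\<phi> n) (\<psi> n)" "\<And>n. ereal (\<epsilon> / 2) < H_half_dist_set (\<psi> n (t n)) ?G"
    by metis
  have "\<exists>z\<in>?G. H_half_norm (\<lambda>x. \<phi> n x - z x) < 1 / real (Suc n)" for n
    using \<phi>(2)[of n] by (auto simp: H_half_dist_set_def INF_less_iff)
  then obtain z where z: "\<And>n. z n \<in> ?G" "\<And>n. H_half_norm (\<lambda>x. \<phi> n x - z n x) < 1 / real (Suc n)" by metis
  \<comment> \<open>A finite distance to the ground states means that this set is not empty. Its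
    members supply a minimiser, so the infimum is a real number.\<close>
  obtain u0 where u0: "u0 \<in> sphere_L2 \<rho>" "ereal (energy v p q u0) = min_energy v p q \<rho>"
    using z(1)[of 0] by (auto simp: ground_states_def)
  define e where "e = energy v p q u0"
  have e_min: "min_energy v p q \<rho> = ereal e" using u0 by (simp add: e_def)
  have e: "e < 0" using assms(8)[of \<rho>] assms(9) by (simp add: e_min)
  have min: "e \<le> energy v p q y" if "y \<in> sphere_L2 \<rho>" for y
  proof -
    have "min_energy v p q \<rho> \<le> ereal (energy v p q y)"
      unfolding min_energy_def by (rule INF_lower[OF that])
    then show ?thesis by (simp add: e_min)
  qed
  have G: "y \<in> H_half \<and> mass y = \<rho>\<^sup>2 \<and> energy v p q y = e" if mem: "y \<in> ?G" for y
  proof -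
    obtain \<gamma> s u where y: "y = (\<lambda>x. cis \<gamma> * u (x + s))" and u: "u \<in> sphere_L2 \<rho>" "ereal (energy v p q u) = min_energy v p q \<rho>"
      using mem unfolding ground_states_def by blast
    have ue: "energy v p q u = e" using u(2) e_min by simp
    have uH: "u \<in> H_half" "mass u = \<rho>\<^sup>2" using u(1) by (auto simp: sphere_L2_iff[OF \<rho>])
    have c: "cmod (cis \<gamma>) = 1" by simp
    show ?thesis unfolding y
      using H_half_phase[OF H_half_translate[OF uH(1)] c] mass_phase[OF c] mass_translate[of u s] uH ue
        energy_phase[OF H_half_L2[OF H_half_translate[OF uH(1)]] c] energy_translate[OF H_half_L2[OF uH(1)]]
      by simp
  qed
  have zH: "z n \<in> H_half" and zm: "mass (z n) = \<rho>\<^sup>2" and ze: "energy v p q (z n) = e" for n using G[OF z(1)] by auto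
  obtain B where B: "\<And>n. kinetic 0 (z n) \<le> B"
    using kinetic_bounded_by_energy[OF v pq, of "\<rho>\<^sup>2" e] zH zm ze by (metis order_refl zero_le_power2)
  have lim: "(\<lambda>n. H_half_norm (\<lambda>x. \<phi> n x - z n x)) \<longlonglongrightarrow> 0"
    using z(2) H_half_norm_bounds(4)[OF H_half_diff[OF \<phi>(1) zH]]
    by (intro Lim_null_comparison[OF _ LIMSEQ_Suc[OF lim_1_over_n]] always_eventually) (auto intro: less_imp_le)
  have \<phi>e: "(\<lambda>n. energy v p q (\<phi> n)) \<longlonglongrightarrow> e" and \<phi>m: "(\<lambda>n. mass (\<phi> n)) \<longlonglongrightarrow> \<rho>\<^sup>2"
    using energy_close[OF v pq \<phi>(1) zH eq_refl[OF zm] B lim] by (simp_all add: zm ze LIM_zero_iff)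
  define u where "u n = \<psi> n (t n)" for n
  note cons = conservation[OF well_posed \<phi>(1) \<psi>(1)]
  have uH: "u n \<in> H_half" for n unfolding u_def by (rule cons(1))
  have um: "(\<lambda>n. mass (u n)) \<longlonglongrightarrow> \<rho>\<^sup>2" unfolding u_def cons(2) by (rule \<phi>m)
  have ue: "(\<lambda>n. energy v p q (u n)) \<longlonglongrightarrow> e" unfolding u_def cons(3) by (rule \<phi>e)
  obtain r y w where r: "strict_mono (r :: nat \<Rightarrow> nat)" and w: "w \<in> sphere_L2 \<rho>" "energy v p q w = e"
    and conv: "(\<lambda>n. H_half_norm (\<lambda>x. u (r n) (x + y n) - w x)) \<longlonglongrightarrow> 0"
    by (rule minimizing_sequence_compactness[OF v pq \<rho> e min uH um ue])
  have wH: "w \<in> H_half" using w(1) by (simp add: sphere_L2_def)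
  have "\<epsilon> / 2 < H_half_norm (\<lambda>x. u (r n) (x + y n) - w x)" for n
  proof -
    \<comment> \<open>Translated back, the limit profile is a ground state, and translation
      invariance of the norm transfers the lower bound \<epsilon> / 2 to the recentred
      sequence.\<close>
    let ?w = "\<lambda>x. w (x + - y n)"
    have "?w \<in> ?G"
      unfolding ground_states_def using w e_min by (intro CollectI exI[of _ 0] exI[of _ "- y n"] exI[of _ w]) simp
    then have "H_half_dist_set (u (r n)) ?G \<le> ereal (H_half_norm (\<lambda>x. u (r n) x - ?w x))"
      unfolding H_half_dist_set_def by (rule INF_lower)
    also have "H_half_norm (\<lambda>x. u (r n) x - ?w x) = H_half_norm (\<lambda>x. u (r n) (x + y n) - w x)"
      using translate_invariance(4)[OF L2_diff[OF H_half_L2[OF uH] L2_translate[OF H_half_L2[OF wH]]], of "r n" "y n" "- y n"] by simp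
    finally show ?thesis using \<psi>(2)[of "r n"] unfolding u_def by (metis less_le_trans less_ereal.simps(1))
  qed
  then have "\<epsilon> / 2 \<le> 0" using LIMSEQ_le_const[OF conv] by (metis less_imp_le)
  then show False using \<epsilon> by simp
qed

end
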